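(* Let $R$ be a Gorenstein local ring of Krull dimension $d \geq 2$. Then every maximal Cohen-Macaulay $R$-module $M$ that is locally free on the punctured spectrum (i.e. $M_{\mathfrak p}$ is a free $R_{\mathfrak p}$-module for every non-maximal prime $\mathfrak p$) belongs to $\mathcal{E}(R)$, that is, $\underline{\mathrm{ann}}_R(M) = \mathrm{ARann}_R(M)$.
   Context: All rings are commutative Noetherian local and all modules finitely generated. For $R$-modules $X,Y$, let $P(X,Y)\subseteq \mathrm{Hom}_R(X,Y)$ be the submodule of homomorphisms factoring through a projective (= free) module, and $\underline{\mathrm{Hom}}_R(X,Y)=\mathrm{Hom}_R(X,Y)/P(X,Y)$, $\underline{\mathrm{End}}_R(X)=\underline{\mathrm{Hom}}_R(X,X)$. The stable annihilator is $\underline{\mathrm{ann}}_R(M)=\mathrm{ann}_R\underline{\mathrm{End}}_R(M)$. The Auslander-Reiten annihilator is $\mathrm{ARann}_R(M)=\bigcap_{i>0}\mathrm{ann}_R\mathrm{Ext}^i_R(M,M\oplus R)$. $\mathcal{E}(R)$ denotes the full subcategory of finitely generated $R$-modules $M$ with $\underline{\mathrm{ann}}_R(M)=\mathrm{ARann}_R(M)$. *)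

theory Defs
  imports Main "HOL-Library.Function_Algebras" "HOL-Library.Product_Plus"
begin

text \<open>The ring R is the whole type 'a (class comm_ring_1).  An R-module is a carrier
  set M of an abelian-group type 'm together with a scalar action s.\<close>

definition is_module :: "'m::ab_group_add set \<Rightarrow> ('a::comm_ring_1 \<Rightarrow> 'm \<Rightarrow> 'm) \<Rightarrow> bool" where
  "is_module M s \<longleftrightarrow> 0 \<in> M \<and> (\<forall>x\<in>M. \<forall>y\<in>M. x + y \<in> M) \<and> (\<forall>x\<in>M. - x \<in> M)
     \<and> (\<forall>a. \<forall>x\<in>M. s a x \<in> M)
     \<and> (\<forall>a b. \<forall>x\<in>M. s (a + b) x = s a x + s b x)
     \<and> (\<forall>a. \<forall>x\<in>M. \<forall>y\<in>M. s a (x + y) = s a x + s a y)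
     \<and> (\<forall>a b. \<forall>x\<in>M. s (a * b) x = s a (s b x))
     \<and> (\<forall>x\<in>M. s 1 x = x)"

definition is_hom :: "'m::ab_group_add set \<Rightarrow> ('a::comm_ring_1 \<Rightarrow> 'm \<Rightarrow> 'm)
    \<Rightarrow> 'n::ab_group_add set \<Rightarrow> ('a \<Rightarrow> 'n \<Rightarrow> 'n) \<Rightarrow> ('m \<Rightarrow> 'n) \<Rightarrow> bool" where
  "is_hom M s N t f \<longleftrightarrow> (\<forall>x\<in>M. f x \<in> N) \<and> (\<forall>x\<in>M. \<forall>y\<in>M. f (x + y) = f x + f y)
     \<and> (\<forall>a. \<forall>x\<in>M. f (s a x) = t a (f x))"

definition fin_gen :: "'m::ab_group_add set \<Rightarrow> ('a::comm_ring_1 \<Rightarrow> 'm \<Rightarrow> 'm) \<Rightarrow> bool" where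
  "fin_gen M s \<longleftrightarrow> (\<exists>gs. set gs \<subseteq> M \<and>
     (\<forall>x\<in>M. \<exists>cs. length cs = length gs \<and> x = (\<Sum>j<length gs. s (cs ! j) (gs ! j))))"

definition freemod :: "nat \<Rightarrow> (nat \<Rightarrow> 'a::comm_ring_1) set" where
  "freemod n = {v. \<forall>i\<ge>n. v i = 0}"

definition fsmult :: "'a::comm_ring_1 \<Rightarrow> (nat \<Rightarrow> 'a) \<Rightarrow> (nat \<Rightarrow> 'a)" where
  "fsmult a v = (\<lambda>i. a * v i)"

definition factors_free :: "'m::ab_group_add set \<Rightarrow> ('a::comm_ring_1 \<Rightarrow> 'm \<Rightarrow> 'm)
    \<Rightarrow> 'n::ab_group_add set \<Rightarrow> ('a \<Rightarrow> 'n \<Rightarrow> 'n) \<Rightarrow> ('m \<Rightarrow> 'n) \<Rightarrow> bool" where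
  "factors_free M s N t g \<longleftrightarrow> (\<exists>n h k. is_hom M s (freemod n) fsmult h
      \<and> is_hom (freemod n) fsmult N t k \<and> (\<forall>x\<in>M. g x = k (h x)))"

text \<open>Stable annihilator: ann of End(M)/P(M,M).\<close>
definition stable_ann :: "'m::ab_group_add set \<Rightarrow> ('a::comm_ring_1 \<Rightarrow> 'm \<Rightarrow> 'm) \<Rightarrow> 'a set" where
  "stable_ann M s = {r. \<forall>f. is_hom M s M s f \<longrightarrow> factors_free M s M s (\<lambda>x. s r (f x))}"

definition acyclic_free_cx :: "(nat \<Rightarrow> nat) \<Rightarrow> (nat \<Rightarrow> (nat \<Rightarrow> 'a::comm_ring_1) \<Rightarrow> (nat \<Rightarrow> 'a)) \<Rightarrow> bool" where
  "acyclic_free_cx rk d \<longleftrightarrow>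
     (\<forall>i. is_hom (freemod (rk (Suc i))) fsmult (freemod (rk i)) fsmult (d (Suc i)))
   \<and> (\<forall>i. d (Suc (Suc i)) ` freemod (rk (Suc (Suc i))) = {x \<in> freemod (rk (Suc i)). d (Suc i) x = 0})"

definition free_res :: "'m::ab_group_add set \<Rightarrow> ('a::comm_ring_1 \<Rightarrow> 'm \<Rightarrow> 'm)
    \<Rightarrow> (nat \<Rightarrow> nat) \<Rightarrow> (nat \<Rightarrow> (nat \<Rightarrow> 'a) \<Rightarrow> (nat \<Rightarrow> 'a)) \<Rightarrow> ((nat \<Rightarrow> 'a) \<Rightarrow> 'm) \<Rightarrow> bool" where
  "free_res M s rk d eps \<longleftrightarrow> acyclic_free_cx rk d
     \<and> is_hom (freemod (rk 0)) fsmult M s eps \<and> eps ` freemod (rk 0) = M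
     \<and> d (Suc 0) ` freemod (rk (Suc 0)) = {x \<in> freemod (rk 0). eps x = 0}"

text \<open>Annihilator of the cohomology H^(j+1)(Hom(F,N)): r kills the class of every
  cocycle f : F_(j+1) \<rightarrow> N, i.e. r f is a coboundary g \<circ> d_(j+1).\<close>
definition cx_ext_ann :: "(nat \<Rightarrow> nat) \<Rightarrow> (nat \<Rightarrow> (nat \<Rightarrow> 'a::comm_ring_1) \<Rightarrow> (nat \<Rightarrow> 'a))
    \<Rightarrow> 'n::ab_group_add set \<Rightarrow> ('a \<Rightarrow> 'n \<Rightarrow> 'n) \<Rightarrow> nat \<Rightarrow> 'a set" where
  "cx_ext_ann rk d N t j = {r. \<forall>f. is_hom (freemod (rk (Suc j))) fsmult N t f
       \<and> (\<forall>x\<in>freemod (rk (Suc (Suc j))). f (d (Suc (Suc j)) x) = 0)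
     \<longrightarrow> (\<exists>g. is_hom (freemod (rk j)) fsmult N t g
            \<and> (\<forall>x\<in>freemod (rk (Suc j)). t r (f x) = g (d (Suc j) x)))}"

text \<open>ann_R Ext^(j+1)_R(M,N), computed from (any) free resolution of M.\<close>
definition ext_ann :: "'m::ab_group_add set \<Rightarrow> ('a::comm_ring_1 \<Rightarrow> 'm \<Rightarrow> 'm)
    \<Rightarrow> 'n::ab_group_add set \<Rightarrow> ('a \<Rightarrow> 'n \<Rightarrow> 'n) \<Rightarrow> nat \<Rightarrow> 'a set" where
  "ext_ann M s N t j = {r. \<forall>rk d eps. free_res M s rk d eps \<longrightarrow> r \<in> cx_ext_ann rk d N t j}"

definition sum_smult :: "('a::comm_ring_1 \<Rightarrow> 'm \<Rightarrow> 'm) \<Rightarrow> 'a \<Rightarrow> 'm \<times> 'a \<Rightarrow> 'm \<times> 'a" where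
  "sum_smult s r p = (s r (fst p), r * snd p)"

definition AR_ann :: "'m::ab_group_add set \<Rightarrow> ('a::comm_ring_1 \<Rightarrow> 'm \<Rightarrow> 'm) \<Rightarrow> 'a set" where
  "AR_ann M s = (\<Inter>j. ext_ann M s (M \<times> (UNIV :: 'a set)) (sum_smult s) j)"

definition is_ideal :: "'a::comm_ring_1 set \<Rightarrow> bool" where
  "is_ideal I \<longleftrightarrow> 0 \<in> I \<and> (\<forall>x\<in>I. \<forall>y\<in>I. x + y \<in> I) \<and> (\<forall>a. \<forall>x\<in>I. a * x \<in> I)"

definition prime_ideal :: "'a::comm_ring_1 set \<Rightarrow> bool" where
  "prime_ideal P \<longleftrightarrow> is_ideal P \<and> 1 \<notin> P \<and> (\<forall>a b. a * b \<in> P \<longrightarrow> a \<in> P \<or> b \<in> P)"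

definition maximal_ideal :: "'a::comm_ring_1 set \<Rightarrow> bool" where
  "maximal_ideal m \<longleftrightarrow> is_ideal m \<and> 1 \<notin> m \<and> (\<forall>J. is_ideal J \<and> m \<subseteq> J \<longrightarrow> J = m \<or> 1 \<in> J)"

definition noetherian_ring :: "'a::comm_ring_1 itself \<Rightarrow> bool" where
  "noetherian_ring _ \<longleftrightarrow> (\<forall>I::'a set. is_ideal I \<longrightarrow> fin_gen I (\<lambda>a x. a * x))"

definition local_ring :: "'a::comm_ring_1 itself \<Rightarrow> bool" where
  "local_ring _ \<longleftrightarrow> (\<exists>!m::'a set. maximal_ideal m)"

definition max_ideal :: "'a::comm_ring_1 itself \<Rightarrow> 'a set" where
  "max_ideal _ = (THE m. maximal_ideal m)"

definition prime_chain :: "nat \<Rightarrow> (nat \<Rightarrow> 'a::comm_ring_1 set) \<Rightarrow> bool" where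
  "prime_chain n P \<longleftrightarrow> (\<forall>i\<le>n. prime_ideal (P i)) \<and> (\<forall>i<n. P i \<subset> P (Suc i))"

definition krull_dim_eq :: "'a::comm_ring_1 itself \<Rightarrow> nat \<Rightarrow> bool" where
  "krull_dim_eq T d \<longleftrightarrow> (\<exists>P::nat \<Rightarrow> 'a set. prime_chain d P) \<and> \<not> (\<exists>P::nat \<Rightarrow> 'a set. prime_chain (Suc d) P)"

definition seq_submod :: "'m::ab_group_add set \<Rightarrow> ('a::comm_ring_1 \<Rightarrow> 'm \<Rightarrow> 'm) \<Rightarrow> 'a list \<Rightarrow> nat \<Rightarrow> 'm set" where
  "seq_submod M s xs j = {(\<Sum>k<j. s (xs ! k) (ys k)) | ys. \<forall>k<j. ys k \<in> M}"

definition regular_seq :: "'m::ab_group_add set \<Rightarrow> ('a::comm_ring_1 \<Rightarrow> 'm \<Rightarrow> 'm) \<Rightarrow> 'a list \<Rightarrow> bool" where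
  "regular_seq M s xs \<longleftrightarrow> set xs \<subseteq> max_ideal TYPE('a)
     \<and> (\<forall>j<length xs. \<forall>y\<in>M. s (xs ! j) y \<in> seq_submod M s xs j \<longrightarrow> y \<in> seq_submod M s xs j)
     \<and> seq_submod M s xs (length xs) \<noteq> M"

definition depth_eq :: "'m::ab_group_add set \<Rightarrow> ('a::comm_ring_1 \<Rightarrow> 'm \<Rightarrow> 'm) \<Rightarrow> nat \<Rightarrow> bool" where
  "depth_eq M s n \<longleftrightarrow> (\<exists>xs. length xs = n \<and> regular_seq M s xs)
     \<and> \<not> (\<exists>xs. length xs = Suc n \<and> regular_seq M s xs)"

definition max_CM :: "'m::ab_group_add set \<Rightarrow> ('a::comm_ring_1 \<Rightarrow> 'm \<Rightarrow> 'm) \<Rightarrow> bool" where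
  "max_CM M s \<longleftrightarrow> (\<exists>n. krull_dim_eq TYPE('a) n \<and> depth_eq M s n)"

text \<open>Gorenstein: Noetherian local with injdim_R R < \<infinity>, where injdim_R R \<le> n means
  Ext^i_R(X,R) = 0 for all i > n and all f.g. X; X is presented via an arbitrary
  free resolution (an acyclic complex of f.g. free modules, X = coker d_1).\<close>
definition gorenstein :: "'a::comm_ring_1 itself \<Rightarrow> bool" where
  "gorenstein T \<longleftrightarrow> noetherian_ring T \<and> local_ring T \<and>
     (\<exists>n. \<forall>rk (d :: nat \<Rightarrow> (nat \<Rightarrow> 'a) \<Rightarrow> (nat \<Rightarrow> 'a)). acyclic_free_cx rk d \<longrightarrow>
        (\<forall>j\<ge>n. (1::'a) \<in> cx_ext_ann rk d (UNIV :: 'a set) (\<lambda>a x. a * x) j))"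

text \<open>M_p is a free R_p-module, written out on representatives: elements x_1..x_k of M
  whose images x_i/1 form an R_p-basis of M_p.\<close>
definition free_at :: "'m::ab_group_add set \<Rightarrow> ('a::comm_ring_1 \<Rightarrow> 'm \<Rightarrow> 'm) \<Rightarrow> 'a set \<Rightarrow> bool" where
  "free_at M s p \<longleftrightarrow> (\<exists>xs. set xs \<subseteq> M
     \<and> (\<forall>y\<in>M. \<exists>as u w. length as = length xs \<and> u \<notin> p \<and> w \<notin> p
            \<and> s w (s u y - (\<Sum>j<length xs. s (as ! j) (xs ! j))) = 0)
     \<and> (\<forall>as. length as = length xs \<longrightarrow>
            (\<exists>w. w \<notin> p \<and> s w (\<Sum>j<length xs. s (as ! j) (xs ! j)) = 0) \<longrightarrow>
            (\<forall>j<length xs. \<exists>w. w \<notin> p \<and> w * as ! j = 0)))"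

definition locally_free_punctured :: "'m::ab_group_add set \<Rightarrow> ('a::comm_ring_1 \<Rightarrow> 'm \<Rightarrow> 'm) \<Rightarrow> bool" where
  "locally_free_punctured M s \<longleftrightarrow>
     (\<forall>p. prime_ideal p \<and> p \<noteq> max_ideal TYPE('a) \<longrightarrow> free_at M s p)"

end

theory Submission
  imports Defs
begin

text \<open>The inclusion of the stable annihilator in the Auslander--Reiten annihilator is a chain homotopy:
  if multiplication by \<open>r\<close> on \<open>M\<close> factors through a free module, then multiplication by \<open>r\<close> on a
  free resolution is null-homotopic in positive degrees.

  The converse is a concrete form of Auslander--Reiten duality. Since \<open>M\<close> is locally free on the
  punctured spectrum, its stable annihilator lies in no prime other than the maximal one, so it
  contains a regular sequence \<open>x\<close> of maximal length \<open>t\<close>, and \<open>R / x\<close> has a socle. A local ring of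
  finite injective dimension with a socle is self-injective; hence \<open>R / x\<close> is self-injective, \<open>R\<close> has
  injective dimension at most \<open>t\<close>, \<open>Ext\<close> of \<open>M\<close> into \<open>R\<close> vanishes in positive degrees, \<open>M\<close> is a syzygy
  of arbitrarily high order, and \<open>t\<close> is the dimension. Extend a resolution of \<open>M\<close> to the right
  accordingly. A stable endomorphism that does not factor through a free module is detected modulo
  \<open>x\<close> by a trace pairing; moving each \<open>x\<^sub>i\<close> from one side of the pairing to the other shifts the
  degree by one, and after \<open>t\<close> steps the pairing is with a class in \<open>Ext\<close> of \<open>M\<close> with itself in
  degree \<open>t - 1 \<ge> 1\<close>. If \<open>r\<close> kills that group, it kills the stable endomorphisms.\<close>

section \<open>Modules, free modules and linear maps\<close>

text \<open>The ring is a type, so its quotients and localisations are not types of their own and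
  everything stays over R. A complex over R/J is a sequence of matrices over R whose identities hold
  modulo J, a functional is a coefficient vector, and localisation enters only through common
  denominators. Number the extended resolution so that M is presented in degree 0. A stable
  endomorphism is then paired with classes of degree -1 with coefficients in M/xM; the extension to
  the right is what makes this degree available, and t steps lead from it to degree t - 1. The
  obstacle is that the partner of the endomorphism is a cocycle only modulo x, whereas
  \<open>r\<close> is known to act as zero on genuine classes of M. The defect is traded element by
  element for one of the other factor, harmless because the trace is taken modulo x anyway. This
  needs each \<open>x i\<close> to be regular modulo the other elements in any order, and
  multiplication by \<open>x i\<close> on M to pass through a free module, which is why the sequence
  is chosen inside the stable annihilator. Reduction modulo x costs up to t positions at the low end
  of the complex, so the extension has length t + 2.\<close>

lemma is_moduleD:
  assumes "is_module M s"
  shows "0 \<in> M" "x \<in> M \<Longrightarrow> y \<in> M \<Longrightarrow> x + y \<in> M" "x \<in> M \<Longrightarrow> - x \<in> M"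
    "x \<in> M \<Longrightarrow> s a x \<in> M" "x \<in> M \<Longrightarrow> s (a + b) x = s a x + s b x"
    "x \<in> M \<Longrightarrow> y \<in> M \<Longrightarrow> s a (x + y) = s a x + s a y"
    "x \<in> M \<Longrightarrow> s (a * b) x = s a (s b x)" "x \<in> M \<Longrightarrow> s 1 x = x"
  using assms unfolding is_module_def by blast+

lemma module_diff: "is_module M s \<Longrightarrow> x \<in> M \<Longrightarrow> y \<in> M \<Longrightarrow> x - y \<in> M"
  using is_moduleD(2,3)[of M s] by (metis diff_conv_add_uminus)

lemma module_smult_zero_left: "is_module M s \<Longrightarrow> x \<in> M \<Longrightarrow> s 0 x = 0"
  using is_moduleD(5)[of M s x 0 0] by simp

lemma module_smult_zero_right: "is_module M s \<Longrightarrow> s a 0 = 0"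
  using is_moduleD(6)[of M s 0 0 a] is_moduleD(1)[of M s] by simp

lemma module_smult_minus_right: "is_module M s \<Longrightarrow> x \<in> M \<Longrightarrow> s a (- x) = - s a x"
  using is_moduleD(6)[of M s x "- x" a] module_smult_zero_right[of M s a] is_moduleD(3)[of M s x]
  by (simp add: eq_neg_iff_add_eq_0 add.commute)

lemma module_smult_minus_left: "is_module M s \<Longrightarrow> x \<in> M \<Longrightarrow> s (- a) x = - s a x"
  using is_moduleD(5)[of M s x a "- a"] module_smult_zero_left[of M s x]
  by (simp add: eq_neg_iff_add_eq_0 add.commute)

lemma module_smult_diff_right:
  "is_module M s \<Longrightarrow> x \<in> M \<Longrightarrow> y \<in> M \<Longrightarrow> s a (x - y) = s a x - s a y"
  using is_moduleD(6)[of M s x "- y" a] is_moduleD(3)[of M s y] module_smult_minus_right[of M s y a]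
  by simp

lemma module_smult_diff_left:
  "is_module M s \<Longrightarrow> x \<in> M \<Longrightarrow> s (a - b) x = s a x - s b x"
  using is_moduleD(5)[of M s x a "- b"] module_smult_minus_left[of M s x b] by simp

lemma module_sum: "is_module M s \<Longrightarrow> (\<And>i. i \<in> A \<Longrightarrow> f i \<in> M) \<Longrightarrow> (\<Sum>i\<in>A. f i) \<in> M"
  by (induction A rule: infinite_finite_induct) (auto simp: is_moduleD)

lemma module_smult_sum:
  "is_module M s \<Longrightarrow> (\<And>i. i \<in> A \<Longrightarrow> f i \<in> M) \<Longrightarrow> s a (\<Sum>i\<in>A. f i) = (\<Sum>i\<in>A. s a (f i))"
  by (induction A rule: infinite_finite_induct)
    (auto simp: is_moduleD module_sum module_smult_zero_right)

lemma is_homD: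
  assumes "is_hom M s N t f"
  shows "x \<in> M \<Longrightarrow> f x \<in> N" "x \<in> M \<Longrightarrow> y \<in> M \<Longrightarrow> f (x + y) = f x + f y"
    "x \<in> M \<Longrightarrow> f (s a x) = t a (f x)"
  using assms unfolding is_hom_def by blast+

lemma hom_zero: "is_module M s \<Longrightarrow> is_hom M s N t f \<Longrightarrow> f 0 = 0"
  using is_homD(2)[of M s N t f 0 0] is_moduleD(1)[of M s] by simp

lemma hom_minus: "is_module M s \<Longrightarrow> is_hom M s N t f \<Longrightarrow> x \<in> M \<Longrightarrow> f (- x) = - f x"
  using is_homD(2)[of M s N t f x "- x"] is_moduleD(3)[of M s x] hom_zero[of M s N t f]
  by (simp add: eq_neg_iff_add_eq_0 add.commute)

lemma hom_diff:
  "is_module M s \<Longrightarrow> is_hom M s N t f \<Longrightarrow> x \<in> M \<Longrightarrow> y \<in> M \<Longrightarrow> f (x - y) = f x - f y"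
  using is_homD(2)[of M s N t f x "- y"] is_moduleD(3)[of M s y] hom_minus[of M s N t f y]
  by simp

lemma hom_sum:
  "is_module M s \<Longrightarrow> is_hom M s N t f \<Longrightarrow> (\<And>i. i \<in> A \<Longrightarrow> g i \<in> M) \<Longrightarrow>
    f (\<Sum>i\<in>A. g i) = (\<Sum>i\<in>A. f (g i))"
  by (induction A rule: infinite_finite_induct) (auto simp: hom_zero is_homD module_sum)

lemma hom_comp:
  "is_hom M s N t f \<Longrightarrow> is_hom N t P u g \<Longrightarrow> is_hom M s P u (\<lambda>x. g (f x))"
  unfolding is_hom_def by auto

lemma hom_add:
  assumes "is_module N t" "is_hom M s N t f" "is_hom M s N t g"
  shows "is_hom M s N t (\<lambda>x. f x + g x)"
  using assms(2,3) is_moduleD(2,6)[OF assms(1)] unfolding is_hom_def by (auto simp: algebra_simps)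

lemma hom_smult:
  fixes t :: "'a::comm_ring_1 \<Rightarrow> 'n::ab_group_add \<Rightarrow> 'n"
  assumes "is_module N t" "is_hom M s N t f"
  shows "is_hom M s N t (\<lambda>x. t r (f x))"
proof -
  have "t r (t a y) = t a (t r y)" if "y \<in> N" for a y
    using is_moduleD(7)[OF assms(1) that, of r a] is_moduleD(7)[OF assms(1) that, of a r]
    by (simp add: mult.commute)
  thus ?thesis
    using assms(2) is_moduleD(4,6)[OF assms(1)] unfolding is_hom_def by auto
qed

lemma hom_sub:
  assumes "is_module N t" "is_hom M s N t f" "is_hom M s N t g"
  shows "is_hom M s N t (\<lambda>x. f x - g x)"
  using assms(2,3) module_diff[OF assms(1)] module_smult_diff_right[OF assms(1)]
  unfolding is_hom_def by (auto simp: algebra_simps)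

lemma hom_image_module:
  assumes "is_module M s" "is_module N t" "is_hom M s N t f" shows "is_module (f ` M) t"
  unfolding is_module_def
proof (intro conjI ballI allI)
  show "0 \<in> f ` M" using hom_zero[OF assms(1,3)] is_moduleD(1)[OF assms(1)] by force
next
  fix x y assume "x \<in> f ` M" "y \<in> f ` M"
  then show "x + y \<in> f ` M"
    using is_homD(2)[OF assms(3)] is_moduleD(2)[OF assms(1)] by (metis (no_types, lifting) image_iff)
next
  fix x assume "x \<in> f ` M" then show "- x \<in> f ` M"
    using hom_minus[OF assms(1,3)] is_moduleD(3)[OF assms(1)] by (metis (no_types, lifting) image_iff)
next
  fix x a assume "x \<in> f ` M" then show "t a x \<in> f ` M"
    using is_homD(3)[OF assms(3)] is_moduleD(4)[OF assms(1)] by (metis (no_types, lifting) image_iff)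
qed (use assms(2) is_homD(1)[OF assms(3)] in \<open>auto simp: is_moduleD\<close>)

lemma hom_vimage_module:
  assumes "is_module M s" "is_module N t" "is_hom M s N t f" "is_module Q t"
  shows "is_module {x \<in> M. f x \<in> Q} s"
  using assms(1) is_moduleD[OF assms(4)] hom_zero[OF assms(1,3)] hom_minus[OF assms(1,3)]
    is_homD[OF assms(3)]
  unfolding is_module_def by auto

lemma module_sum_module:
  assumes "is_module M s" "is_module P s" "is_module Q s" "P \<subseteq> M" "Q \<subseteq> M"
  shows "is_module {x + y | x y. x \<in> P \<and> y \<in> Q} s"
proof -
  have sub: "x \<in> P \<Longrightarrow> x \<in> M" "x \<in> Q \<Longrightarrow> x \<in> M" for x using assms by auto
  show ?thesis
    unfolding is_module_def
  proof (intro conjI ballI allI)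
    show "0 \<in> {x + y | x y. x \<in> P \<and> y \<in> Q}"
      using is_moduleD(1)[OF assms(2)] is_moduleD(1)[OF assms(3)] by force
  next
    fix u v assume "u \<in> {x + y | x y. x \<in> P \<and> y \<in> Q}" "v \<in> {x + y | x y. x \<in> P \<and> y \<in> Q}"
    then obtain x y x' y' where "u = x + y" "v = x' + y'" "x \<in> P" "y \<in> Q" "x' \<in> P" "y' \<in> Q" by auto
    then have "u + v = (x + x') + (y + y')" "x + x' \<in> P" "y + y' \<in> Q"
      using is_moduleD(2)[OF assms(2)] is_moduleD(2)[OF assms(3)] by (auto simp: algebra_simps)
    then show "u + v \<in> {x + y | x y. x \<in> P \<and> y \<in> Q}" by blast
  next
    fix u assume "u \<in> {x + y | x y. x \<in> P \<and> y \<in> Q}"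
    then obtain x y where "u = x + y" "x \<in> P" "y \<in> Q" by auto
    then have "- u = (- x) + (- y)" "- x \<in> P" "- y \<in> Q"
      using is_moduleD(3)[OF assms(2)] is_moduleD(3)[OF assms(3)] by auto
    then show "- u \<in> {x + y | x y. x \<in> P \<and> y \<in> Q}" by blast
  next
    fix u a assume "u \<in> {x + y | x y. x \<in> P \<and> y \<in> Q}"
    then obtain x y where "u = x + y" "x \<in> P" "y \<in> Q" by auto
    then have "s a u = s a x + s a y" "s a x \<in> P" "s a y \<in> Q"
      using is_moduleD(4)[OF assms(2)] is_moduleD(4)[OF assms(3)] is_moduleD(6)[OF assms(1)] sub by auto
    then show "s a u \<in> {x + y | x y. x \<in> P \<and> y \<in> Q}" by blast
  qed (use assms(1) sub in \<open>auto simp: is_moduleD\<close>)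
qed

lemma is_module_subset:
  assumes "is_module M s" "N \<subseteq> M" "0 \<in> N" "\<And>x y. x \<in> N \<Longrightarrow> y \<in> N \<Longrightarrow> x + y \<in> N"
    "\<And>a x. x \<in> N \<Longrightarrow> s a x \<in> N"
  shows "is_module N s"
proof -
  have "- x \<in> N" if "x \<in> N" for x
    using assms(5)[OF that, of "- 1"] module_smult_minus_left[OF assms(1), of x 1] assms(2) that
      is_moduleD(8)[OF assms(1)] by auto
  thus ?thesis using assms unfolding is_module_def by (meson subsetD)
qed

lemma ring_module [simp]: "is_module (UNIV :: 'a::comm_ring_1 set) (*)"
  by (auto simp: is_module_def algebra_simps)

lemma ideal_iff_module: "is_ideal I \<longleftrightarrow> is_module I (*)"
proof
  assume "is_ideal I" then show "is_module I (*)"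
    by (intro is_module_subset[OF ring_module]) (auto simp: is_ideal_def)
qed (auto simp: is_ideal_def is_module_def)

lemma fsmult_apply [simp]: "fsmult a v i = a * v i"
  by (simp add: fsmult_def)

lemma sum_fun_apply: "(\<Sum>a\<in>A. f a) i = (\<Sum>a\<in>A. f a i)"
  by (induction A rule: infinite_finite_induct) auto

lemma freemod_module [simp]: "is_module (freemod n) fsmult"
  by (auto simp: is_module_def freemod_def fun_eq_iff algebra_simps)

lemmas fm_zero [simp] = is_moduleD(1)[OF freemod_module]
lemmas fm_add [simp] = is_moduleD(2)[OF freemod_module]
lemmas fm_minus [simp] = is_moduleD(3)[OF freemod_module]
lemmas fm_smult [simp] = is_moduleD(4)[OF freemod_module]
lemmas fm_diff [simp] = module_diff[OF freemod_module]
definition unitv :: "nat \<Rightarrow> nat \<Rightarrow> 'a::comm_ring_1" where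
  "unitv a = (\<lambda>i. if i = a then 1 else 0)"

lemma unitv_in [simp]: "a < n \<Longrightarrow> unitv a \<in> freemod n"
  by (auto simp: unitv_def freemod_def)

lemma unitv_apply: "unitv a i = (if i = a then 1 else 0)"
  by (simp add: unitv_def)

lemma vec_expand: "v \<in> freemod n \<Longrightarrow> v = (\<Sum>a<n. fsmult (v a) (unitv a))"
  by (auto simp: fun_eq_iff sum_fun_apply unitv_def freemod_def if_distrib cong: if_cong)

lemma hom_expand:
  assumes "is_hom (freemod n) fsmult N t f" "v \<in> freemod n"
  shows "f v = (\<Sum>a<n. t (v a) (f (unitv a)))"
proof -
  have "f v = f (\<Sum>a<n. fsmult (v a) (unitv a))" using vec_expand[OF assms(2)] by simp
  also have "\<dots> = (\<Sum>a<n. f (fsmult (v a) (unitv a)))"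
    by (rule hom_sum[OF _ assms(1)]) auto
  also have "\<dots> = (\<Sum>a<n. t (v a) (f (unitv a)))"
    by (rule sum.cong) (auto simp: is_homD(3)[OF assms(1)])
  finally show ?thesis .
qed

definition comb :: "nat \<Rightarrow> ('a::comm_ring_1 \<Rightarrow> 'm \<Rightarrow> 'm::ab_group_add) \<Rightarrow> (nat \<Rightarrow> 'm) \<Rightarrow> (nat \<Rightarrow> 'a) \<Rightarrow> 'm" where
  "comb n t w v = (\<Sum>a<n. t (v a) (w a))"

lemma comb_hom:
  fixes t :: "'a::comm_ring_1 \<Rightarrow> 'n::ab_group_add \<Rightarrow> 'n"
  assumes "is_module N t" "\<And>a. a < n \<Longrightarrow> w a \<in> N"
  shows "is_hom (freemod k) fsmult N t (comb n t w)"
  unfolding is_hom_def comb_def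
proof (intro conjI ballI allI)
  fix x :: "nat \<Rightarrow> 'a"
  show "(\<Sum>a<n. t (x a) (w a)) \<in> N"
    by (rule module_sum[OF assms(1)]) (auto simp: is_moduleD[OF assms(1)] assms(2))
next
  fix x y :: "nat \<Rightarrow> 'a"
  have "(\<Sum>a<n. t ((x + y) a) (w a)) = (\<Sum>a<n. t (x a) (w a) + t (y a) (w a))"
    by (rule sum.cong) (auto simp: is_moduleD[OF assms(1)] assms(2))
  then show "(\<Sum>a<n. t ((x + y) a) (w a)) = (\<Sum>a<n. t (x a) (w a)) + (\<Sum>a<n. t (y a) (w a))"
    by (simp add: sum.distrib)
next
  fix a and x :: "nat \<Rightarrow> 'a"
  have "t a (\<Sum>i<n. t (x i) (w i)) = (\<Sum>i<n. t a (t (x i) (w i)))"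
    by (rule module_smult_sum[OF assms(1)]) (auto simp: is_moduleD[OF assms(1)] assms(2))
  also have "\<dots> = (\<Sum>i<n. t (fsmult a x i) (w i))"
    by (rule sum.cong) (auto simp: is_moduleD[OF assms(1)] assms(2))
  finally show "(\<Sum>i<n. t (fsmult a x i) (w i)) = t a (\<Sum>i<n. t (x i) (w i))" by simp
qed

lemma comb_unitv:
  assumes "is_module N t" "\<And>a. a < n \<Longrightarrow> w a \<in> N" "b < n"
  shows "comb n t w (unitv b) = w b"
proof -
  have "(\<Sum>a<n. t (unitv b a) (w a)) = (\<Sum>a<n. if a = b then w b else 0)"
    by (rule sum.cong)
      (auto simp: unitv_def is_moduleD[OF assms(1)] module_smult_zero_left[OF assms(1)] assms(2))
  thus ?thesis using assms(3) by (simp add: comb_def)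
qed

lemma hom_eqI:
  assumes "is_hom (freemod n) fsmult N t f" "is_hom (freemod n) fsmult N t g"
    "\<And>a. a < n \<Longrightarrow> f (unitv a) = g (unitv a)" "v \<in> freemod n"
  shows "f v = g v"
  using hom_expand[OF assms(1,4)] hom_expand[OF assms(2,4)] assms(3) by simp

lemma hom_into_submodule:
  assumes "is_hom (freemod n) fsmult N t f" "is_module Q t"
    "\<And>a. a < n \<Longrightarrow> f (unitv a) \<in> Q" "v \<in> freemod n"
  shows "f v \<in> Q"
  unfolding hom_expand[OF assms(1,4)]
  by (rule module_sum[OF assms(2)]) (auto simp: is_moduleD[OF assms(2)] assms(3))

text \<open>Projectivity of free modules relative to a submodule \<open>Q\<close>: preimages are
  chosen for the unit vectors alone. Lifts over a quotient ring are the case where \<open>Q\<close>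
  consists of the vectors with entries in an ideal.\<close>

lemma free_lift:
  assumes N: "is_module N t" and Q: "is_module Q t" and f: "is_hom (freemod n) fsmult N t f"
    and P: "is_module P u" and p: "is_hom P u N t p"
    and ex: "\<And>a. a < n \<Longrightarrow> \<exists>w\<in>P. f (unitv a) - p w \<in> Q"
  shows "\<exists>g. is_hom (freemod n) fsmult P u g \<and> (\<forall>v\<in>freemod n. f v - p (g v) \<in> Q)"
proof -
  obtain w where w: "\<And>a. a < n \<Longrightarrow> w a \<in> P \<and> f (unitv a) - p (w a) \<in> Q"
    using ex by metis
  have g: "is_hom (freemod n) fsmult P u (comb n u w)" using comb_hom[OF P] w by blast
  have h: "is_hom (freemod n) fsmult N t (\<lambda>v. f v - p (comb n u w v))"
    by (rule hom_sub[OF N f hom_comp[OF g p]])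
  have "f v - p (comb n u w v) \<in> Q" if "v \<in> freemod n" for v
    by (rule hom_into_submodule[OF h Q _ that]) (use w comb_unitv[OF P] in auto)
  with g show ?thesis by blast
qed

abbreviation lin :: "nat \<Rightarrow> nat \<Rightarrow> ((nat \<Rightarrow> 'a::comm_ring_1) \<Rightarrow> nat \<Rightarrow> 'a) \<Rightarrow> bool" where
  "lin n m f \<equiv> is_hom (freemod n) fsmult (freemod m) fsmult f"

lemmas linD = is_homD[where M = "freemod _" and s = fsmult and N = "freemod _" and t = fsmult]
lemmas lin_zero = hom_zero[OF freemod_module, where N = "freemod _" and t = fsmult]
lemmas lin_minus = hom_minus[OF freemod_module, where N = "freemod _" and t = fsmult]
lemmas lin_diff = hom_diff[OF freemod_module, where N = "freemod _" and t = fsmult]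

lemma lin_comb: "(\<And>a. a < n \<Longrightarrow> w a \<in> freemod m) \<Longrightarrow> lin n m (comb n fsmult w)"
  using comb_hom[OF freemod_module] by blast

lemma comb_unitv_free: "(\<And>a. a < n \<Longrightarrow> w a \<in> freemod m) \<Longrightarrow> b < n \<Longrightarrow> comb n fsmult w (unitv b) = w b"
  by (rule comb_unitv[OF freemod_module])

lemma lin_fsmult [simp]: "lin n n (fsmult x)"
  by (auto simp: is_hom_def fun_eq_iff algebra_simps)

lemma lin_id [simp]: "lin n n (\<lambda>v. v)"
  by (auto simp: is_hom_def)

lemma lin_zero_map [simp]: "lin n m (\<lambda>v. 0)"
  by (auto simp: is_hom_def fun_eq_iff)

subsection \<open>Vectors with entries in an ideal\<close>

lemma idealD:
  assumes "is_ideal J"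
  shows "0 \<in> J" "x \<in> J \<Longrightarrow> y \<in> J \<Longrightarrow> x + y \<in> J" "x \<in> J \<Longrightarrow> a * x \<in> J" "x \<in> J \<Longrightarrow> x * a \<in> J"
    "x \<in> J \<Longrightarrow> - x \<in> J" "x \<in> J \<Longrightarrow> y \<in> J \<Longrightarrow> x - y \<in> J"
proof -
  have J: "is_module J (*)" using assms by (simp add: ideal_iff_module)
  show "x \<in> J \<Longrightarrow> a * x \<in> J" "x \<in> J \<Longrightarrow> x * a \<in> J"
    using is_moduleD(4)[OF J, of x a] by (simp_all add: mult.commute[of x])
qed (use assms is_moduleD(1-3)[of J "(*)"] module_diff[of J "(*)"] in
  \<open>auto simp: ideal_iff_module\<close>)

lemma ideal_sum: "is_ideal J \<Longrightarrow> (\<And>i. i \<in> A \<Longrightarrow> f i \<in> J) \<Longrightarrow> (\<Sum>i\<in>A. f i) \<in> J"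
  by (simp add: ideal_iff_module module_sum)

lemma zero_ideal [simp]: "is_ideal {0}" by (auto simp: is_ideal_def)

text \<open>The kernel of the map from R^n to (R/J)^n: congruence modulo \<open>vecs J n\<close>
  replaces equality over R/J.\<close>

definition vecs :: "'a::comm_ring_1 set \<Rightarrow> nat \<Rightarrow> (nat \<Rightarrow> 'a) set" where
  "vecs J n = {v \<in> freemod n. \<forall>i. v i \<in> J}"

lemma vecs_module: "is_ideal J \<Longrightarrow> is_module (vecs J n) fsmult"
  by (rule is_module_subset[OF freemod_module]) (auto simp: vecs_def idealD)

lemma vecs_sub: "v \<in> vecs J n \<Longrightarrow> v \<in> freemod n" by (simp add: vecs_def)

lemma vecs_zero [simp]: "vecs {0} n = {0}"
  by (auto simp: vecs_def fun_eq_iff)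

lemma vecs_mono: "J \<subseteq> J' \<Longrightarrow> vecs J n \<subseteq> vecs J' n" by (auto simp: vecs_def)

lemma vecsD: "v \<in> vecs J n \<Longrightarrow> v i \<in> J" by (simp add: vecs_def)

lemma lin_vecs:
  assumes "is_ideal J" "lin n m f" "v \<in> vecs J n" shows "f v \<in> vecs J m"
proof -
  have v: "v \<in> freemod n" using assms(3) vecs_sub by blast
  have "f v = (\<Sum>a<n. fsmult (v a) (f (unitv a)))" by (rule hom_expand[OF assms(2) v])
  moreover have "\<dots> \<in> vecs J m"
    by (rule module_sum[OF vecs_module[OF assms(1)]])
      (use assms linD(1)[OF assms(2)] in \<open>auto simp: vecs_def idealD\<close>)
  ultimately show ?thesis by simp
qed

definition adjoin :: "'a::comm_ring_1 set \<Rightarrow> 'a \<Rightarrow> 'a set" where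
  "adjoin J x = {j + x * a | j a. j \<in> J}"

lemma adjoin_ideal: assumes "is_ideal J" shows "is_ideal (adjoin J x)"
  unfolding is_ideal_def adjoin_def
proof (intro conjI ballI allI)
  show "0 \<in> {j + x * a | j a. j \<in> J}" using idealD(1)[OF assms] by (auto intro!: exI[of _ 0])
next
  fix u v assume "u \<in> {j + x * a | j a. j \<in> J}" "v \<in> {j + x * a | j a. j \<in> J}"
  then obtain j a j' a' where "u = j + x * a" "v = j' + x * a'" "j \<in> J" "j' \<in> J" by auto
  then have "u + v = (j + j') + x * (a + a')" "j + j' \<in> J" using idealD[OF assms] by (auto simp: algebra_simps)
  then show "u + v \<in> {j + x * a | j a. j \<in> J}" by blast
next
  fix c u assume "u \<in> {j + x * a | j a. j \<in> J}"
  then obtain j a where "u = j + x * a" "j \<in> J" by auto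
  then have "c * u = c * j + x * (c * a)" "c * j \<in> J" using idealD(3)[OF assms, of j c] by (simp_all add: algebra_simps)
  then show "c * u \<in> {j + x * a | j a. j \<in> J}" by blast
qed

lemma adjoin_sub: "J \<subseteq> adjoin J x"
proof
  fix j assume "j \<in> J" then have "j = j + x * 0 \<and> j \<in> J" by simp
  then show "j \<in> adjoin J x" unfolding adjoin_def by blast
qed

lemma adjoin_mem: "is_ideal J \<Longrightarrow> x * a \<in> adjoin J x"
  using idealD(1)[of J] by (force simp: adjoin_def)

lemma adjoin_vecs:
  assumes "is_ideal J" "v \<in> vecs (adjoin J x) n"
  shows "\<exists>w\<in>freemod n. v - fsmult x w \<in> vecs J n"
proof -
  have "\<forall>i. \<exists>a. v i - x * a \<in> J" using assms(2) by (auto simp: vecs_def adjoin_def) (metis add_diff_cancel_right')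
  then obtain w where w: "\<And>i. v i - x * w i \<in> J" by metis
  have "(\<lambda>i. if i < n then w i else 0) \<in> freemod n" by (simp add: freemod_def)
  moreover have "v - fsmult x (\<lambda>i. if i < n then w i else 0) \<in> vecs J n"
    using w assms by (auto simp: vecs_def freemod_def idealD)
  ultimately show ?thesis by blast
qed

lemma adjoin_vecsI:
  assumes "is_ideal J" "w \<in> freemod n" "v - fsmult x w \<in> vecs J n"
  shows "v \<in> vecs (adjoin J x) n"
proof -
  have "v = (v - fsmult x w) + fsmult x w" by simp
  moreover have "v - fsmult x w \<in> vecs (adjoin J x) n" using assms(3) vecs_mono[OF adjoin_sub] by blast
  moreover have "fsmult x w \<in> vecs (adjoin J x) n"
    using assms(2) adjoin_mem[OF assms(1)] by (auto simp: vecs_def)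
  ultimately show ?thesis using is_moduleD(2)[OF vecs_module[OF adjoin_ideal[OF assms(1)]]] by metis
qed

text \<open>Injectivity of multiplication by \<open>x\<close> on R/J; the zero quotient is
  allowed.\<close>

definition nzd :: "'a::comm_ring_1 set \<Rightarrow> 'a \<Rightarrow> bool" where
  "nzd J x \<longleftrightarrow> (\<forall>a. x * a \<in> J \<longrightarrow> a \<in> J)"

lemma nzd_vecs: "nzd J x \<Longrightarrow> v \<in> freemod n \<Longrightarrow> fsmult x v \<in> vecs J n \<Longrightarrow> v \<in> vecs J n"
  by (auto simp: nzd_def vecs_def)

subsection \<open>Dot products and transposes\<close>

definition dot :: "nat \<Rightarrow> (nat \<Rightarrow> 'a::comm_ring_1) \<Rightarrow> (nat \<Rightarrow> 'a) \<Rightarrow> 'a" where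
  "dot n c v = (\<Sum>i<n. c i * v i)"

lemma dot_add_left: "dot n (c + c') v = dot n c v + dot n c' v"
  by (simp add: dot_def algebra_simps sum.distrib)
lemma dot_add_right: "dot n c (v + v') = dot n c v + dot n c v'"
  by (simp add: dot_def algebra_simps sum.distrib)
lemma dot_diff_left: "dot n (c - c') v = dot n c v - dot n c' v"
  by (simp add: dot_def algebra_simps sum_subtractf)
lemma dot_diff_right: "dot n c (v - v') = dot n c v - dot n c v'"
  by (simp add: dot_def algebra_simps sum_subtractf)
lemma dot_smult_left: "dot n (fsmult a c) v = a * dot n c v"
  by (simp add: dot_def algebra_simps sum_distrib_left)
lemma dot_smult_right: "dot n c (fsmult a v) = a * dot n c v"
  by (simp add: dot_def algebra_simps sum_distrib_left)
lemma dot_zero_left [simp]: "dot n 0 v = 0" by (simp add: dot_def)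
lemma dot_zero_right [simp]: "dot n c 0 = 0" by (simp add: dot_def)
lemma dot_minus_left: "dot n (- c) v = - dot n c v"
  by (simp add: dot_def sum_negf)
lemma dot_minus_right: "dot n c (- v) = - dot n c v"
  by (simp add: dot_def sum_negf)
lemma dot_commute: "dot n c v = dot n v c" by (simp add: dot_def mult.commute)
lemma dot_unitv: "a < n \<Longrightarrow> dot n c (unitv a) = c a"
  by (simp add: dot_def unitv_def if_distrib cong: if_cong)

lemmas dot_simps = dot_add_left dot_add_right dot_diff_left dot_diff_right dot_smult_left
  dot_smult_right dot_minus_left dot_minus_right

lemma dot_vecs_right: "is_ideal J \<Longrightarrow> v \<in> vecs J n \<Longrightarrow> dot k c v \<in> J"
  unfolding dot_def by (rule ideal_sum) (auto simp: idealD vecs_def)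
lemma dot_vecs_left: "is_ideal J \<Longrightarrow> c \<in> vecs J n \<Longrightarrow> dot k c v \<in> J"
  using dot_vecs_right dot_commute by metis

lemma vecsI_dot:
  assumes "is_ideal J" "c \<in> freemod n" "\<And>v. v \<in> freemod n \<Longrightarrow> dot n c v \<in> J"
  shows "c \<in> vecs J n"
proof -
  have "c i \<in> J" for i
  proof (cases "i < n")
    case True then show ?thesis using assms(3)[of "unitv i"] by (simp add: dot_unitv)
  next
    case False then show ?thesis using assms(1,2) by (simp add: freemod_def idealD)
  qed
  thus ?thesis using assms(2) by (simp add: vecs_def)
qed

lemma dot_hom: "is_hom (freemod k) fsmult UNIV (*) (dot n c)"
  by (auto simp: is_hom_def dot_simps)

definition transp :: "nat \<Rightarrow> nat \<Rightarrow> ((nat \<Rightarrow> 'a::comm_ring_1) \<Rightarrow> nat \<Rightarrow> 'a) \<Rightarrow> (nat \<Rightarrow> 'a) \<Rightarrow> nat \<Rightarrow> 'a" where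
  "transp n m f c = (\<lambda>a. if a < n then dot m c (f (unitv a)) else 0)"

lemma lin_transp: "lin k n (transp n m f)"
  by (auto simp: is_hom_def transp_def freemod_def dot_simps fun_eq_iff)

lemma transp_in [simp]: "transp n m f c \<in> freemod n"
  by (auto simp: transp_def freemod_def)

lemma dot_transp:
  assumes "lin n m f" "v \<in> freemod n"
  shows "dot n (transp n m f c) v = dot m c (f v)"
proof -
  have "is_hom (freemod n) fsmult UNIV (*) (\<lambda>v. dot m c (f v))"
    by (rule hom_comp[OF assms(1) dot_hom])
  from hom_expand[OF this assms(2)]
  have "dot m c (f v) = (\<Sum>a<n. v a * dot m c (f (unitv a)))" .
  also have "\<dots> = dot n (transp n m f c) v"
    unfolding dot_def[of n] by (rule sum.cong) (auto simp: transp_def mult.commute)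
  finally show ?thesis by simp
qed

lemma dot_eqI:
  assumes "c \<in> freemod n" "c' \<in> freemod n" "\<And>v. v \<in> freemod n \<Longrightarrow> dot n c v = dot n c' v"
  shows "c = c'"
  using vecsI_dot[of "{0}" "c - c'" n] assms by (simp add: dot_simps)

lemma transp_transp:
  assumes "lin n m f" "v \<in> freemod n" shows "transp m n (transp n m f) v = f v"
proof (rule dot_eqI)
  fix c :: "nat \<Rightarrow> 'a" assume c: "c \<in> freemod m"
  show "dot m (transp m n (transp n m f) v) c = dot m (f v) c"
    using dot_transp[OF lin_transp c, of n m f v] dot_transp[OF assms, of c] by (simp add: dot_commute)
qed (use assms linD(1) in auto)

declare fsmult_apply [simp del]

subsection \<open>Direct sums of free modules\<close>

definition fstv :: "nat \<Rightarrow> (nat \<Rightarrow> 'a::comm_ring_1) \<Rightarrow> nat \<Rightarrow> 'a" where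
  "fstv n v = (\<lambda>i. if i < n then v i else 0)"
definition sndv :: "nat \<Rightarrow> (nat \<Rightarrow> 'a::comm_ring_1) \<Rightarrow> nat \<Rightarrow> 'a" where
  "sndv n v = (\<lambda>i. v (i + n))"
definition pairv :: "nat \<Rightarrow> (nat \<Rightarrow> 'a::comm_ring_1) \<Rightarrow> (nat \<Rightarrow> 'a) \<Rightarrow> nat \<Rightarrow> 'a" where
  "pairv n a b = (\<lambda>i. if i < n then a i else b (i - n))"

lemma fstv_in [simp]: "fstv n v \<in> freemod n" by (simp add: fstv_def freemod_def)
lemma sndv_in [simp]: "v \<in> freemod (n + m) \<Longrightarrow> sndv n v \<in> freemod m"
  by (simp add: sndv_def freemod_def)
lemma pairv_in [simp]: "b \<in> freemod m \<Longrightarrow> pairv n a b \<in> freemod (n + m)"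
  by (simp add: pairv_def freemod_def)
lemma fstv_pairv [simp]: "a \<in> freemod n \<Longrightarrow> fstv n (pairv n a b) = a"
  by (auto simp: fstv_def pairv_def freemod_def)
lemma sndv_pairv [simp]: "sndv n (pairv n a b) = b"
  by (auto simp: sndv_def pairv_def)
lemma pairv_fst_snd [simp]: "pairv n (fstv n v) (sndv n v) = v"
  by (auto simp: fstv_def sndv_def pairv_def)
lemma lin_fstv: "lin k n (fstv n)"
  by (auto simp: is_hom_def fstv_def freemod_def fun_eq_iff fsmult_apply)
lemma lin_sndv: "lin (n + m) m (sndv n)"
  by (auto simp: is_hom_def sndv_def freemod_def fun_eq_iff fsmult_apply)
lemma pairv_add: "pairv n a b + pairv n a' b' = pairv n (a + a') (b + b')"
  by (auto simp: pairv_def)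
lemma pairv_diff: "pairv n a b - pairv n a' b' = pairv n (a - a') (b - b')"
  by (auto simp: pairv_def)
lemma pairv_smult: "fsmult c (pairv n a b) = pairv n (fsmult c a) (fsmult c b)"
  by (auto simp: pairv_def fsmult_apply)
lemma lin_pairv: "lin k n f \<Longrightarrow> lin k m g \<Longrightarrow> lin k (n + m) (\<lambda>v. pairv n (f v) (g v))"
  unfolding is_hom_def by (auto simp: pairv_add pairv_smult)
lemma dot_pairv: "dot (n + m) c v = dot n (fstv n c) (fstv n v) + dot m (sndv n c) (sndv n v)"
proof -
  have "dot (n + m) c v = (\<Sum>i<n. c i * v i) + (\<Sum>i<m. c (i + n) * v (i + n))"
    by (induction m) (auto simp: dot_def algebra_simps)
  thus ?thesis by (simp add: dot_def fstv_def sndv_def)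
qed
lemma vecs_pairv: "a \<in> vecs J n \<Longrightarrow> b \<in> vecs J m \<Longrightarrow> pairv n a b \<in> vecs J (n + m)"
  by (auto simp: vecs_def) (auto simp: pairv_def)
lemma vecs_fstv: "is_ideal J \<Longrightarrow> v \<in> vecs J k \<Longrightarrow> fstv n v \<in> vecs J n"
  by (auto simp: vecs_def) (auto simp: fstv_def idealD)
lemma vecs_sndv: "v \<in> vecs J (n + m) \<Longrightarrow> sndv n v \<in> vecs J m"
  by (auto simp: vecs_def) (auto simp: sndv_def)
section \<open>Noetherian modules\<close>

definition coverable :: "'m::ab_group_add set \<Rightarrow> ('a::comm_ring_1 \<Rightarrow> 'm \<Rightarrow> 'm) \<Rightarrow> bool" where
  "coverable N s \<longleftrightarrow> (\<exists>q g. is_hom (freemod q) fsmult N s g \<and> g ` freemod q = N)"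

lemma fin_gen_coverable:
  fixes s :: "'a::comm_ring_1 \<Rightarrow> 'm::ab_group_add \<Rightarrow> 'm"
  assumes "is_module N s" "fin_gen N s" shows "coverable N s"
proof -
  obtain gs where gs: "set gs \<subseteq> N"
    "\<And>x. x \<in> N \<Longrightarrow> \<exists>cs. length cs = length gs \<and> x = (\<Sum>j<length gs. s (cs ! j) (gs ! j))"
    using assms(2) unfolding fin_gen_def by blast
  let ?g = "comb (length gs) s (\<lambda>j. gs ! j)"
  have h: "is_hom (freemod (length gs)) fsmult N s ?g"
    by (rule comb_hom[OF assms(1)]) (use gs in auto)
  have "x \<in> ?g ` freemod (length gs)" if x: "x \<in> N" for x
  proof -
    obtain cs where cs: "length cs = length gs" "x = (\<Sum>j<length gs. s (cs ! j) (gs ! j))"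
      using gs(2)[OF x] by blast
    have "x = ?g (\<lambda>i. if i < length gs then cs ! i else 0)" by (simp add: cs comb_def)
    moreover have "(\<lambda>i. if i < length gs then cs ! i else 0) \<in> freemod (length gs)"
      by (simp add: freemod_def)
    ultimately show ?thesis by blast
  qed
  then have "?g ` freemod (length gs) = N" using is_homD(1)[OF h] by blast
  thus ?thesis using h unfolding coverable_def by blast
qed

definition noethmod :: "'m::ab_group_add set \<Rightarrow> ('a::comm_ring_1 \<Rightarrow> 'm \<Rightarrow> 'm) \<Rightarrow> bool" where
  "noethmod X s \<longleftrightarrow> is_module X s \<and> (\<forall>N. N \<subseteq> X \<and> is_module N s \<longrightarrow> coverable N s)"

lemma noethmod_cover:
  assumes "noethmod X s" "N \<subseteq> X" "is_module N s"
  obtains q g where "is_hom (freemod q) fsmult N s g" "g ` freemod q = N"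
  using assms unfolding noethmod_def coverable_def by blast

lemma coverable_least:
  assumes "is_hom (freemod q) fsmult N s g" "g ` freemod q = N" "is_module N s" "is_module P s"
    "\<And>a. a < q \<Longrightarrow> g (unitv a) \<in> P"
  shows "N \<subseteq> P"
  using hom_into_submodule[OF assms(1,4,5)] assms(2) by blast

text \<open>Zorn's lemma applies because the union of a chain is finitely generated: its generators
  already lie in one member, which is then the whole union.\<close>

lemma noethmod_maximal:
  assumes X: "noethmod X s" and ne: "F \<noteq> {}" and F: "\<And>N. N \<in> F \<Longrightarrow> is_module N s \<and> N \<subseteq> X"
  shows "\<exists>M\<in>F. \<forall>N\<in>F. M \<subseteq> N \<longrightarrow> N = M"
proof (rule subset_Zorn_nonempty[OF ne])
  fix C assume C: "C \<noteq> {}" "subset.chain F C"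
  have CF: "C \<subseteq> F" using C(2) by (simp add: subset.chain_def)
  have lin: "A \<subseteq> B \<or> B \<subseteq> A" if "A \<in> C" "B \<in> C" for A B
    using C(2) that by (auto simp: subset.chain_def)
  have X': "is_module X s" using X by (simp add: noethmod_def)
  have sub: "\<Union>C \<subseteq> X" using CF F by blast
  have mod: "is_module (\<Union>C) s"
  proof (rule is_module_subset[OF X' sub])
    show "0 \<in> \<Union>C" using C(1) CF F is_moduleD(1) by blast
    fix x y assume "x \<in> \<Union>C" "y \<in> \<Union>C"
    then obtain A B where AB: "A \<in> C" "B \<in> C" "x \<in> A" "y \<in> B" by blast
    then have "(x \<in> A \<and> y \<in> A) \<or> (x \<in> B \<and> y \<in> B)" using lin by blast
    then show "x + y \<in> \<Union>C" using AB CF F is_moduleD(2)[of A s] is_moduleD(2)[of B s] by blast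
  next
    fix a x assume "x \<in> \<Union>C" then show "s a x \<in> \<Union>C" using CF F is_moduleD(4) by blast
  qed
  obtain q g where g: "is_hom (freemod q) fsmult (\<Union>C) s g" "g ` freemod q = \<Union>C"
    by (rule noethmod_cover[OF X sub mod])
  have "(\<lambda>a. g (unitv a)) ` {..<q} \<subseteq> \<Union>C" using is_homD(1)[OF g(1)] by auto
  from finite_subset_Union_chain[OF _ this C]
  obtain B where B: "B \<in> C" "(\<lambda>a. g (unitv a)) ` {..<q} \<subseteq> B" by blast
  then have "is_module B s" using CF F by blast
  then have "\<Union>C \<subseteq> B" using coverable_least[OF g mod] B(2) by blast
  then have "\<Union>C = B" using B(1) by blast
  thus "\<Union>C \<in> F" using B(1) CF by blast
qed

lemma noetherian_ring_noethmod:
  assumes "noetherian_ring TYPE('a::comm_ring_1)"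
  shows "noethmod (UNIV :: 'a set) (*)"
  using assms fin_gen_coverable unfolding noethmod_def noetherian_ring_def
  by (auto simp: ideal_iff_module)

text \<open>Induction on \<open>n\<close>. The last coordinates of a submodule form an ideal of the
  ring, the elements with last coordinate 0 form a submodule of the smaller free module, and
  generators of the two together cover it.\<close>

lemma noethmod_freemod:
  assumes R: "noethmod (UNIV :: 'a::comm_ring_1 set) (*)"
  shows "noethmod (freemod n :: (nat \<Rightarrow> 'a) set) fsmult"
proof (induction n)
  case 0
  have "coverable N fsmult" if "N \<subseteq> (freemod 0 :: (nat \<Rightarrow> 'a) set)" "is_module N fsmult" for N :: "(nat \<Rightarrow> 'a) set"
  proof -
    have z: "freemod 0 = {0 :: nat \<Rightarrow> 'a}" by (auto simp: freemod_def fun_eq_iff)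
    then have N: "N = {0}" using that is_moduleD(1) by blast
    have "is_hom (freemod 0) fsmult N fsmult (\<lambda>v. v)" using N z by (auto simp: is_hom_def)
    thus ?thesis unfolding coverable_def using N z by (intro exI[of _ 0] exI[of _ "\<lambda>v. v"]) auto
  qed
  then show ?case by (simp add: noethmod_def)
next
  case (Suc n)
  have "coverable N fsmult" if N: "N \<subseteq> (freemod (Suc n) :: (nat \<Rightarrow> 'a) set)" "is_module N fsmult" for N :: "(nat \<Rightarrow> 'a) set"
  proof -
    let ?I = "(\<lambda>v. v n) ` N"
    have hN: "is_hom N fsmult UNIV (*) (\<lambda>v. v n)" by (auto simp: is_hom_def fsmult_apply)
    have I: "is_module ?I (*)" by (rule hom_image_module[OF N(2) ring_module hN])
    obtain q g where g: "is_hom (freemod q) fsmult ?I (*) g" "g ` freemod q = ?I"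
      by (rule noethmod_cover[OF R subset_UNIV I])
    let ?N = "N \<inter> freemod n"
    have N': "is_module ?N fsmult"
      by (rule is_module_subset[OF N(2)]) (auto simp: is_moduleD[OF N(2)])
    obtain q' g' where g': "is_hom (freemod q') fsmult ?N fsmult g'" "g' ` freemod q' = ?N"
      by (rule noethmod_cover[OF Suc Int_lower2 N'])
    have "\<forall>a. a < q \<longrightarrow> (\<exists>w\<in>N. w n = g (unitv a))"
      using is_homD(1)[OF g(1)] by (metis (no_types, lifting) image_iff unitv_in)
    then obtain w where w: "\<And>a. a < q \<Longrightarrow> w a \<in> N \<and> w a n = g (unitv a)" by metis
    have cw: "is_hom (freemod q) fsmult N fsmult (comb q fsmult w)"
      by (rule comb_hom[OF N(2)]) (use w in blast)
    let ?G = "\<lambda>v. g' (fstv q' v) + comb q fsmult w (sndv q' v)"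
    have "is_hom (freemod q') fsmult N fsmult g'" using g'(1) by (auto simp: is_hom_def)
    from hom_add[OF N(2) hom_comp[OF lin_fstv this] hom_comp[OF lin_sndv cw]]
    have G: "is_hom (freemod (q' + q)) fsmult N fsmult ?G" .
    have "v \<in> ?G ` freemod (q' + q)" if v: "v \<in> N" for v
    proof -
      obtain c where c: "c \<in> freemod q" "v n = g c" using g(2) v by (metis (no_types, lifting) image_iff)
      have cn: "comb q fsmult w c n = g c"
        using w by (simp add: hom_expand[OF g(1) c(1)] comb_def sum_fun_apply fsmult_apply)
      let ?v = "v - comb q fsmult w c"
      have vN: "?v \<in> N" by (rule module_diff[OF N(2) v is_homD(1)[OF cw c(1)]])
      have v0: "?v n = 0" using cn c(2) by simp
      have v1: "?v i = 0" if "i \<ge> Suc n" for i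
        using subsetD[OF N(1) vN] that by (simp add: freemod_def)
      have "?v i = 0" if "i \<ge> n" for i
        using v0 v1[of i] that by (cases "i = n") auto
      then have "?v \<in> freemod n" unfolding freemod_def by blast
      then have "?v \<in> g' ` freemod q'" unfolding g'(2) using vN by blast
      then obtain b where b: "b \<in> freemod q'" "?v = g' b" by blast
      have "?G (pairv q' b c) = ?v + comb q fsmult w c" using b(1) by (simp add: b(2))
      then have "v = ?G (pairv q' b c)" by simp
      moreover have "pairv q' b c \<in> freemod (q' + q)" using c(1) by simp
      ultimately show ?thesis by blast
    qed
    then have "?G ` freemod (q' + q) = N" using is_homD(1)[OF G] by blast
    thus ?thesis using G unfolding coverable_def by blast
  qed
  then show ?case by (simp add: noethmod_def)
qed

section \<open>Simple quotients and Nakayama's lemma over a Noetherian local ring\<close>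

locale local_noeth =
  fixes \<mm> :: "'a::comm_ring_1 set"
  assumes noeth: "noethmod (UNIV :: 'a set) (*)"
    and mideal: "is_ideal \<mm>" and one_notin: "1 \<notin> \<mm>"
    and units: "\<And>a. a \<notin> \<mm> \<Longrightarrow> \<exists>b. a * b = 1"
begin

lemma free_noeth: "noethmod (freemod n :: (nat \<Rightarrow> 'a) set) fsmult"
  by (rule noethmod_freemod[OF noeth])

lemma one_minus_unit: "x \<in> \<mm> \<Longrightarrow> \<exists>b. (1 - c * x) * b = 1"
  using units[of "1 - c * x"] idealD(2,3)[OF mideal] one_notin
  by (metis diff_add_cancel)

lemma cancel_unit:
  assumes "is_module V (s :: 'a \<Rightarrow> 'm::ab_group_add \<Rightarrow> 'm)" "is_module X s" "w \<in> X" "s a w \<in> V" "a * b = 1"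
  shows "w \<in> V"
proof -
  have "s b (s a w) = s (b * a) w" using is_moduleD(7)[OF assms(2,3)] by simp
  also have "\<dots> = w" using assms(5) is_moduleD(8)[OF assms(2,3)] by (simp add: mult.commute)
  finally show ?thesis using is_moduleD(4)[OF assms(1,4)] by metis
qed

text \<open>The quotient \<open>W / V\<close> is simple: an element outside \<open>V\<close>
  generates it and the maximal ideal annihilates it. It is a copy of the residue field below
  \<open>W / U\<close>, used for Nakayama's lemma and for functionals with values in a
  socle.\<close>

lemma maximal_submodule:
  assumes X: "noethmod X (s :: 'a \<Rightarrow> 'm::ab_group_add \<Rightarrow> 'm)"
    and W: "is_module W s" "W \<subseteq> X" and U: "is_module U s" "U \<subseteq> W" "U \<noteq> W"
  obtains V w where "is_module V s" "U \<subseteq> V" "V \<subseteq> W" "w \<in> W" "w \<notin> V"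
    "W = {v + s c w | v c. v \<in> V}" "\<forall>c. s c w \<in> V \<longrightarrow> c \<in> \<mm>" "\<forall>c\<in>\<mm>. \<forall>v\<in>W. s c v \<in> V"
proof -
  let ?F = "{V. is_module V s \<and> U \<subseteq> V \<and> V \<subseteq> W \<and> V \<noteq> W}"
  have "\<exists>M\<in>?F. \<forall>N\<in>?F. M \<subseteq> N \<longrightarrow> N = M"
    by (rule noethmod_maximal[OF X]) (use W U in auto)
  then obtain V where V: "is_module V s" "U \<subseteq> V" "V \<subseteq> W" "V \<noteq> W"
    and mx: "\<And>N. is_module N s \<Longrightarrow> V \<subseteq> N \<Longrightarrow> N \<subseteq> W \<Longrightarrow> N \<noteq> W \<Longrightarrow> N = V"
    by (smt (verit) mem_Collect_eq subset_trans)
  have span: "W = {v + s c w | v c. v \<in> V}" if w: "w \<in> W" "w \<notin> V" for w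
  proof -
    let ?R = "{y. \<exists>c. y = s c w}"
    have R: "is_module ?R s"
    proof (rule is_module_subset[OF W(1)])
      show "?R \<subseteq> W" using w is_moduleD(4)[OF W(1)] by auto
      show "0 \<in> ?R" using module_smult_zero_left[OF W(1) w(1)] by force
      show "x + y \<in> ?R" if "x \<in> ?R" "y \<in> ?R" for x y
        using that is_moduleD(5)[OF W(1) w(1)] by (smt (verit) mem_Collect_eq)
      show "s a x \<in> ?R" if "x \<in> ?R" for a x
        using that is_moduleD(7)[OF W(1) w(1)] by (smt (verit) mem_Collect_eq)
    qed
    let ?N = "{x + y | x y. x \<in> V \<and> y \<in> ?R}"
    have Req: "?R \<subseteq> W" using w is_moduleD(4)[OF W(1)] by auto
    have N: "is_module ?N s" by (rule module_sum_module[OF W(1) V(1) R V(3) Req])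
    have "?N \<subseteq> W" using V(3) Req is_moduleD(2)[OF W(1)] by blast
    moreover have "V \<subseteq> ?N" using is_moduleD(1)[OF R] by force
    moreover have "w = 0 + s 1 w" using is_moduleD(8)[OF W(1) w(1)] by simp
    then have "w \<in> ?N" using is_moduleD(1)[OF V(1)] by blast
    ultimately have "?N = W" using mx[OF N] w(2) by blast
    moreover have "?N = {v + s c w | v c. v \<in> V}" by blast
    ultimately show ?thesis by simp
  qed
  obtain w where w: "w \<in> W" "w \<notin> V" using V by blast
  have 1: "c \<in> \<mm>" if "s c w \<in> V" for c
    using units[of c] cancel_unit[OF V(1) W(1) w(1) that] w(2) by blast
  have 2: "s c v \<in> V" if c: "c \<in> \<mm>" and v: "v \<in> W" for c v
  proof (rule ccontr)
    \<comment> \<open>In that case \<open>s c v\<close> generates \<open>W\<close> modulo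
      \<open>V\<close>, so \<open>v\<close> is congruent to the multiple \<open>b * c\<close> of
      itself; since \<open>1 - b * c\<close> is a unit, \<open>v\<close> lies in \<open>V\<close>,
      and so does \<open>s c v\<close>.\<close>
    assume nv: "s c v \<notin> V"
    from span[OF is_moduleD(4)[OF W(1) v] nv] v
    obtain v' b where e: "v' \<in> V" "v = v' + s b (s c v)" by blast
    have "s (1 - b * c) v = v'"
      using e(2) module_smult_diff_left[OF W(1) v, of 1 "b * c"] is_moduleD(7,8)[OF W(1) v]
      by (metis add_diff_cancel_right')
    then have "v \<in> V" using cancel_unit[OF V(1) W(1) v, of "1 - b * c"] one_minus_unit[OF c, of b] e(1) by auto
    then show False using nv is_moduleD(4)[OF V(1)] by blast
  qed
  show ?thesis by (rule that[OF V(1-3) w span[OF w]]) (use 1 2 in blast)+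
qed

text \<open>A proper \<open>U\<close> lies in a submodule \<open>V\<close> with \<open>W / V\<close>
  simple. This \<open>V\<close> contains \<open>U\<close> and, as \<open>x\<close> acts as zero on
  the quotient, also x W; together these are all of \<open>W\<close>.\<close>

lemma nakayama:
  assumes X: "noethmod X (s :: 'a \<Rightarrow> 'm::ab_group_add \<Rightarrow> 'm)"
    and W: "is_module W s" "W \<subseteq> X" and U: "is_module U s" "U \<subseteq> W"
    and x: "x \<in> \<mm>" and gen: "\<And>w. w \<in> W \<Longrightarrow> \<exists>w'\<in>W. w - s x w' \<in> U"
  shows "W = U"
proof (rule ccontr)
  assume "W \<noteq> U"
  then have ne: "U \<noteq> W" by blast
  obtain V w where V: "is_module V s" "U \<subseteq> V" "V \<subseteq> W" "w \<in> W" "w \<notin> V"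
    and "W = {v + s c w | v c. v \<in> V}" "\<forall>c. s c w \<in> V \<longrightarrow> c \<in> \<mm>"
    and V6: "\<forall>c\<in>\<mm>. \<forall>v\<in>W. s c v \<in> V"
    by (rule maximal_submodule[OF X W U ne])
  obtain w' where w': "w' \<in> W" "w - s x w' \<in> U" using gen V(4) by blast
  have "w = (w - s x w') + s x w'" by simp
  then have "w \<in> V" using V(2) V6[rule_format, OF x w'(1)] w'(2) is_moduleD(2)[OF V(1)] by (metis subsetD)
  thus False using V(5) by blast
qed

end

section \<open>Complexes of free modules that are exact modulo an ideal\<close>

text \<open>Over R/J this is a free resolution of the cokernel of \<open>d 1\<close>. Differentials
  are named by their source; \<open>d 0\<close> is unconstrained and no exactness is asked at
  position 0.\<close>

definition acyc :: "'a::comm_ring_1 set \<Rightarrow> (nat \<Rightarrow> nat) \<Rightarrow> (nat \<Rightarrow> (nat \<Rightarrow> 'a) \<Rightarrow> (nat \<Rightarrow> 'a)) \<Rightarrow> bool" where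
  "acyc J rk d \<longleftrightarrow> (\<forall>i. lin (rk (Suc i)) (rk i) (d (Suc i)))
     \<and> (\<forall>i. \<forall>v\<in>freemod (rk (Suc (Suc i))). d (Suc i) (d (Suc (Suc i)) v) \<in> vecs J (rk i))
     \<and> (\<forall>i. \<forall>v\<in>freemod (rk (Suc i)). d (Suc i) v \<in> vecs J (rk i) \<longrightarrow>
          (\<exists>w\<in>freemod (rk (Suc (Suc i))). v - d (Suc (Suc i)) w \<in> vecs J (rk (Suc i))))"

lemma acycD:
  assumes "acyc J rk d"
  shows "lin (rk (Suc i)) (rk i) (d (Suc i))"
    "v \<in> freemod (rk (Suc (Suc i))) \<Longrightarrow> d (Suc i) (d (Suc (Suc i)) v) \<in> vecs J (rk i)"
    "v \<in> freemod (rk (Suc i)) \<Longrightarrow> d (Suc i) v \<in> vecs J (rk i) \<Longrightarrow>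
      \<exists>w\<in>freemod (rk (Suc (Suc i))). v - d (Suc (Suc i)) w \<in> vecs J (rk (Suc i))"
  using assms unfolding acyc_def by blast+

lemma acyclic_free_cx_iff: "acyclic_free_cx rk d \<longleftrightarrow> acyc {0} rk d"
proof
  assume A: "acyclic_free_cx rk d"
  then have im: "d (Suc (Suc i)) ` freemod (rk (Suc (Suc i))) = {x \<in> freemod (rk (Suc i)). d (Suc i) x = 0}" for i
    unfolding acyclic_free_cx_def by blast
  show "acyc {0} rk d"
    unfolding acyc_def vecs_zero
  proof (intro conjI allI ballI impI)
    fix i show "lin (rk (Suc i)) (rk i) (d (Suc i))" using A by (simp add: acyclic_free_cx_def)
    show "d (Suc i) (d (Suc (Suc i)) v) \<in> {0}" if "v \<in> freemod (rk (Suc (Suc i)))" for v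
      using imageI[OF that, of "d (Suc (Suc i))"] unfolding im by simp
    show "\<exists>w\<in>freemod (rk (Suc (Suc i))). v - d (Suc (Suc i)) w \<in> {0}"
      if "v \<in> freemod (rk (Suc i))" "d (Suc i) v \<in> {0}" for v
    proof -
      have "v \<in> d (Suc (Suc i)) ` freemod (rk (Suc (Suc i)))" unfolding im using that by simp
      then obtain w where "w \<in> freemod (rk (Suc (Suc i)))" "v = d (Suc (Suc i)) w" by (rule imageE)
      then show ?thesis by (intro bexI[of _ w]) simp_all
    qed
  qed
next
  assume A: "acyc {0} rk d"
  show "acyclic_free_cx rk d"
    unfolding acyclic_free_cx_def
  proof (intro conjI allI equalityI subsetI)
    fix i show "lin (rk (Suc i)) (rk i) (d (Suc i))" by (rule acycD(1)[OF A])
    show "x \<in> {x \<in> freemod (rk (Suc i)). d (Suc i) x = 0}"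
      if "x \<in> d (Suc (Suc i)) ` freemod (rk (Suc (Suc i)))" for x
      using that acycD(2)[OF A, of _ i] linD(1)[OF acycD(1)[OF A, of "Suc i"]] by auto
    show "x \<in> d (Suc (Suc i)) ` freemod (rk (Suc (Suc i)))"
      if "x \<in> {x \<in> freemod (rk (Suc i)). d (Suc i) x = 0}" for x
      using that acycD(3)[OF A, of x i] by auto
  qed
qed

text \<open>Kernels modulo \<open>J\<close> are taken inside free modules over R itself, which are
  Noetherian, so each is the image of a free module; dependent choice strings the covers
  together.\<close>

lemma resolution_exists:
  assumes R: "noethmod (UNIV :: 'a::comm_ring_1 set) (*)" and J: "is_ideal (J :: 'a set)" and g: "lin q n g"
  shows "\<exists>rk d. acyc J rk d \<and> rk 0 = n \<and> rk (Suc 0) = q \<and> d (Suc 0) = g"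
proof -
  \<comment> \<open>A state is (target rank, source rank, map); the clause for \<open>k = 0\<close>
    fixes the given map \<open>g\<close> as the beginning.\<close>
  define P where "P = (\<lambda>(k::nat) (n', q', g'). lin q' n' g' \<and> (k = 0 \<longrightarrow> n' = n \<and> q' = q \<and> (g' :: (nat \<Rightarrow> 'a) \<Rightarrow> nat \<Rightarrow> 'a) = g))"
  define Q where "Q = (\<lambda>(k::nat) (n, q, g) (n', q', g' :: (nat \<Rightarrow> 'a) \<Rightarrow> nat \<Rightarrow> 'a). n' = q \<and> (\<forall>v\<in>freemod q'. g (g' v) \<in> vecs J n) \<and>
    (\<forall>v\<in>freemod q. g v \<in> vecs J n \<longrightarrow> (\<exists>w\<in>freemod q'. v - g' w \<in> vecs J q)))"
  have "\<exists>f. \<forall>k. P k (f k) \<and> Q k (f k) (f (Suc k))"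
  proof (rule dependent_nat_choice)
    show "\<exists>x. P 0 x" using g by (auto simp: P_def)
  next
    fix x and k assume "P k x"
    then obtain n q g where x: "x = (n, q, g)" and g: "lin q n g" by (cases x) (auto simp: P_def)
    let ?N = "{v \<in> freemod q. g v \<in> vecs J n}"
    have N: "is_module ?N fsmult"
      by (rule hom_vimage_module[OF freemod_module freemod_module g vecs_module[OF J]])
    have "?N \<subseteq> freemod q" by blast
    from noethmod_cover[OF noethmod_freemod[OF R] this N]
    obtain q' g' where g': "is_hom (freemod q') fsmult ?N fsmult g'" "g' ` freemod q' = ?N" .
    have l: "lin q' q g'" using g'(1) by (auto simp: is_hom_def)
    have "\<exists>w\<in>freemod q'. v - g' w \<in> vecs J q" if v: "v \<in> freemod q" "g v \<in> vecs J n" for v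
    proof -
      have "v \<in> g' ` freemod q'" unfolding g'(2) using v by simp
      then obtain w where "w \<in> freemod q'" "v = g' w" by blast
      moreover have "v - v \<in> vecs J q" using is_moduleD(1)[OF vecs_module[OF J]] by simp
      ultimately show ?thesis by metis
    qed
    then have "Q k x (q, q', g')" using g' x is_homD(1)[OF g'(1)] by (auto simp: Q_def)
    moreover have "P (Suc k) (q, q', g')" using l by (simp add: P_def)
    ultimately show "\<exists>y. P (Suc k) y \<and> Q k x y" by blast
  qed
  then obtain f where f: "\<And>k. P k (f k)" "\<And>k. Q k (f k) (f (Suc k))" by blast
  define a where "a k = fst (f k)" for k
  define b where "b k = fst (snd (f k))" for k
  define c where "c k = snd (snd (f k))" for k
  have fk: "f k = (a k, b k, c k)" for k by (simp add: a_def b_def c_def)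
  have ab: "a (Suc k) = b k" for k using f(2)[of k] by (simp add: fk Q_def)
  have "acyc J a (\<lambda>i. c (i - 1))"
    unfolding acyc_def
  proof (intro conjI allI)
    fix i
    show "lin (a (Suc i)) (a i) (c (Suc i - 1))" using f(1)[of i] by (simp add: fk P_def ab)
    show "\<forall>v\<in>freemod (a (Suc (Suc i))). c (Suc i - 1) (c (Suc (Suc i) - 1) v) \<in> vecs J (a i)"
      "\<forall>v\<in>freemod (a (Suc i)). c (Suc i - 1) v \<in> vecs J (a i) \<longrightarrow>
        (\<exists>w\<in>freemod (a (Suc (Suc i))). v - c (Suc (Suc i) - 1) w \<in> vecs J (a (Suc i)))"
      using f(2)[of i] by (simp_all add: fk Q_def ab)
  qed
  moreover have "a 0 = n" "a (Suc 0) = q" "c 0 = g" using f(1)[of 0] by (auto simp: fk P_def ab)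
  ultimately show ?thesis by (intro exI[of _ a] exI[of _ "\<lambda>i. c (i - 1)"]) simp
qed

text \<open>Only the last given map matters for the continuation: it is resolved afresh, and the
  resolution is spliced in at the target of that map, position \<open>p - 1\<close>.\<close>

lemma extend_complex:
  assumes R: "noethmod (UNIV :: 'a::comm_ring_1 set) (*)" and J: "is_ideal (J :: 'a set)" and p: "p \<ge> 1"
    and l: "\<And>i. i < p \<Longrightarrow> lin (rk (Suc i)) (rk i) (d (Suc i))"
    and c: "\<And>i v. Suc i < p \<Longrightarrow> v \<in> freemod (rk (Suc (Suc i))) \<Longrightarrow> d (Suc i) (d (Suc (Suc i)) v) \<in> vecs J (rk i)"
    and e: "\<And>i v. Suc i < p \<Longrightarrow> v \<in> freemod (rk (Suc i)) \<Longrightarrow> d (Suc i) v \<in> vecs J (rk i) \<Longrightarrow>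
          \<exists>w\<in>freemod (rk (Suc (Suc i))). v - d (Suc (Suc i)) w \<in> vecs J (rk (Suc i))"
  shows "\<exists>rk' d'. acyc J rk' d' \<and> (\<forall>i\<le>p. rk' i = rk i) \<and> (\<forall>i<p. d' (Suc i) = d (Suc i))"
proof -
  obtain k where k: "p = Suc k" using p by (cases p) auto
  obtain rk1 d1 where 1: "acyc J rk1 d1" "rk1 0 = rk k" "rk1 (Suc 0) = rk p" "d1 (Suc 0) = d p"
    using resolution_exists[OF R J l[of k]] k by auto
  define rk' where "rk' i = (if i < k then rk i else rk1 (i - k))" for i
  define d' where "d' i = (if i \<le> k then d i else d1 (i - k))" for i
  have rk: "rk' i = rk i" if "i \<le> p" for i using that 1 k by (auto simp: rk'_def le_Suc_eq)
  have d: "d' i = d i" if "i \<le> p" for i using that 1 k by (auto simp: d'_def le_Suc_eq)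
  have rk1: "rk' i = rk1 (i - k)" if "k \<le> i" for i using that by (auto simp: rk'_def)
  have d1: "d' i = d1 (i - k)" if "k < i" for i using that by (auto simp: d'_def)
  have "lin (rk' (Suc i)) (rk' i) (d' (Suc i))" for i
  proof (cases "i < p")
    case True then show ?thesis using l[of i] rk d by simp
  next
    case False then show ?thesis using acycD(1)[OF 1(1), of "i - k"] rk1 d1 k by (simp add: Suc_diff_le)
  qed
  moreover have "(\<forall>v\<in>freemod (rk' (Suc (Suc i))). d' (Suc i) (d' (Suc (Suc i)) v) \<in> vecs J (rk' i))
     \<and> (\<forall>v\<in>freemod (rk' (Suc i)). d' (Suc i) v \<in> vecs J (rk' i) \<longrightarrow>
          (\<exists>w\<in>freemod (rk' (Suc (Suc i))). v - d' (Suc (Suc i)) w \<in> vecs J (rk' (Suc i))))" for i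
  proof (cases "Suc i < p")
    case True then show ?thesis using c[of i] e[of i] rk d by simp
  next
    case False then show ?thesis using acycD(2,3)[OF 1(1), of _ "i - k"] rk1 d1 k by (simp add: Suc_diff_le)
  qed
  ultimately have "acyc J rk' d'" unfolding acyc_def by blast
  with rk d show ?thesis by (metis Suc_leI)
qed

section \<open>Vanishing of Ext with values in the ring\<close>

text \<open>A functional on a free module is its vector of coefficients for \<open>dot\<close>; the
  dual complex thus has the same free modules, with transposed differentials.\<close>

definition cocyc :: "'a::comm_ring_1 set \<Rightarrow> (nat \<Rightarrow> nat) \<Rightarrow> (nat \<Rightarrow> (nat \<Rightarrow> 'a) \<Rightarrow> (nat \<Rightarrow> 'a)) \<Rightarrow> nat \<Rightarrow> (nat \<Rightarrow> 'a) \<Rightarrow> bool" where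
  "cocyc J rk d i c \<longleftrightarrow> c \<in> freemod (rk i) \<and> transp (rk (Suc i)) (rk i) (d (Suc i)) c \<in> vecs J (rk (Suc i))"

text \<open>The index is that of the module carrying the primitive \<open>b\<close>; the coboundary
  \<open>c\<close> itself has degree \<open>Suc j\<close>.\<close>

definition cobd :: "'a::comm_ring_1 set \<Rightarrow> (nat \<Rightarrow> nat) \<Rightarrow> (nat \<Rightarrow> (nat \<Rightarrow> 'a) \<Rightarrow> (nat \<Rightarrow> 'a)) \<Rightarrow> nat \<Rightarrow> (nat \<Rightarrow> 'a) \<Rightarrow> bool" where
  "cobd J rk d j c \<longleftrightarrow> c \<in> freemod (rk (Suc j)) \<and>
     (\<exists>b\<in>freemod (rk j). c - transp (rk (Suc j)) (rk j) (d (Suc j)) b \<in> vecs J (rk (Suc j)))"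

text \<open>The ring modulo \<open>J\<close> has injective dimension below \<open>N\<close>.\<close>
definition van :: "'a::comm_ring_1 set \<Rightarrow> nat \<Rightarrow> bool" where
  "van J N \<longleftrightarrow> (\<forall>rk d. acyc J rk d \<longrightarrow> (\<forall>j c. N \<le> Suc j \<longrightarrow> cocyc J rk d (Suc j) c \<longrightarrow> cobd J rk d j c))"

lemma vanD: "van J N \<Longrightarrow> acyc J rk d \<Longrightarrow> N \<le> Suc j \<Longrightarrow> cocyc J rk d (Suc j) c \<Longrightarrow> cobd J rk d j c"
  unfolding van_def by blast

lemma vecs_iff_dot:
  assumes "is_ideal J" "c \<in> freemod n"
  shows "c \<in> vecs J n \<longleftrightarrow> (\<forall>v\<in>freemod n. dot n c v \<in> J)"
  using vecsI_dot[OF assms] dot_vecs_left[OF assms(1)] by blast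

lemma cocyc_iff:
  assumes "is_ideal J" "lin (rk (Suc i)) (rk i) (d (Suc i))"
  shows "cocyc J rk d i c \<longleftrightarrow> c \<in> freemod (rk i) \<and> (\<forall>v\<in>freemod (rk (Suc i)). dot (rk i) c (d (Suc i) v) \<in> J)"
proof -
  let ?t = "transp (rk (Suc i)) (rk i) (d (Suc i)) c"
  have "?t \<in> vecs J (rk (Suc i)) \<longleftrightarrow> (\<forall>v\<in>freemod (rk (Suc i)). dot (rk (Suc i)) ?t v \<in> J)"
    by (rule vecs_iff_dot[OF assms(1) transp_in])
  then show ?thesis unfolding cocyc_def using dot_transp[OF assms(2)] by auto
qed

lemma cobd_iff:
  assumes "is_ideal J" "lin (rk (Suc j)) (rk j) (d (Suc j))"
  shows "cobd J rk d j c \<longleftrightarrow> c \<in> freemod (rk (Suc j)) \<and>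
     (\<exists>b\<in>freemod (rk j). \<forall>v\<in>freemod (rk (Suc j)). dot (rk (Suc j)) c v - dot (rk j) b (d (Suc j) v) \<in> J)"
proof -
  have "c - transp (rk (Suc j)) (rk j) (d (Suc j)) b \<in> vecs J (rk (Suc j)) \<longleftrightarrow>
     (\<forall>v\<in>freemod (rk (Suc j)). dot (rk (Suc j)) c v - dot (rk j) b (d (Suc j) v) \<in> J)"
    if c: "c \<in> freemod (rk (Suc j))" for b
  proof -
    let ?t = "c - transp (rk (Suc j)) (rk j) (d (Suc j)) b"
    have "?t \<in> vecs J (rk (Suc j)) \<longleftrightarrow> (\<forall>v\<in>freemod (rk (Suc j)). dot (rk (Suc j)) ?t v \<in> J)"
      by (rule vecs_iff_dot[OF assms(1) fm_diff[OF c transp_in]])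
    then show ?thesis using dot_transp[OF assms(2)] by (simp add: dot_diff_left)
  qed
  then show ?thesis unfolding cobd_def by blast
qed

lemma acyc_cocyc_iff:
  assumes "is_ideal J" "acyc J rk d"
  shows "cocyc J rk d i c \<longleftrightarrow> c \<in> freemod (rk i) \<and> (\<forall>v\<in>freemod (rk (Suc i)). dot (rk i) c (d (Suc i) v) \<in> J)"
  by (rule cocyc_iff[where rk = rk and d = d, OF assms(1) acycD(1)[OF assms(2)]])

lemma acyc_cobd_iff:
  assumes "is_ideal J" "acyc J rk d"
  shows "cobd J rk d j c \<longleftrightarrow> c \<in> freemod (rk (Suc j)) \<and>
     (\<exists>b\<in>freemod (rk j). \<forall>v\<in>freemod (rk (Suc j)). dot (rk (Suc j)) c v - dot (rk j) b (d (Suc j) v) \<in> J)"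
  by (rule cobd_iff[where rk = rk and d = d, OF assms(1) acycD(1)[OF assms(2)]])

lemma cocyc_module:
  assumes "is_ideal J"
  shows "is_module {c. cocyc J rk d i c} fsmult"
  using hom_vimage_module[OF freemod_module freemod_module lin_transp vecs_module[OF assms(1)]]
  unfolding cocyc_def by blast

lemma cobd_module:
  assumes "is_ideal J"
  shows "is_module {c. cobd J rk d j c} fsmult"
proof -
  let ?t = "transp (rk (Suc j)) (rk j) (d (Suc j))"
  let ?P = "?t ` freemod (rk j)"
  have P: "is_module ?P fsmult" by (rule hom_image_module[OF freemod_module freemod_module lin_transp])
  have "is_module {x + y | x y. x \<in> ?P \<and> y \<in> vecs J (rk (Suc j))} fsmult"
    by (rule module_sum_module[OF freemod_module P vecs_module[OF assms]]) (auto simp: vecs_def)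
  moreover have "{x + y | x y. x \<in> ?P \<and> y \<in> vecs J (rk (Suc j))} = {c. cobd J rk d j c}"
  proof (intro set_eqI iffI)
    fix c assume "c \<in> {x + y | x y. x \<in> ?P \<and> y \<in> vecs J (rk (Suc j))}"
    then obtain b y where b: "b \<in> freemod (rk j)" "y \<in> vecs J (rk (Suc j))" "c = ?t b + y" by blast
    then have "c - ?t b = y" by simp
    moreover have "c \<in> freemod (rk (Suc j))" unfolding b(3) by (rule fm_add[OF transp_in vecs_sub[OF b(2)]])
    ultimately show "c \<in> {c. cobd J rk d j c}" using b(1,2) unfolding cobd_def by auto
  next
    fix c assume "c \<in> {c. cobd J rk d j c}"
    then obtain b where b: "b \<in> freemod (rk j)" "c - ?t b \<in> vecs J (rk (Suc j))" by (auto simp: cobd_def)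
    then have "c = ?t b + (c - ?t b)" by simp
    then show "c \<in> {x + y | x y. x \<in> ?P \<and> y \<in> vecs J (rk (Suc j))}" using b by blast
  qed
  ultimately show ?thesis by simp
qed

lemma cobd_cocyc:
  assumes J: "is_ideal J" and D: "acyc J rk d" and c: "cobd J rk d j c"
  shows "cocyc J rk d (Suc j) c"
proof -
  obtain b where b: "c \<in> freemod (rk (Suc j))" "b \<in> freemod (rk j)"
    "\<forall>v\<in>freemod (rk (Suc j)). dot (rk (Suc j)) c v - dot (rk j) b (d (Suc j) v) \<in> J"
    using c acyc_cobd_iff[OF J D] by blast
  have "dot (rk (Suc j)) c (d (Suc (Suc j)) v) \<in> J" if v: "v \<in> freemod (rk (Suc (Suc j)))" for v
  proof -
    have "dot (rk (Suc j)) c (d (Suc (Suc j)) v) - dot (rk j) b (d (Suc j) (d (Suc (Suc j)) v)) \<in> J"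
      using b(3) linD(1)[OF acycD(1)[OF D] v] by blast
    moreover have "dot (rk j) b (d (Suc j) (d (Suc (Suc j)) v)) \<in> J"
      using acycD(2)[OF D v] dot_vecs_right[OF J] by blast
    ultimately show ?thesis using idealD(2)[OF J] by fastforce
  qed
  then show ?thesis using b(1) acyc_cocyc_iff[OF J D] by blast
qed

lemma vecs_cobd: "is_ideal J \<Longrightarrow> c \<in> vecs J (rk (Suc j)) \<Longrightarrow> cobd J rk d j c"
  unfolding cobd_def lin_zero[OF lin_transp] using vecs_sub lin_zero[OF lin_transp] by (intro conjI bexI[of _ 0]) (auto simp: lin_zero[OF lin_transp])

lemma van_mono: "van J N \<Longrightarrow> N \<le> N' \<Longrightarrow> van J N'"
  unfolding van_def by (meson order_trans)

lemma gorenstein_van: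
  assumes "gorenstein TYPE('a::comm_ring_1)"
  shows "\<exists>N. van ({0} :: 'a set) N"
proof -
  obtain n where n: "\<And>rk (d :: nat \<Rightarrow> (nat \<Rightarrow> 'a) \<Rightarrow> (nat \<Rightarrow> 'a)) j. acyclic_free_cx rk d \<Longrightarrow> j \<ge> n \<Longrightarrow>
        (1::'a) \<in> cx_ext_ann rk d (UNIV :: 'a set) (\<lambda>a x. a * x) j"
    using assms unfolding gorenstein_def by blast
  \<comment> \<open>In \<open>cx_ext_ann\<close> the index \<open>j\<close> refers to degree
    \<open>j + 1\<close>, hence the bound \<open>Suc n\<close>.\<close>
  have "van ({0} :: 'a set) (Suc n)"
    unfolding van_def
  proof (intro allI impI)
    fix rk j c and d :: "nat \<Rightarrow> (nat \<Rightarrow> 'a) \<Rightarrow> (nat \<Rightarrow> 'a)"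
    assume D: "acyc {0} rk d" and j: "Suc n \<le> Suc j" and c: "cocyc {0} rk d (Suc j) c"
    have c': "c \<in> freemod (rk (Suc j))" "\<And>v. v \<in> freemod (rk (Suc (Suc j))) \<Longrightarrow> dot (rk (Suc j)) c (d (Suc (Suc j)) v) = 0"
      using c acyc_cocyc_iff[OF zero_ideal D] by auto
    have "(1::'a) \<in> cx_ext_ann rk d (UNIV :: 'a set) (*) j"
      using n[of rk d j] D j by (simp add: acyclic_free_cx_iff)
    then obtain g where g: "is_hom (freemod (rk j)) fsmult (UNIV :: 'a set) (*) g"
      "\<forall>x\<in>freemod (rk (Suc j)). 1 * dot (rk (Suc j)) c x = g (d (Suc j) x)"
      unfolding cx_ext_ann_def using dot_hom c'(2) by blast
    define b where "b = (\<lambda>a. if a < rk j then g (unitv a) else 0)"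
    have gb: "g v = dot (rk j) b v" if "v \<in> freemod (rk j)" for v
      by (simp add: hom_expand[OF g(1) that] dot_def b_def mult.commute)
    have "b \<in> freemod (rk j)" by (simp add: b_def freemod_def)
    moreover have "\<forall>v\<in>freemod (rk (Suc j)). dot (rk (Suc j)) c v - dot (rk j) b (d (Suc j) v) \<in> {0}"
      using g(2) gb linD(1)[OF acycD(1)[OF D]] by auto
    ultimately show "cobd {0} rk d j c" using acyc_cobd_iff[OF zero_ideal D] c'(1) by blast
  qed
  then show ?thesis by blast
qed

subsection \<open>Passing to the quotient by a regular element\<close>

definition drk :: "(nat \<Rightarrow> nat) \<Rightarrow> nat \<Rightarrow> nat" where
  "drk rk i = rk (Suc i) + rk i"

text \<open>On pairs this is the matrix ((d, -x), (h, -d)). Its square vanishes modulo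
  \<open>J\<close> as soon as d d = x h and h d = d h hold there. A pair at \<open>k\<close> has
  components in positions \<open>k + 1\<close> and \<open>k\<close>, which the shift
  \<open>shrk\<close> turns into \<open>k\<close> and \<open>k - 1\<close> of the original
  complex.\<close>

definition dd :: "(nat \<Rightarrow> nat) \<Rightarrow> (nat \<Rightarrow> (nat \<Rightarrow> 'a) \<Rightarrow> (nat \<Rightarrow> 'a)) \<Rightarrow> (nat \<Rightarrow> (nat \<Rightarrow> 'a) \<Rightarrow> (nat \<Rightarrow> 'a))
    \<Rightarrow> 'a::comm_ring_1 \<Rightarrow> nat \<Rightarrow> (nat \<Rightarrow> 'a) \<Rightarrow> (nat \<Rightarrow> 'a)" where
  "dd rk d h x k v = (let a = fstv (rk (Suc k)) v; b = sndv (rk (Suc k)) v in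
     pairv (rk k) (d (Suc k) a - fsmult x b) (h (k - 1) a - d k b))"

lemma dd_pairv:
  "a \<in> freemod (rk (Suc (Suc i))) \<Longrightarrow> dd rk d h x (Suc i) (pairv (rk (Suc (Suc i))) a b) =
    pairv (rk (Suc i)) (d (Suc (Suc i)) a - fsmult x b) (h i a - d (Suc i) b)"
  by (simp add: dd_def)

lemma dd_lin:
  assumes "\<And>i. lin (rk (Suc i)) (rk i) (d (Suc i))" "\<And>i. lin (rk (Suc (Suc i))) (rk i) (h i)"
  shows "lin (drk rk (Suc i)) (drk rk i) (dd rk d h x (Suc i))"
  unfolding dd_def drk_def Let_def
  by (rule lin_pairv)
    (auto intro!: hom_sub hom_comp[OF lin_fstv] hom_comp[OF lin_sndv] assms hom_smult)

text \<open>With \<open>h = 0\<close> this is the mapping cone of \<open>x\<close>; in general it is Shamash's construction of a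
  resolution modulo \<open>J\<close> from one modulo \<open>J + (x)\<close>.\<close>
lemma doubled_acyc:
  assumes J: "is_ideal J"
    and d: "\<And>i. lin (rk (Suc i)) (rk i) (d (Suc i))" and h: "\<And>i. lin (rk (Suc (Suc i))) (rk i) (h i)"
    and ddh: "\<And>i v. v \<in> freemod (rk (Suc (Suc i))) \<Longrightarrow> d (Suc i) (d (Suc (Suc i)) v) - fsmult x (h i v) \<in> vecs J (rk i)"
    and comm: "\<And>i v. v \<in> freemod (rk (Suc (Suc (Suc i)))) \<Longrightarrow>
       h i (d (Suc (Suc (Suc i))) v) - d (Suc i) (h (Suc i) v) \<in> vecs J (rk i)"
    and ex: "\<And>i a b. a \<in> freemod (rk (Suc (Suc i))) \<Longrightarrow> b \<in> freemod (rk (Suc i)) \<Longrightarrow>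
       d (Suc (Suc i)) a - fsmult x b \<in> vecs J (rk (Suc i)) \<Longrightarrow> h i a - d (Suc i) b \<in> vecs J (rk i) \<Longrightarrow>
       \<exists>\<alpha>\<in>freemod (rk (Suc (Suc (Suc i)))). \<exists>\<beta>\<in>freemod (rk (Suc (Suc i))).
         a - (d (Suc (Suc (Suc i))) \<alpha> - fsmult x \<beta>) \<in> vecs J (rk (Suc (Suc i))) \<and>
         b - (h (Suc i) \<alpha> - d (Suc (Suc i)) \<beta>) \<in> vecs J (rk (Suc i))"
  shows "acyc J (drk rk) (dd rk d h x)"
  unfolding acyc_def
proof (intro conjI allI ballI impI)
  fix i
  show "lin (drk rk (Suc i)) (drk rk i) (dd rk d h x (Suc i))" by (rule dd_lin[where rk = rk and d = d and h = h, OF d h])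
  let ?n = "rk (Suc (Suc (Suc i)))"
  show "dd rk d h x (Suc i) (dd rk d h x (Suc (Suc i)) v) \<in> vecs J (drk rk i)"
    if "v \<in> freemod (drk rk (Suc (Suc i)))" for v
  proof -
    define a b where "a = fstv ?n v" and "b = sndv ?n v"
    have ab: "a \<in> freemod ?n" "b \<in> freemod (rk (Suc (Suc i)))" "v = pairv ?n a b"
      using that by (auto simp: a_def b_def drk_def)
    let ?a = "d (Suc (Suc (Suc i))) a - fsmult x b" and ?b = "h (Suc i) a - d (Suc (Suc i)) b"
    have a': "?a \<in> freemod (rk (Suc (Suc i)))" "?b \<in> freemod (rk (Suc i))"
      using ab linD(1)[OF d] linD(1)[OF h] by auto
    have mem: "d (Suc (Suc (Suc i))) a \<in> freemod (rk (Suc (Suc i)))" "h (Suc i) a \<in> freemod (rk (Suc i))"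
      "d (Suc (Suc i)) b \<in> freemod (rk (Suc i))" using ab linD(1)[OF d] linD(1)[OF h] by auto
    have 1: "d (Suc (Suc i)) ?a - fsmult x ?b \<in> vecs J (rk (Suc i))"
    proof -
      have "d (Suc (Suc i)) ?a - fsmult x ?b =
        d (Suc (Suc i)) (d (Suc (Suc (Suc i))) a) - fsmult x (h (Suc i) a)"
        using ab mem by (simp add: lin_diff[OF d] linD(3)[OF d] module_smult_diff_right[OF freemod_module] fun_eq_iff fsmult_apply algebra_simps)
      then show ?thesis using ddh[OF ab(1)] by simp
    qed
    have 2: "h i ?a - d (Suc i) ?b \<in> vecs J (rk i)"
    proof -
      have "h i ?a - d (Suc i) ?b = (h i (d (Suc (Suc (Suc i))) a) - d (Suc i) (h (Suc i) a)) +
         (d (Suc i) (d (Suc (Suc i)) b) - fsmult x (h i b))"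
        using ab mem by (simp add: lin_diff[OF d] lin_diff[OF h] linD(3)[OF h] linD(3)[OF d] algebra_simps)
      then show ?thesis using comm[OF ab(1)] ddh[OF ab(2)] is_moduleD(2)[OF vecs_module[OF J]] by metis
    qed
    have "dd rk d h x (Suc i) (dd rk d h x (Suc (Suc i)) v) =
      pairv (rk (Suc i)) (d (Suc (Suc i)) ?a - fsmult x ?b) (h i ?a - d (Suc i) ?b)"
      unfolding ab(3) dd_pairv[where rk = rk, OF ab(1)] dd_pairv[where rk = rk, OF a'(1)] ..
    then show ?thesis using vecs_pairv[OF 1 2] by (simp add: drk_def)
  qed
  show "\<exists>w\<in>freemod (drk rk (Suc (Suc i))). v - dd rk d h x (Suc (Suc i)) w \<in> vecs J (drk rk (Suc i))"
    if v: "v \<in> freemod (drk rk (Suc i))" "dd rk d h x (Suc i) v \<in> vecs J (drk rk i)" for v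
  proof -
    let ?m = "rk (Suc (Suc i))"
    define a b where "a = fstv ?m v" and "b = sndv ?m v"
    have ab: "a \<in> freemod ?m" "b \<in> freemod (rk (Suc i))" "v = pairv ?m a b"
      using v by (auto simp: a_def b_def drk_def)
    have z: "pairv (rk (Suc i)) (d (Suc (Suc i)) a - fsmult x b) (h i a - d (Suc i) b) \<in> vecs J (rk (Suc i) + rk i)"
      using v(2) unfolding ab(3) dd_pairv[where rk = rk, OF ab(1)] by (simp add: drk_def)
    have mem: "d (Suc (Suc i)) a - fsmult x b \<in> freemod (rk (Suc i))"
      using ab linD(1)[OF d] by auto
    have "d (Suc (Suc i)) a - fsmult x b \<in> vecs J (rk (Suc i))" "h i a - d (Suc i) b \<in> vecs J (rk i)"
      using vecs_fstv[OF J z, of "rk (Suc i)"] vecs_sndv[OF z] mem by simp_all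
    from ex[OF ab(1,2) this] obtain \<alpha> \<beta> where e: "\<alpha> \<in> freemod ?n" "\<beta> \<in> freemod ?m"
      "a - (d (Suc (Suc (Suc i))) \<alpha> - fsmult x \<beta>) \<in> vecs J ?m"
      "b - (h (Suc i) \<alpha> - d (Suc (Suc i)) \<beta>) \<in> vecs J (rk (Suc i))" by blast
    have "v - dd rk d h x (Suc (Suc i)) (pairv ?n \<alpha> \<beta>) \<in> vecs J (drk rk (Suc i))"
      unfolding ab(3) dd_pairv[where rk = rk, OF e(1)] pairv_diff drk_def by (rule vecs_pairv[OF e(3,4)])
    moreover have "pairv ?n \<alpha> \<beta> \<in> freemod (drk rk (Suc (Suc i)))" using e by (simp add: drk_def)
    ultimately show ?thesis by blast
  qed
qed

text \<open>A zero module is put in front, so that the doubled complex has the original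
  \<open>rk 0\<close> alone at position 0.\<close>

definition shrk :: "(nat \<Rightarrow> nat) \<Rightarrow> nat \<Rightarrow> nat" where
  "shrk rk i = (case i of 0 \<Rightarrow> 0 | Suc k \<Rightarrow> rk k)"
definition shd :: "(nat \<Rightarrow> (nat \<Rightarrow> 'a::comm_ring_1) \<Rightarrow> (nat \<Rightarrow> 'a)) \<Rightarrow> nat \<Rightarrow> (nat \<Rightarrow> 'a) \<Rightarrow> (nat \<Rightarrow> 'a)" where
  "shd d i = (if i \<le> 1 then (\<lambda>v. 0) else d (i - 1))"

lemma shift_simps [simp]: "shrk rk 0 = 0" "shrk rk (Suc i) = rk i" "shd d (Suc 0) v = 0" "shd d (Suc (Suc i)) = d (Suc i)"
  by (auto simp: shrk_def shd_def)

lemma shd_lin: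
  assumes "\<And>i. lin (rk (Suc i)) (rk i) (d (Suc i))"
  shows "lin (shrk rk (Suc i)) (shrk rk i) (shd d (Suc i))"
proof (cases i)
  case 0 have "shd d (Suc 0) = (\<lambda>v. 0)" by (simp add: shd_def)
  then show ?thesis using 0 by simp
next
  case (Suc k) then show ?thesis using assms[of k] by simp
qed

lemma freemod_0: "v \<in> freemod 0 \<Longrightarrow> v = 0" by (auto simp: freemod_def)

text \<open>Read modulo \<open>J\<close>, the square of d is a multiple of \<open>x\<close>, and
  \<open>h\<close> is the quotient. Regularity of \<open>x\<close> modulo \<open>J\<close> makes
  \<open>h\<close> unique there, hence commuting with d, and turns exactness modulo J + (x) into
  exactness of the doubled complex.\<close>

lemma shamash_acyc:
  fixes J :: "'a::comm_ring_1 set"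
  assumes J: "is_ideal J" and x: "nzd J x" and D: "acyc (adjoin J x) rk d"
  obtains h where "acyc J (drk (shrk rk)) (dd (shrk rk) (shd d) h x)"
    "\<And>i. lin (shrk rk (Suc (Suc i))) (shrk rk i) (h i)"
    "\<And>i v. v \<in> freemod (shrk rk (Suc (Suc i))) \<Longrightarrow>
       shd d (Suc i) (shd d (Suc (Suc i)) v) - fsmult x (h i v) \<in> vecs J (shrk rk i)"
proof -
  let ?r = "shrk rk" and ?d = "shd d" and ?J = "adjoin J x"
  note VJ = vecs_module[OF J]
  have J': "is_ideal ?J" by (rule adjoin_ideal[OF J])
  have d: "lin (?r (Suc i)) (?r i) (?d (Suc i))" for i by (rule shd_lin[where rk = rk and d = d, OF acycD(1)[OF D]])
  have dd: "?d (Suc i) (?d (Suc (Suc i)) v) \<in> vecs ?J (?r i)" if "v \<in> freemod (?r (Suc (Suc i)))" for i v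
    using that acycD(2)[OF D, of v] is_moduleD(1)[OF vecs_module[OF J']] by (cases i) auto
  have "\<exists>h. lin (?r (Suc (Suc i))) (?r i) h \<and> (\<forall>v\<in>freemod (?r (Suc (Suc i))). ?d (Suc i) (?d (Suc (Suc i)) v) - fsmult x (h v) \<in> vecs J (?r i))" for i
    by (rule free_lift[OF freemod_module VJ hom_comp[OF d d] freemod_module lin_fsmult])
      (use adjoin_vecs[OF J dd] in auto)
  then obtain h where h: "\<And>i. lin (?r (Suc (Suc i))) (?r i) (h i)"
    and hx: "\<And>i v. v \<in> freemod (?r (Suc (Suc i))) \<Longrightarrow> ?d (Suc i) (?d (Suc (Suc i)) v) - fsmult x (h i v) \<in> vecs J (?r i)"
    by metis
  have "acyc J (drk ?r) (dd ?r ?d h x)"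
  proof (rule doubled_acyc[where rk = ?r and d = ?d and h = h, OF J d h hx])
    fix i and v :: "nat \<Rightarrow> 'a" assume v: "v \<in> freemod (?r (Suc (Suc (Suc i))))"
    let ?d3 = "?d (Suc (Suc (Suc i)))" and ?d2 = "?d (Suc (Suc i))" and ?d1 = "?d (Suc i)"
    have dv: "?d3 v \<in> freemod (?r (Suc (Suc i)))" by (rule linD(1)[OF d v])
    have hv: "h (Suc i) v \<in> freemod (?r (Suc i))" by (rule linD(1)[OF h v])
    have "?d1 (?d2 (?d3 v) - fsmult x (h (Suc i) v)) \<in> vecs J (?r i)"
      by (rule lin_vecs[OF J d hx[OF v]])
    then have 1: "?d1 (?d2 (?d3 v)) - fsmult x (?d1 (h (Suc i) v)) \<in> vecs J (?r i)"
      using dv hv linD(1)[OF d dv] by (simp add: lin_diff[OF d] linD(3)[OF d])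
    have "fsmult x (h i (?d3 v) - ?d1 (h (Suc i) v)) =
      (?d1 (?d2 (?d3 v)) - fsmult x (?d1 (h (Suc i) v))) - (?d1 (?d2 (?d3 v)) - fsmult x (h i (?d3 v)))"
      by (simp add: fun_eq_iff fsmult_apply algebra_simps)
    then have "fsmult x (h i (?d3 v) - ?d1 (h (Suc i) v)) \<in> vecs J (?r i)"
      using module_diff[OF VJ 1 hx[OF dv]] by simp
    then show "h i (?d3 v) - ?d1 (h (Suc i) v) \<in> vecs J (?r i)"
      using nzd_vecs[OF x] linD(1)[OF h dv] linD(1)[OF d hv] by (meson fm_diff)
  next
    fix i and a b :: "nat \<Rightarrow> 'a"
    let ?d3 = "?d (Suc (Suc (Suc i)))" and ?d2 = "?d (Suc (Suc i))" and ?d1 = "?d (Suc i)"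
    assume a: "a \<in> freemod (?r (Suc (Suc i)))" and b: "b \<in> freemod (?r (Suc i))"
      and e: "?d2 a - fsmult x b \<in> vecs J (?r (Suc i))"
    have "?d2 a \<in> vecs ?J (?r (Suc i))" by (rule adjoin_vecsI[OF J b e])
    then have "d (Suc i) a \<in> vecs ?J (rk i)" "a \<in> freemod (rk (Suc i))" using a by simp_all
    from acycD(3)[OF D this(2,1)] obtain \<alpha> where \<alpha>: "\<alpha> \<in> freemod (?r (Suc (Suc (Suc i))))"
      "a - ?d3 \<alpha> \<in> vecs ?J (?r (Suc (Suc i)))" by auto
    obtain \<gamma> where \<gamma>: "\<gamma> \<in> freemod (?r (Suc (Suc i)))" "a - ?d3 \<alpha> - fsmult x \<gamma> \<in> vecs J (?r (Suc (Suc i)))"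
      using adjoin_vecs[OF J \<alpha>(2)] by blast
    have d\<alpha>: "?d3 \<alpha> \<in> freemod (?r (Suc (Suc i)))" by (rule linD(1)[OF d \<alpha>(1)])
    have mx: "fsmult x (- \<gamma>) = - fsmult x \<gamma>" by (simp add: fun_eq_iff fsmult_apply)
    have r1: "a - (?d3 \<alpha> - fsmult x (- \<gamma>)) \<in> vecs J (?r (Suc (Suc i)))"
      using \<gamma>(2) by (simp add: mx algebra_simps)
    have "?d2 (a - ?d3 \<alpha> - fsmult x \<gamma>) \<in> vecs J (?r (Suc i))" by (rule lin_vecs[OF J d \<gamma>(2)])
    then have 1: "?d2 a - ?d2 (?d3 \<alpha>) - fsmult x (?d2 \<gamma>) \<in> vecs J (?r (Suc i))"
      using a d\<alpha> \<gamma>(1) by (simp add: lin_diff[OF d] linD(3)[OF d] del: shift_simps)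
    \<comment> \<open>The second component is tested after multiplication by \<open>x\<close>: the
      product is a combination of three known congruences, and \<open>x\<close> can be cancelled
      modulo \<open>J\<close>.\<close>
    have "fsmult x (b - (h (Suc i) \<alpha> - ?d2 (- \<gamma>))) =
       (?d2 a - ?d2 (?d3 \<alpha>) - fsmult x (?d2 \<gamma>)) + (?d2 (?d3 \<alpha>) - fsmult x (h (Suc i) \<alpha>)) - (?d2 a - fsmult x b)"
      by (simp add: lin_minus[OF d \<gamma>(1)] fun_eq_iff fsmult_apply algebra_simps del: shift_simps)
    then have "fsmult x (b - (h (Suc i) \<alpha> - ?d2 (- \<gamma>))) \<in> vecs J (?r (Suc i))"
      using module_diff[OF VJ is_moduleD(2)[OF VJ 1 hx[OF \<alpha>(1)]] e] by simp
    then have r2: "b - (h (Suc i) \<alpha> - ?d2 (- \<gamma>)) \<in> vecs J (?r (Suc i))"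
      using nzd_vecs[OF x] b linD(1)[OF h \<alpha>(1)] linD(1)[OF d fm_minus[OF \<gamma>(1)]] by (meson fm_diff)
    show "\<exists>\<alpha>\<in>freemod (?r (Suc (Suc (Suc i)))). \<exists>\<beta>\<in>freemod (?r (Suc (Suc i))).
         a - (?d3 \<alpha> - fsmult x \<beta>) \<in> vecs J (?r (Suc (Suc i))) \<and>
         b - (h (Suc i) \<alpha> - ?d2 \<beta>) \<in> vecs J (?r (Suc i))"
      using \<alpha>(1) fm_minus[OF \<gamma>(1)] r1 r2 by blast
  qed
  then show ?thesis using that h hx by blast
qed

text \<open>Rees's shift: degree i over R/(J + (x)) corresponds to degree i + 1 over R/J. A cocycle
  \<open>c\<close> modulo J + (x) has coboundary x \<mu> modulo \<open>J\<close>, and the pair of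
  \<open>\<mu>\<close> and \<open>- c\<close> is a cocycle of the doubled complex one degree higher;
  the second component of its primitive is a primitive of \<open>c\<close>.\<close>

lemma van_quotient:
  fixes J :: "'a::comm_ring_1 set"
  assumes J: "is_ideal J" and x: "nzd J x" and V: "van J N"
  shows "van (adjoin J x) N"
  unfolding van_def
proof (intro allI impI)
  fix rk j c and d :: "nat \<Rightarrow> (nat \<Rightarrow> 'a) \<Rightarrow> (nat \<Rightarrow> 'a)"
  let ?J = "adjoin J x" and ?r = "shrk rk" and ?d = "shd d"
  have J': "is_ideal ?J" by (rule adjoin_ideal[OF J])
  assume D: "acyc ?J rk d" and j: "N \<le> Suc j" and c: "cocyc ?J rk d (Suc j) c"
  obtain h where A: "acyc J (drk ?r) (dd ?r ?d h x)" and h: "\<And>i. lin (?r (Suc (Suc i))) (?r i) (h i)"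
    and hx: "\<And>i v. v \<in> freemod (?r (Suc (Suc i))) \<Longrightarrow>
       ?d (Suc i) (?d (Suc (Suc i)) v) - fsmult x (h i v) \<in> vecs J (?r i)"
    using shamash_acyc[OF J x D] by metis
  have d: "lin (?r (Suc i)) (?r i) (?d (Suc i))" for i by (rule shd_lin[where rk = rk and d = d, OF acycD(1)[OF D]])
  let ?n1 = "?r (Suc j)" and ?n2 = "?r (Suc (Suc j))" and ?n3 = "?r (Suc (Suc (Suc j)))" and ?n4 = "?r (Suc (Suc (Suc (Suc j))))"
  let ?d2 = "?d (Suc (Suc j))" and ?d3 = "?d (Suc (Suc (Suc j)))" and ?d4 = "?d (Suc (Suc (Suc (Suc j))))"
  have c1: "c \<in> freemod ?n2" and c2: "transp ?n3 ?n2 ?d3 c \<in> vecs ?J ?n3"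
    using c by (simp_all add: cocyc_def)
  obtain \<mu> where \<mu>: "\<mu> \<in> freemod ?n3" "transp ?n3 ?n2 ?d3 c - fsmult x \<mu> \<in> vecs J ?n3"
    using adjoin_vecs[OF J c2] by blast
  have \<mu>d: "dot ?n2 c (?d3 v) - x * dot ?n3 \<mu> v \<in> J" if "v \<in> freemod ?n3" for v
    using dot_vecs_left[OF J \<mu>(2), of ?n3 v] dot_transp[OF d that, of c] by (simp add: dot_diff_left dot_smult_left)
  let ?c = "pairv ?n3 \<mu> (- c)"
  have "cocyc J (drk ?r) (dd ?r ?d h x) (Suc (Suc j)) ?c"
  proof (subst acyc_cocyc_iff[OF J A], intro conjI ballI)
    show "?c \<in> freemod (drk ?r (Suc (Suc j)))" unfolding drk_def using c1 by (intro pairv_in fm_minus)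
    fix v :: "nat \<Rightarrow> 'a" assume "v \<in> freemod (drk ?r (Suc (Suc (Suc j))))"
    then obtain a b where ab: "a \<in> freemod ?n4" "b \<in> freemod ?n3" "v = pairv ?n4 a b"
      unfolding drk_def by (metis fstv_in sndv_in pairv_fst_snd)
    have da: "?d4 a \<in> freemod ?n3" and ha: "h (Suc (Suc j)) a \<in> freemod ?n2" and db: "?d3 b \<in> freemod ?n2"
      using linD(1)[OF d ab(1)] linD(1)[OF h ab(1)] linD(1)[OF d ab(2)] by auto
    have "dot (drk ?r (Suc (Suc j))) ?c (dd ?r ?d h x (Suc (Suc (Suc j))) v) =
      dot ?n3 \<mu> (?d4 a - fsmult x b) + dot ?n2 (- c) (h (Suc (Suc j)) a - ?d3 b)"
      unfolding ab(3) dd_pairv[where rk = ?r, OF ab(1)] drk_def dot_pairv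
      using \<mu>(1) da ab(2) by (simp del: shift_simps)
    also have "\<dots> = (dot ?n3 \<mu> (?d4 a) - dot ?n2 c (h (Suc (Suc j)) a)) + (dot ?n2 c (?d3 b) - x * dot ?n3 \<mu> b)"
      by (simp add: dot_simps algebra_simps del: shift_simps)
    also have "\<dots> \<in> J"
    proof (rule idealD(2)[OF J _ \<mu>d[OF ab(2)]])
      have "x * (dot ?n3 \<mu> (?d4 a) - dot ?n2 c (h (Suc (Suc j)) a)) =
        dot ?n2 c (?d3 (?d4 a) - fsmult x (h (Suc (Suc j)) a)) - (dot ?n2 c (?d3 (?d4 a)) - x * dot ?n3 \<mu> (?d4 a))"
        by (simp add: dot_simps algebra_simps del: shift_simps)
      also have "\<dots> \<in> J"
        by (rule idealD(6)[OF J dot_vecs_right[OF J hx[OF ab(1)]] \<mu>d[OF da]])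
      finally show "dot ?n3 \<mu> (?d4 a) - dot ?n2 c (h (Suc (Suc j)) a) \<in> J" using x by (simp add: nzd_def)
    qed
    finally show "dot (drk ?r (Suc (Suc j))) ?c (dd ?r ?d h x (Suc (Suc (Suc j))) v) \<in> J" .
  qed
  from vanD[OF V A _ this] j have "cobd J (drk ?r) (dd ?r ?d h x) (Suc j) ?c" by simp
  then obtain e where e: "e \<in> freemod (drk ?r (Suc j))"
    "\<And>v. v \<in> freemod (drk ?r (Suc (Suc j))) \<Longrightarrow> dot (drk ?r (Suc (Suc j))) ?c v
       - dot (drk ?r (Suc j)) e (dd ?r ?d h x (Suc (Suc j)) v) \<in> J"
    using acyc_cobd_iff[OF J A] by blast
  define p q where "p = fstv ?n2 e" and "q = sndv ?n2 e"
  have q: "q \<in> freemod ?n1" using e(1) unfolding q_def drk_def by (rule sndv_in)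
  have "dot ?n2 c b - dot ?n1 q (?d2 b) \<in> ?J" if b: "b \<in> freemod ?n2" for b
  proof -
    have db: "?d2 b \<in> freemod ?n1" by (rule linD(1)[OF d b])
    have h0: "h (Suc j) 0 = 0" "?d3 0 = 0" by (rule lin_zero[OF h], rule lin_zero[OF d])
    have "pairv ?n3 0 b \<in> freemod (drk ?r (Suc (Suc j)))" unfolding drk_def using b by (rule pairv_in)
    from e(2)[OF this]
    have "dot ?n2 (- c) b - (dot ?n2 p (- fsmult x b) + dot ?n1 q (- ?d2 b)) \<in> J"
      unfolding dd_pairv[where rk = ?r and i = "Suc j", OF fm_zero] drk_def dot_pairv p_def q_def h0
      using \<mu>(1) b by (simp del: shift_simps)
    then have m: "- (dot ?n2 c b - dot ?n1 q (?d2 b)) + x * dot ?n2 p b \<in> J"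
      by (simp add: dot_simps algebra_simps del: shift_simps)
    have "dot ?n2 c b - dot ?n1 q (?d2 b) = - (- (dot ?n2 c b - dot ?n1 q (?d2 b)) + x * dot ?n2 p b) + x * dot ?n2 p b"
      by simp
    also have "\<dots> \<in> ?J" using m idealD(5)[OF J] unfolding adjoin_def by blast
    finally show ?thesis .
  qed
  then show "cobd ?J rk d j c" using acyc_cobd_iff[OF J' D] c1 q by auto
qed

lemma fsmult_zero_vec [simp]: "fsmult x 0 = 0" by (auto simp: fsmult_apply fun_eq_iff)
lemma fsmult_zero_scalar [simp]: "fsmult 0 v = 0" by (auto simp: fsmult_apply fun_eq_iff)
lemma fsmult_minus_vec: "fsmult x (- v) = - fsmult x v" by (auto simp: fsmult_apply fun_eq_iff)

lemma pairv_at: "pairv n a b n = b 0" by (simp add: pairv_def)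

text \<open>The mapping cone of multiplication by \<open>y\<close>. The hypothesis
  \<open>reg\<close> says that \<open>y\<close> is injective on the cokernel X of
  \<open>d 1\<close>, so the cone resolves X/yX.\<close>

lemma cone_acyc:
  fixes J :: "'a::comm_ring_1 set"
  assumes J: "is_ideal J" and D: "acyc J rk d"
    and reg: "\<And>a b. a \<in> freemod (rk (Suc 0)) \<Longrightarrow> b \<in> freemod (rk 0) \<Longrightarrow> d (Suc 0) a - fsmult y b \<in> vecs J (rk 0) \<Longrightarrow>
      \<exists>\<beta>\<in>freemod (rk (Suc 0)). b - d (Suc 0) \<beta> \<in> vecs J (rk 0)"
  shows "acyc J (drk (shrk rk)) (dd (shrk rk) (shd d) (\<lambda>i v. 0) y)"
proof -
  let ?r = "shrk rk" and ?d = "shd d"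
  note VJ = vecs_module[OF J]
  have d: "lin (?r (Suc i)) (?r i) (?d (Suc i))" for i
    by (rule shd_lin[where rk = rk and d = d, OF acycD(1)[OF D]])
  show ?thesis
  proof (rule doubled_acyc[where rk = ?r and d = ?d and h = "\<lambda>i v. 0", OF J d])
    show "lin (?r (Suc (Suc i))) (?r i) (\<lambda>v. 0)" for i by simp
    show "?d (Suc i) (?d (Suc (Suc i)) v) - fsmult y 0 \<in> vecs J (?r i)"
      if "v \<in> freemod (?r (Suc (Suc i)))" for i v
      using that acycD(2)[OF D, of v] is_moduleD(1)[OF VJ] by (cases i) auto
    show "0 - ?d (Suc i) 0 \<in> vecs J (?r i)" for i
      using lin_zero[OF d[of i]] is_moduleD(1)[OF VJ] by (simp del: shift_simps)
  next
    fix i and a b :: "nat \<Rightarrow> 'a"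
    assume "a \<in> freemod (?r (Suc (Suc i)))" "b \<in> freemod (?r (Suc i))"
      "?d (Suc (Suc i)) a - fsmult y b \<in> vecs J (?r (Suc i))" and e2: "0 - ?d (Suc i) b \<in> vecs J (?r i)"
    then have a: "a \<in> freemod (rk (Suc i))" and b: "b \<in> freemod (rk i)"
      and e1: "d (Suc i) a - fsmult y b \<in> vecs J (rk i)" by simp_all
    have "\<exists>\<beta>\<in>freemod (rk (Suc i)). b - d (Suc i) \<beta> \<in> vecs J (rk i)"
    proof (cases i)
      case 0 then show ?thesis using reg[of a b] a b e1 by simp
    next
      case (Suc k)
      have "- (0 - ?d (Suc i) b) \<in> vecs J (?r i)" by (rule is_moduleD(3)[OF VJ e2])
      then have "d (Suc k) b \<in> vecs J (rk k)" using Suc by simp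
      then show ?thesis using acycD(3)[OF D, of b k] b Suc by simp
    qed
    then obtain \<beta> where \<beta>: "\<beta> \<in> freemod (rk (Suc i))" "b - d (Suc i) \<beta> \<in> vecs J (rk i)" by blast
    note d' = acycD(1)[OF D, of i]
    have "d (Suc i) (a - fsmult y \<beta>) = (d (Suc i) a - fsmult y b) + fsmult y (b - d (Suc i) \<beta>)"
      using a \<beta>(1) by (simp add: lin_diff[OF d'] linD(3)[OF d'] fun_eq_iff fsmult_apply algebra_simps)
    then have "d (Suc i) (a - fsmult y \<beta>) \<in> vecs J (rk i)"
      using is_moduleD(2)[OF VJ e1 is_moduleD(4)[OF VJ \<beta>(2)]] by simp
    from acycD(3)[OF D fm_diff[OF a fm_smult[OF \<beta>(1)]] this]
    obtain \<alpha> where \<alpha>: "\<alpha> \<in> freemod (rk (Suc (Suc i)))"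
      "a - fsmult y \<beta> - d (Suc (Suc i)) \<alpha> \<in> vecs J (rk (Suc i))" by blast
    have 1: "a - (?d (Suc (Suc (Suc i))) \<alpha> - fsmult y (- \<beta>)) \<in> vecs J (?r (Suc (Suc i)))"
      using \<alpha>(2) by (simp add: fsmult_minus_vec algebra_simps)
    have 2: "b - (0 - ?d (Suc (Suc i)) (- \<beta>)) \<in> vecs J (?r (Suc i))"
      using \<beta> by (simp add: lin_minus[OF d'])
    have 3: "\<alpha> \<in> freemod (?r (Suc (Suc (Suc i))))" "- \<beta> \<in> freemod (?r (Suc (Suc i)))"
      using \<alpha> \<beta> by simp_all
    show "\<exists>\<alpha>\<in>freemod (?r (Suc (Suc (Suc i)))). \<exists>\<beta>\<in>freemod (?r (Suc (Suc i))).
         a - (?d (Suc (Suc (Suc i))) \<alpha> - fsmult y \<beta>) \<in> vecs J (?r (Suc (Suc i))) \<and>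
         b - (0 - ?d (Suc (Suc i)) \<beta>) \<in> vecs J (?r (Suc i))"
      using 1 2 3 by blast
  qed
qed

text \<open>From the long exact sequence for \<open>y\<close> on the cokernel X: if degree
  \<open>i + 1\<close> vanishes for X/yX, multiplication by \<open>y\<close> is onto in degree
  \<open>i\<close> for X. In degree 0 the module at \<open>shrk rk 0\<close> is zero, so the same
  formula covers the case without coboundaries.\<close>

lemma cone_cobd:
  fixes J :: "'a::comm_ring_1 set"
  assumes J: "is_ideal J" and D: "acyc J rk d"
    and A: "acyc J (drk (shrk rk)) (dd (shrk rk) (shd d) (\<lambda>i v. 0) y)"
    and van: "\<And>c. cocyc J (drk (shrk rk)) (dd (shrk rk) (shd d) (\<lambda>i v. 0) y) (Suc i) c \<Longrightarrow>
      cobd J (drk (shrk rk)) (dd (shrk rk) (shd d) (\<lambda>i v. 0) y) i c"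
    and c: "cocyc J rk d i c"
  shows "\<exists>p. cocyc J rk d i p \<and> (\<exists>q\<in>freemod (shrk rk i). \<forall>v\<in>freemod (rk i).
     dot (rk i) (c - fsmult y p) v - dot (shrk rk i) q (shd d (Suc i) v) \<in> J)"
proof -
  let ?R = "drk (shrk rk)" and ?E = "dd (shrk rk) (shd d) (\<lambda>i v. 0) y"
  let ?r = "shrk rk" and ?d = "shd d"
  have d: "lin (?r (Suc i)) (?r i) (?d (Suc i))" for i
    by (rule shd_lin[where rk = rk and d = d, OF acycD(1)[OF D]])
  let ?n0 = "?r i" and ?n1 = "?r (Suc i)" and ?n2 = "?r (Suc (Suc i))" and ?n3 = "?r (Suc (Suc (Suc i)))"
  let ?d1 = "?d (Suc i)" and ?d2 = "?d (Suc (Suc i))" and ?d3 = "?d (Suc (Suc (Suc i)))"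
  have c1: "c \<in> freemod ?n1" and c2: "\<And>v. v \<in> freemod ?n2 \<Longrightarrow> dot ?n1 c (?d2 v) \<in> J"
    using c acyc_cocyc_iff[OF J D] by auto
  let ?c = "pairv ?n2 0 c"
  have "cocyc J ?R ?E (Suc i) ?c"
  proof (subst acyc_cocyc_iff[OF J A], intro conjI ballI)
    show "?c \<in> freemod (?R (Suc i))" unfolding drk_def using c1 by (intro pairv_in)
    fix v :: "nat \<Rightarrow> 'a" assume "v \<in> freemod (?R (Suc (Suc i)))"
    then obtain a b where ab: "a \<in> freemod ?n3" "b \<in> freemod ?n2" "v = pairv ?n3 a b"
      unfolding drk_def by (metis fstv_in sndv_in pairv_fst_snd)
    have "dot (?R (Suc i)) ?c (?E (Suc (Suc i)) v) = - dot ?n1 c (?d2 b)"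
      unfolding ab(3) dd_pairv[where rk = ?r, OF ab(1)] drk_def dot_pairv
      using ab(2) by (simp add: dot_simps del: shift_simps)
    then show "dot (?R (Suc i)) ?c (?E (Suc (Suc i)) v) \<in> J" using idealD(5)[OF J c2[OF ab(2)]] by simp
  qed
  from van[OF this] obtain e where e: "e \<in> freemod (?R i)"
    "\<And>v. v \<in> freemod (?R (Suc i)) \<Longrightarrow> dot (?R (Suc i)) ?c v - dot (?R i) e (?E (Suc i) v) \<in> J"
    using acyc_cobd_iff[OF J A] by blast
  define p q where "p = fstv ?n1 e" and "q = sndv ?n1 e"
  have q: "q \<in> freemod ?n0" using e(1) unfolding q_def drk_def by (rule sndv_in)
  have p: "p \<in> freemod ?n1" unfolding p_def by (rule fstv_in)
  have pc: "dot ?n1 p (?d2 a) \<in> J" if a: "a \<in> freemod ?n2" for a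
  proof -
    have d0: "?d1 0 = 0" by (rule lin_zero[OF d])
    have da: "?d2 a \<in> freemod ?n1" by (rule linD(1)[OF d a])
    have "pairv ?n2 a 0 \<in> freemod (?R (Suc i))" unfolding drk_def by (rule pairv_in[OF fm_zero])
    from e(2)[OF this] have "- dot ?n1 p (?d2 a) \<in> J"
      unfolding dd_pairv[where rk = ?r and i = i, OF a] drk_def dot_pairv p_def q_def d0
      using a da by (simp del: shift_simps)
    from idealD(5)[OF J this] show ?thesis by simp
  qed
  have cb: "dot ?n1 (c - fsmult y (- p)) b - dot ?n0 (- q) (?d1 b) \<in> J" if b: "b \<in> freemod ?n1" for b
  proof -
    have d0: "?d2 0 = 0" by (rule lin_zero[OF d])
    have "pairv ?n2 0 b \<in> freemod (?R (Suc i))" unfolding drk_def by (rule pairv_in[OF b])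
    from e(2)[OF this] have "dot ?n1 c b - (dot ?n1 p (- fsmult y b) + dot ?n0 q (- ?d1 b)) \<in> J"
      unfolding dd_pairv[where rk = ?r and i = i, OF fm_zero] drk_def dot_pairv p_def q_def d0
      using b by (simp del: shift_simps)
    then show ?thesis by (simp add: dot_simps algebra_simps del: shift_simps)
  qed
  have "dot ?n1 (- p) (?d2 a) \<in> J" if "a \<in> freemod ?n2" for a
    using idealD(5)[OF J pc[OF that]] by (simp add: dot_minus_left)
  then have "cocyc J rk d i (- p)" using acyc_cocyc_iff[OF J D, of i "- p"] p by simp
  moreover have "- q \<in> freemod ?n0" using q by simp
  ultimately show ?thesis using cb by (metis shift_simps(2))
qed

text \<open>Dropping position 0 replaces the cokernel by the image of \<open>d 1\<close>, which over
  R/J sits in a free module; there \<open>x\<close> acts injectively, so reduction modulo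
  \<open>x\<close> keeps the complex exact. The price is one position.\<close>

lemma acyc_shift_quotient:
  fixes J :: "'a::comm_ring_1 set"
  assumes J: "is_ideal J" and D: "acyc J rk d" and x: "nzd J x"
  shows "acyc (adjoin J x) (\<lambda>i. rk (Suc i)) (\<lambda>i. d (Suc i))"
  unfolding acyc_def
proof (intro conjI allI ballI impI)
  note VJ = vecs_module[OF J]
  fix i
  show "lin (rk (Suc (Suc i))) (rk (Suc i)) (d (Suc (Suc i)))" by (rule acycD(1)[OF D])
  show "d (Suc (Suc i)) (d (Suc (Suc (Suc i))) v) \<in> vecs (adjoin J x) (rk (Suc i))"
    if "v \<in> freemod (rk (Suc (Suc (Suc i))))" for v
    using acycD(2)[OF D that] vecs_mono[OF adjoin_sub] by blast
  let ?d1 = "d (Suc i)" and ?d2 = "d (Suc (Suc i))" and ?d3 = "d (Suc (Suc (Suc i)))"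
  note l1 = acycD(1)[OF D, of i] and l2 = acycD(1)[OF D, of "Suc i"]
  show "\<exists>w\<in>freemod (rk (Suc (Suc (Suc i)))). v - ?d3 w \<in> vecs (adjoin J x) (rk (Suc (Suc i)))"
    if v: "v \<in> freemod (rk (Suc (Suc i)))" "?d2 v \<in> vecs (adjoin J x) (rk (Suc i))" for v
  proof -
    obtain b where b: "b \<in> freemod (rk (Suc i))" "?d2 v - fsmult x b \<in> vecs J (rk (Suc i))"
      using adjoin_vecs[OF J v(2)] by blast
    have "?d1 (?d2 v - fsmult x b) \<in> vecs J (rk i)" by (rule lin_vecs[OF J l1 b(2)])
    then have "?d1 (?d2 v) - fsmult x (?d1 b) \<in> vecs J (rk i)"
      using b(1) linD(1)[OF l2 v(1)] by (simp add: lin_diff[OF l1] linD(3)[OF l1])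
    from module_diff[OF VJ acycD(2)[OF D v(1)] this] have "fsmult x (?d1 b) \<in> vecs J (rk i)" by simp
    from nzd_vecs[OF x linD(1)[OF l1 b(1)] this] acycD(3)[OF D b(1)]
    obtain w where w: "w \<in> freemod (rk (Suc (Suc i)))" "b - ?d2 w \<in> vecs J (rk (Suc i))" by blast
    have "?d2 (v - fsmult x w) = (?d2 v - fsmult x b) + fsmult x (b - ?d2 w)"
      using v w by (simp add: lin_diff[OF l2] linD(3)[OF l2] fun_eq_iff fsmult_apply algebra_simps)
    then have "?d2 (v - fsmult x w) \<in> vecs J (rk (Suc i))"
      using is_moduleD(2)[OF VJ b(2) is_moduleD(4)[OF VJ w(2)]] by simp
    from acycD(3)[OF D fm_diff[OF v(1) fm_smult[OF w(1)]] this]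
    obtain u where u: "u \<in> freemod (rk (Suc (Suc (Suc i))))"
      "v - fsmult x w - ?d3 u \<in> vecs J (rk (Suc (Suc i)))" by blast
    have "v - ?d3 u - fsmult x w \<in> vecs J (rk (Suc (Suc i)))" using u(2) by (simp add: algebra_simps)
    from adjoin_vecsI[OF J w(1) this] u(1) show ?thesis by blast
  qed
qed

text \<open>Turning around the dual of a finite stretch of a complex and continuing it by a resolution.\<close>
lemma dual_complex:
  fixes J :: "'a::comm_ring_1 set"
  assumes R: "noethmod (UNIV :: 'a set) (*)" and J: "is_ideal J" and D: "acyc J rk d" and p: "p \<ge> 1"
    and ex: "\<And>k c. l \<le> k \<Longrightarrow> Suc k < l + p \<Longrightarrow> cocyc J rk d (Suc k) c \<Longrightarrow> cobd J rk d k c"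
    and g: "lin q (rk l) g" "\<And>v. v \<in> freemod q \<Longrightarrow> cocyc J rk d l (g v)"
      "\<And>c. cocyc J rk d l c \<Longrightarrow> \<exists>v\<in>freemod q. c - g v \<in> vecs J (rk l)"
  obtains rk' d' where "acyc J rk' d'" "\<forall>i\<le>p. rk' i = rk (l + p - i)" "rk' (Suc p) = q"
    "\<forall>i<p. d' (Suc i) = transp (rk (l + p - i)) (rk (l + p - Suc i)) (d (l + p - i))"
    "d' (Suc p) = g"
proof -
  define r where "r i = (if i \<le> p then rk (l + p - i) else q)" for i
  define e where "e i = (if i \<le> p then transp (rk (l + p - (i - 1))) (rk (l + p - i)) (d (l + p - (i - 1))) else g)" for i
  have e1: "e (Suc i) = transp (rk (l + p - i)) (rk (l + p - Suc i)) (d (l + p - i))" if "i < p" for i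
    using that by (simp add: e_def)
  have r1: "r i = rk (l + p - i)" if "i \<le> p" for i using that by (simp add: r_def)
  have ep: "e (Suc p) = g" "r (Suc p) = q" by (simp_all add: e_def r_def)
  have "\<exists>rk' d'. acyc J rk' d' \<and> (\<forall>i\<le>Suc p. rk' i = r i) \<and> (\<forall>i<Suc p. d' (Suc i) = e (Suc i))"
  proof (rule extend_complex[OF R J])
    show "1 \<le> Suc p" by simp
    show "lin (r (Suc i)) (r i) (e (Suc i))" if "i < Suc p" for i
    proof (cases "i = p")
      case True then show ?thesis using g(1) by (simp add: ep r_def)
    next
      case False then show ?thesis using that lin_transp by (simp add: e1 r1)
    qed
  next
    fix i assume i: "Suc i < Suc p"
    then have ip: "i < p" by simp
    \<comment> \<open>Position \<open>Suc i\<close> of the turned complex is position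
      \<open>k\<close> of the old one.\<close>
    define k where "k = l + p - Suc i"
    have k: "l + p - i = Suc k" "l \<le> k" "l + p - Suc i = k" using ip by (auto simp: k_def)
    have ei: "e (Suc i) = transp (rk (Suc k)) (rk k) (d (Suc k))" "r i = rk (Suc k)" "r (Suc i) = rk k"
      using ip by (simp_all add: e1 r1 k)
    have cc: "e (Suc i) c \<in> vecs J (r i) \<longleftrightarrow> cocyc J rk d k c" if "c \<in> freemod (rk k)" for c
      using that by (simp add: ei cocyc_def)
    show "e (Suc i) (e (Suc (Suc i)) v) \<in> vecs J (r i)" if v: "v \<in> freemod (r (Suc (Suc i)))" for v
    proof (cases "Suc i = p")
      case True
      then have "k = l" by (simp add: k_def)
      then show ?thesis using g(2)[of v] v True cc[of "g v"] by (simp add: ep cocyc_def)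
    next
      case False
      then have sp: "Suc i < p" using ip by simp
      define n where "n = l + p - Suc (Suc i)"
      have n: "k = Suc n" "l + p - Suc (Suc i) = n" "l + p - Suc i = Suc n" using sp by (auto simp: k_def n_def)
      have e2: "e (Suc (Suc i)) v = transp (rk (Suc n)) (rk n) (d (Suc n)) v"
        using sp e1[of "Suc i"] n by simp
      have vn: "v \<in> freemod (rk n)" using v sp n by (simp add: r_def)
      have "e (Suc (Suc i)) v - transp (rk (Suc n)) (rk n) (d (Suc n)) v \<in> vecs J (rk (Suc n))"
        using e2 is_moduleD(1)[OF vecs_module[OF J]] by simp
      moreover have "e (Suc (Suc i)) v \<in> freemod (rk (Suc n))" unfolding e2 by (rule transp_in)
      ultimately have "cobd J rk d n (e (Suc (Suc i)) v)" using vn unfolding cobd_def by blast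
      from cobd_cocyc[OF J D this] show ?thesis using cc[of "e (Suc (Suc i)) v"] n by (simp add: cocyc_def)
    qed
    show "\<exists>w\<in>freemod (r (Suc (Suc i))). v - e (Suc (Suc i)) w \<in> vecs J (r (Suc i))"
      if v: "v \<in> freemod (r (Suc i))" "e (Suc i) v \<in> vecs J (r i)" for v
    proof -
      have c: "cocyc J rk d k v" using v cc ei by simp
      show ?thesis
      proof (cases "Suc i = p")
        case True
        then have "k = l" by (simp add: k_def)
        then show ?thesis using g(3)[of v] c True r1[of p] by (simp add: ep)
      next
        case False
        then have sp: "Suc i < p" using ip by simp
        define n where "n = l + p - Suc (Suc i)"
        have n: "k = Suc n" "l + p - Suc (Suc i) = n" "l + p - Suc i = Suc n" using sp by (auto simp: k_def n_def)
        have e2: "e (Suc (Suc i)) = transp (rk (Suc n)) (rk n) (d (Suc n))" "r (Suc (Suc i)) = rk n"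
          using sp e1[of "Suc i"] n by (simp_all add: r_def)
        have ln: "l \<le> n" "Suc n < l + p" using sp by (auto simp: n_def)
        have "cobd J rk d n v" by (rule ex[OF ln]) (use c n(1) in simp)
        then show ?thesis unfolding cobd_def e2 ei n by blast
      qed
    qed
  qed
  then obtain rk' d' where A: "acyc J rk' d'" "\<And>i. i \<le> Suc p \<Longrightarrow> rk' i = r i" "\<And>i. i < Suc p \<Longrightarrow> d' (Suc i) = e (Suc i)"
    by blast
  show ?thesis
  proof (rule that[OF A(1)])
    show "\<forall>i\<le>p. rk' i = rk (l + p - i)" using A(2) r1 by simp
    show "rk' (Suc p) = q" using A(2)[of "Suc p"] ep by simp
    show "\<forall>i<p. d' (Suc i) = transp (rk (l + p - i)) (rk (l + p - Suc i)) (d (l + p - i))"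
      using A(3) e1 by simp
    show "d' (Suc p) = g" using A(3)[of p] ep by simp
  qed
qed

section \<open>Injective dimension: socles, regular elements and depth\<close>

context local_noeth
begin

lemma lin_extend:
  assumes g1: "lin q n g1" and w: "w \<in> freemod n"
  shows "lin (q + 1) n (\<lambda>v. g1 (fstv q v) + fsmult (v q) w)"
proof -
  have "lin (q + 1) n (\<lambda>v. g1 (fstv q v) + comb 1 fsmult (\<lambda>_. w) (sndv q v))"
    by (intro hom_add[OF freemod_module hom_comp[OF lin_fstv g1] hom_comp[OF lin_sndv comb_hom]]) (auto simp: w)
  then show ?thesis by (simp add: comb_def sndv_def)
qed

text \<open>The functional that is \<open>u\<close> on the generator \<open>w\<close> and zero on the generators of \<open>V'\<close> is a cocycle,
  because relations have their \<open>w\<close>-coefficient in the maximal ideal.\<close>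
lemma socle_functional:
  assumes J: "is_ideal J" and u: "\<And>a. a \<in> \<mm> \<Longrightarrow> u * a \<in> J" and C: "acyc J r e"
    and g: "r (Suc p) = q + 1" "e (Suc p) = (\<lambda>v. g1 (fstv q v) + fsmult (v q) w)"
    and V': "is_module V' fsmult" "vecs J (r p) \<subseteq> V'" "V' \<subseteq> freemod (r p)"
    and g1: "is_hom (freemod q) fsmult V' fsmult g1" "g1 ` freemod q = V'"
    and w: "w \<in> freemod (r p)" "\<And>c. fsmult c w \<in> V' \<Longrightarrow> c \<in> \<mm>"
    and cob: "\<And>c. cocyc J r e (Suc p) c \<Longrightarrow> cobd J r e p c"
  shows "\<exists>b\<in>freemod (r p). (\<forall>v\<in>V'. dot (r p) b v \<in> J) \<and> u - dot (r p) b w \<in> J"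
proof -
  have g1l: "lin q (r p) g1" using g1(1) V'(3) unfolding is_hom_def by blast
  let ?c = "fsmult u (unitv q)" and ?g = "\<lambda>v. g1 (fstv q v) + fsmult (v q) w"
  have dq: "dot (q + 1) ?c v = u * v q" for v
    by (simp add: dot_smult_left dot_commute[of _ "unitv q"] dot_unitv)
  have "cocyc J r e (Suc p) ?c"
  proof (subst acyc_cocyc_iff[OF J C], unfold g(1), intro conjI ballI)
    show "?c \<in> freemod (q + 1)" by simp
    fix y :: "nat \<Rightarrow> 'a" assume y: "y \<in> freemod (r (Suc (Suc p)))"
    define z where "z = e (Suc (Suc p)) y"
    have "?g z \<in> vecs J (r p)" using acycD(2)[OF C y] by (simp add: z_def g)
    then have "?g z \<in> V'" using V'(2) by blast
    moreover have "g1 (fstv q z) \<in> V'" by (rule is_homD(1)[OF g1(1) fstv_in])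
    ultimately have "fsmult (z q) w \<in> V'" using module_diff[OF V'(1), of "?g z" "g1 (fstv q z)"] by simp
    then show "dot (q + 1) ?c (e (Suc (Suc p)) y) \<in> J" unfolding z_def[symmetric] dq using w(2) u by blast
  qed
  from cob[OF this] obtain b where b: "b \<in> freemod (r p)"
    "\<And>z. z \<in> freemod (q + 1) \<Longrightarrow> u * z q - dot (r p) b (?g z) \<in> J"
    unfolding acyc_cobd_iff[OF J C] g dq by blast
  have "dot (r p) b v \<in> J" if vV: "v \<in> V'" for v
  proof -
    obtain a where a: "a \<in> freemod q" "v = g1 a" using g1(2) vV by blast
    have "pairv q a 0 \<in> freemod (q + 1)" by (rule pairv_in[OF fm_zero])
    from b(2)[OF this] have "- dot (r p) b v \<in> J" using a by (simp add: pairv_at)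
    from idealD(5)[OF J this] show ?thesis by simp
  qed
  moreover have "u - dot (r p) b w \<in> J"
  proof -
    have "fstv q (unitv q) = (0 :: nat \<Rightarrow> 'a)" by (auto simp: fstv_def unitv_def)
    then have "?g (unitv q) = w" using lin_zero[OF g1l] w(1)
      by (simp add: unitv_apply is_moduleD(8)[OF freemod_module])
    moreover have "(unitv q :: nat \<Rightarrow> 'a) \<in> freemod (q + 1)" by simp
    ultimately show ?thesis using b(2)[of "unitv q"] by (simp add: unitv_apply)
  qed
  ultimately show ?thesis using b(1) by blast
qed

text \<open>Suppose degree \<open>N\<close> is nonzero, and let \<open>w\<close> be a cocycle
  generating a simple quotient of it. Dualise the stretch from \<open>N\<close> to
  \<open>2 * N\<close> and end it with generators of the cocycles, \<open>w\<close> among them. The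
  functional sending \<open>w\<close> to the socle element \<open>u\<close> now has degree
  \<open>N + 1\<close>, where vanishing is known, so it is the pairing with some \<open>b\<close>.
  As \<open>b\<close> annihilates the coboundaries it is a cycle, hence a boundary, hence
  annihilates the cocycle \<open>w\<close>; this forces \<open>u\<close> into
  \<open>J\<close>.\<close>

lemma van_descend:
  assumes J: "is_ideal J" and u: "u \<notin> J" "\<And>a. a \<in> \<mm> \<Longrightarrow> u * a \<in> J" and N: "N \<ge> 1" and V: "van J (Suc N)"
  shows "van J N"
  unfolding van_def
proof (intro allI impI)
  fix rk j c and d :: "nat \<Rightarrow> (nat \<Rightarrow> 'a) \<Rightarrow> (nat \<Rightarrow> 'a)"
  assume D: "acyc J rk d" and j: "N \<le> Suc j" and c: "cocyc J rk d (Suc j) c"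
  show "cobd J rk d j c"
  proof (cases "Suc N \<le> Suc j")
    case True show ?thesis by (rule vanD[OF V D True c])
  next
    case False
    then have jN: "N = Suc j" using j by simp
    let ?W = "{c. cocyc J rk d N c}" and ?U = "{c. cobd J rk d j c}"
    have W: "is_module ?W fsmult" "?W \<subseteq> freemod (rk N)" by (rule cocyc_module[OF J]) (auto simp: cocyc_def)
    have U: "is_module ?U fsmult" "?U \<subseteq> ?W" using cobd_module[OF J] cobd_cocyc[OF J D] jN by auto
    have "?U = ?W"
    proof (rule ccontr)
      assume ne: "?U \<noteq> ?W"
      obtain V' w where V': "is_module V' fsmult" "?U \<subseteq> V'" "V' \<subseteq> ?W" "w \<in> ?W" and "w \<notin> V'"
        and V'2: "?W = {v + fsmult c w | v c. v \<in> V'}" "\<forall>c. fsmult c w \<in> V' \<longrightarrow> c \<in> \<mm>"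
        and "\<forall>c\<in>\<mm>. \<forall>v\<in>?W. fsmult c v \<in> V'"
        by (rule maximal_submodule[OF free_noeth W U ne])
      have V'sub: "V' \<subseteq> freemod (rk N)" using V'(3) W(2) by blast
      have wf: "w \<in> freemod (rk N)" using V'(4) W(2) by blast
      obtain q g1 where g1: "is_hom (freemod q) fsmult V' fsmult g1" "g1 ` freemod q = V'"
        by (rule noethmod_cover[OF free_noeth V'sub V'(1)])
      have g1l: "lin q (rk N) g1" using g1(1) V'sub unfolding is_hom_def by blast
      define g where "g v = g1 (fstv q v) + fsmult (v q) w" for v
      note gv = g_def
      have gl: "lin (q + 1) (rk N) g" unfolding g_def by (rule lin_extend[OF g1l wf])
      have VJ: "vecs J (rk N) \<subseteq> V'" using V'(2) vecs_cobd[OF J] jN by blast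
      \<comment> \<open>The stretch has length \<open>N\<close> in order that the generators of the
        cocycles land in position \<open>N + 1\<close>.\<close>
      obtain rk' d' where C: "acyc J rk' d'" "\<forall>i\<le>N. rk' i = rk (N + N - i)" "rk' (Suc N) = q + 1" "d' (Suc N) = g"
      proof (rule dual_complex[OF noeth J D N, of N "q + 1" g])
        show "cobd J rk d k c" if "N \<le> k" "cocyc J rk d (Suc k) c" for k c
          by (rule vanD[OF V D _ that(2)]) (use that in simp)
        show "lin (q + 1) (rk N) g" by (rule gl)
        show "cocyc J rk d N (g v)" if "v \<in> freemod (q + 1)" for v
        proof -
          have "g1 (fstv q v) \<in> V'" by (rule is_homD(1)[OF g1(1) fstv_in])
          then have "g v \<in> {v + fsmult c w | v c. v \<in> V'}" unfolding gv by blast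
          then show ?thesis using V'2(1) by blast
        qed
        show "\<exists>v\<in>freemod (q + 1). c - g v \<in> vecs J (rk N)" if "cocyc J rk d N c" for c
        proof -
          have "c \<in> {v + fsmult c w | v c. v \<in> V'}" using V'2(1) that by blast
          then obtain v b where vb: "c = v + fsmult b w" "v \<in> V'" by blast
          then obtain a where a: "a \<in> freemod q" "v = g1 a" using g1(2) by blast
          have b1: "(\<lambda>i. if i = 0 then b else 0) \<in> freemod 1" by (simp add: freemod_def)
          have "g (pairv q a (\<lambda>i. if i = 0 then b else 0)) = c"
            unfolding gv using a vb by (simp add: pairv_at)
          then have "c - g (pairv q a (\<lambda>i. if i = 0 then b else 0)) \<in> vecs J (rk N)"
            using is_moduleD(1)[OF vecs_module[OF J]] by simp
          then show ?thesis using pairv_in[OF b1] by blast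
        qed
      qed blast
      have rkN: "rk' N = rk N" using C(2) by simp
      obtain b where b: "b \<in> freemod (rk N)" and bV: "\<And>v. v \<in> V' \<Longrightarrow> dot (rk N) b v \<in> J" and bw: "u - dot (rk N) b w \<in> J"
        using socle_functional[where p = N and V' = V', OF J u(2) C(1,3) _ V'(1) _ _ g1 _ _ vanD[OF V C(1)]]
          C(4) VJ V'sub wf V'2(2) unfolding rkN g_def by blast
      have l: "lin (rk N) (rk j) (d N)" using acycD(1)[OF D, of j] jN by simp
      have "d N b \<in> vecs J (rk j)"
      proof (rule vecsI_dot[OF J linD(1)[OF l b]])
        fix e :: "nat \<Rightarrow> 'a" assume e: "e \<in> freemod (rk j)"
        have "cobd J rk d j (transp (rk N) (rk j) (d N) e)"
          unfolding cobd_def jN using e is_moduleD(1)[OF vecs_module[OF J]] by (intro conjI bexI[of _ e]) auto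
        then have "dot (rk N) b (transp (rk N) (rk j) (d N) e) \<in> J" using bV V'(2) by blast
        then show "dot (rk j) (d N b) e \<in> J"
          using dot_transp[OF l b, of e] by (simp add: dot_commute)
      qed
      then obtain w' where w': "w' \<in> freemod (rk (Suc N))" "b - d (Suc N) w' \<in> vecs J (rk N)"
        using acycD(3)[OF D, of b j] b jN by auto
      have "cocyc J rk d N w" using V'(4) by blast
      then have "dot (rk N) w (d (Suc N) w') \<in> J" using acyc_cocyc_iff[OF J D] w'(1) by blast
      moreover have "dot (rk N) w (b - d (Suc N) w') \<in> J" by (rule dot_vecs_right[OF J w'(2)])
      ultimately have "dot (rk N) w b \<in> J" using idealD(2)[OF J] by (fastforce simp: dot_diff_right)
      then have "dot (rk N) b w \<in> J" by (simp add: dot_commute)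
      with bw have "u \<in> J" using idealD(2)[OF J] by fastforce
      then show False using u(1) by blast
    qed
    then show ?thesis using c jN by blast
  qed
qed

lemma van_socle:
  assumes J: "is_ideal J" and u: "u \<notin> J" "\<And>a. a \<in> \<mm> \<Longrightarrow> u * a \<in> J" and V: "van J N"
  shows "van J 1"
proof -
  \<comment> \<open>\<open>van_descend\<close> stops at 1; starting from \<open>Suc N\<close> also
    covers \<open>N = 0\<close>.\<close>
  have "van J (Suc N)" using van_mono[OF V] by simp
  then show ?thesis
  proof (induction N)
    case 0 then show ?case by simp
  next
    case (Suc N) then show ?case using van_descend[OF J u, of "Suc N"] by simp
  qed
qed

text \<open>On the complex without position 0, a cocycle of degree \<open>j + 1\<close> becomes one
  of degree \<open>j\<close> modulo J + (x), hence a coboundary up to a term x \<mu>. By regularity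
  \<open>\<mu>\<close> is again a cocycle, so Nakayama's lemma applies to the cocycles over the
  coboundaries.\<close>

lemma van_lift:
  assumes J: "is_ideal J" and x: "nzd J x" "x \<in> \<mm>" and N: "N \<ge> 1" and V: "van (adjoin J x) N"
  shows "van J (Suc N)"
  unfolding van_def
proof (intro allI impI)
  fix rk j c and d :: "nat \<Rightarrow> (nat \<Rightarrow> 'a) \<Rightarrow> (nat \<Rightarrow> 'a)"
  let ?J = "adjoin J x"
  have J': "is_ideal ?J" by (rule adjoin_ideal[OF J])
  assume D: "acyc J rk d" and j: "Suc N \<le> Suc j" and c: "cocyc J rk d (Suc j) c"
  obtain k where k: "j = Suc k" using j N by (cases j) auto
  let ?W = "{c. cocyc J rk d (Suc j) c}" and ?U = "{c. cobd J rk d j c}"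
  note D' = acyc_shift_quotient[OF J D x(1)]
  have W: "is_module ?W fsmult" "?W \<subseteq> freemod (rk (Suc j))" by (rule cocyc_module[OF J]) (auto simp: cocyc_def)
  have U: "is_module ?U fsmult" "?U \<subseteq> ?W" using cobd_module[OF J] cobd_cocyc[OF J D] by auto
  have "?W = ?U"
  proof (rule nakayama[OF free_noeth W U x(2)])
    fix w assume "w \<in> ?W"
    then have w: "w \<in> freemod (rk (Suc j))" "\<And>v. v \<in> freemod (rk (Suc (Suc j))) \<Longrightarrow> dot (rk (Suc j)) w (d (Suc (Suc j)) v) \<in> J"
      using acyc_cocyc_iff[OF J D] by auto
    have "cocyc ?J (\<lambda>i. rk (Suc i)) (\<lambda>i. d (Suc i)) (Suc k) w"
      unfolding acyc_cocyc_iff[OF J' D'] using w k adjoin_sub by auto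
    from vanD[OF V D' _ this] j k have "cobd ?J (\<lambda>i. rk (Suc i)) (\<lambda>i. d (Suc i)) k w" by simp
    then obtain b where b: "b \<in> freemod (rk j)" "w - transp (rk (Suc j)) (rk j) (d (Suc j)) b \<in> vecs ?J (rk (Suc j))"
      unfolding cobd_def k by blast
    let ?t = "transp (rk (Suc j)) (rk j) (d (Suc j)) b"
    obtain \<mu> where \<mu>: "\<mu> \<in> freemod (rk (Suc j))" "w - ?t - fsmult x \<mu> \<in> vecs J (rk (Suc j))"
      using adjoin_vecs[OF J b(2)] by blast
    note l = acycD(1)[OF D, of j]
    have "dot (rk (Suc j)) \<mu> (d (Suc (Suc j)) v) \<in> J" if v: "v \<in> freemod (rk (Suc (Suc j)))" for v
    proof -
      have dv: "d (Suc (Suc j)) v \<in> freemod (rk (Suc j))" by (rule linD(1)[OF acycD(1)[OF D] v])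
      have "x * dot (rk (Suc j)) \<mu> (d (Suc (Suc j)) v) = dot (rk (Suc j)) w (d (Suc (Suc j)) v)
        - dot (rk j) b (d (Suc j) (d (Suc (Suc j)) v)) - dot (rk (Suc j)) (w - ?t - fsmult x \<mu>) (d (Suc (Suc j)) v)"
        using dot_transp[OF l dv, of b] by (simp add: dot_simps)
      also have "\<dots> \<in> J"
        by (intro idealD(6)[OF J] w(2)[OF v] dot_vecs_right[OF J acycD(2)[OF D v]] dot_vecs_left[OF J \<mu>(2)])
      finally show ?thesis using x(1) by (simp add: nzd_def)
    qed
    then have "\<mu> \<in> ?W" using acyc_cocyc_iff[OF J D] \<mu>(1) by auto
    moreover have "w - fsmult x \<mu> - ?t \<in> vecs J (rk (Suc j))" using \<mu>(2) by (simp add: algebra_simps)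
    then have "w - fsmult x \<mu> \<in> ?U" unfolding cobd_def using b(1) w(1) \<mu>(1) by auto
    ultimately show "\<exists>w'\<in>?W. w - fsmult x w' \<in> ?U" by blast
  qed
  then show "cobd J rk d j c" using c by blast
qed

text \<open>Regular sequences on the cokernel of the relations \<open>B\<close> in R^n, each element
  being added to the relations in turn. Nonvanishing of the last quotient is not included.\<close>

fun creg :: "nat \<Rightarrow> (nat \<Rightarrow> 'a) set \<Rightarrow> 'a list \<Rightarrow> bool" where
  "creg n B [] = True"
| "creg n B (y # ys) \<longleftrightarrow> y \<in> \<mm> \<and> (\<forall>v\<in>freemod n. fsmult y v \<in> B \<longrightarrow> v \<in> B) \<and>
     creg n {b + fsmult y v | b v. b \<in> B \<and> v \<in> freemod n} ys"

text \<open>Injective dimension minus depth bounds the nonzero degrees. Induction on the sequence: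
  the cone of \<open>y\<close> resolves X/yX, so \<open>y\<close> acts surjectively on X in the
  degrees concerned, and Nakayama's lemma applies. Degree 0, which \<open>cobd\<close> does not
  reach, is the separate clause: there are no nonzero functionals once a nonempty sequence has
  length at least \<open>N\<close>.\<close>

lemma van_regular_cokernel:
  assumes V: "van ({0} :: 'a set) N"
  shows "acyc {0} rk d \<Longrightarrow> creg (rk 0) (d (Suc 0) ` freemod (rk (Suc 0))) ys \<Longrightarrow>
    (\<forall>j c. N \<le> Suc j + length ys \<longrightarrow> cocyc {0} rk d (Suc j) c \<longrightarrow> cobd {0} rk d j c) \<and>
    (\<forall>c. ys \<noteq> [] \<longrightarrow> N \<le> length ys \<longrightarrow> cocyc {0} rk d 0 c \<longrightarrow> c = 0)"
proof (induction ys arbitrary: rk d)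
  case Nil
  then show ?case using vanD[OF V] by auto
next
  case (Cons y ys)
  note D = Cons.prems(1)
  let ?R = "drk (shrk rk)" and ?E = "dd (shrk rk) (shd d) (\<lambda>i v. 0) y"
  let ?B = "d (Suc 0) ` freemod (rk (Suc 0))"
  have y: "y \<in> \<mm>" and reg: "\<And>v. v \<in> freemod (rk 0) \<Longrightarrow> fsmult y v \<in> ?B \<Longrightarrow> v \<in> ?B"
    and cr: "creg (rk 0) {b + fsmult y v | b v. b \<in> ?B \<and> v \<in> freemod (rk 0)} ys"
    using Cons.prems(2) by auto
  have A: "acyc {0} ?R ?E"
  proof (rule cone_acyc[OF zero_ideal D])
    fix a b :: "nat \<Rightarrow> 'a" assume "a \<in> freemod (rk (Suc 0))" "b \<in> freemod (rk 0)" "d (Suc 0) a - fsmult y b \<in> vecs {0} (rk 0)"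
    then have "b \<in> ?B" using reg[of b] by (metis eq_iff_diff_eq_0 image_eqI singletonD vecs_zero)
    then show "\<exists>\<beta>\<in>freemod (rk (Suc 0)). b - d (Suc 0) \<beta> \<in> vecs {0} (rk 0)" by auto
  qed
  have R0: "?R 0 = rk 0" "?R (Suc 0) = rk (Suc 0) + rk 0" by (simp_all add: drk_def)
  have E: "?E (Suc 0) (pairv (rk (Suc 0)) a b) = d (Suc 0) a - fsmult y b"
    if "a \<in> freemod (rk (Suc 0))" "b \<in> freemod (rk 0)" for a b
  proof -
    have "d (Suc 0) a - fsmult y b \<in> freemod (rk 0)" using that linD(1)[OF acycD(1)[OF D]] by auto
    moreover have "pairv n v 0 = v" if "v \<in> freemod n" for n and v :: "nat \<Rightarrow> 'a"
      using that by (auto simp: pairv_def freemod_def)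
    ultimately show ?thesis using dd_pairv[where rk = "shrk rk" and i = 0 and a = a] that by simp
  qed
  \<comment> \<open>The relations of the cone are exactly the enlarged relations in the recursion of
    \<open>creg\<close>.\<close>
  have im: "?E (Suc 0) ` freemod (?R (Suc 0)) = {b + fsmult y v | b v. b \<in> ?B \<and> v \<in> freemod (rk 0)}"
  proof (intro equalityI subsetI)
    fix z assume "z \<in> ?E (Suc 0) ` freemod (?R (Suc 0))"
    then obtain v where v: "v \<in> freemod (rk (Suc 0) + rk 0)" "z = ?E (Suc 0) v" unfolding R0 by blast
    define a b where "a = fstv (rk (Suc 0)) v" and "b = sndv (rk (Suc 0)) v"
    have ab: "a \<in> freemod (rk (Suc 0))" "b \<in> freemod (rk 0)" "v = pairv (rk (Suc 0)) a b"
      using v by (auto simp: a_def b_def)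
    have "z = d (Suc 0) a + fsmult y (- b)" using v(2) ab E by (simp add: fsmult_minus_vec)
    then show "z \<in> {b + fsmult y v | b v. b \<in> ?B \<and> v \<in> freemod (rk 0)}" using ab fm_minus by blast
  next
    fix z assume "z \<in> {b + fsmult y v | b v. b \<in> ?B \<and> v \<in> freemod (rk 0)}"
    then obtain a v where a: "a \<in> freemod (rk (Suc 0))" "v \<in> freemod (rk 0)" "z = d (Suc 0) a + fsmult y v" by blast
    then have "z = ?E (Suc 0) (pairv (rk (Suc 0)) a (- v))" using E[of a "- v"] by (simp add: fsmult_minus_vec)
    moreover have "pairv (rk (Suc 0)) a (- v) \<in> freemod (?R (Suc 0))" unfolding R0 using a by simp
    ultimately show "z \<in> ?E (Suc 0) ` freemod (?R (Suc 0))" by blast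
  qed
  have IH: "\<And>j c. N \<le> Suc j + length ys \<Longrightarrow> cocyc {0} ?R ?E (Suc j) c \<Longrightarrow> cobd {0} ?R ?E j c"
    using Cons.IH[OF A] cr unfolding R0(1) im by blast
  have main: "\<exists>p. cocyc {0} rk d i p \<and> (\<exists>q\<in>freemod (shrk rk i). \<forall>v\<in>freemod (rk i).
     dot (rk i) (c - fsmult y p) v - dot (shrk rk i) q (shd d (Suc i) v) \<in> {0})"
    if "N \<le> Suc i + length ys" "cocyc {0} rk d i c" for i c
    using cone_cobd[OF zero_ideal D A IH that(2)] that(1) by blast
  show ?case
  proof (intro conjI allI impI)
    fix j c assume N: "N \<le> Suc j + length (y # ys)" and c: "cocyc {0} rk d (Suc j) c"
    let ?W = "{c. cocyc {0} rk d (Suc j) c}" and ?U = "{c. cobd {0} rk d j c}"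
    have W: "is_module ?W fsmult" "?W \<subseteq> freemod (rk (Suc j))" by (rule cocyc_module[OF zero_ideal]) (auto simp: cocyc_def)
    have U: "is_module ?U fsmult" "?U \<subseteq> ?W" using cobd_module[OF zero_ideal] cobd_cocyc[OF zero_ideal D] by auto
    have "?W = ?U"
    proof (rule nakayama[OF free_noeth W U y])
      fix w assume w: "w \<in> ?W"
      then obtain p q where p: "cocyc {0} rk d (Suc j) p" "q \<in> freemod (rk j)"
        "\<forall>v\<in>freemod (rk (Suc j)). dot (rk (Suc j)) (w - fsmult y p) v - dot (rk j) q (d (Suc j) v) \<in> {0}"
        using main[of "Suc j" w] N by auto
      have "w - fsmult y p \<in> freemod (rk (Suc j))" using w p(1) by (auto simp: cocyc_def)
      then have "cobd {0} rk d j (w - fsmult y p)" unfolding acyc_cobd_iff[OF zero_ideal D] using p by blast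
      then show "\<exists>w'\<in>?W. w - fsmult y w' \<in> ?U" using p(1) by blast
    qed
    then show "cobd {0} rk d j c" using c by blast
  next
    fix c assume N: "N \<le> length (y # ys)" and c: "cocyc {0} rk d 0 c"
    let ?W = "{c. cocyc {0} rk d 0 c}" and ?U = "{0 :: nat \<Rightarrow> 'a}"
    have W: "is_module ?W fsmult" "?W \<subseteq> freemod (rk 0)" by (rule cocyc_module[OF zero_ideal]) (auto simp: cocyc_def)
    have U: "is_module ?U fsmult" "?U \<subseteq> ?W" using vecs_module[OF zero_ideal, of 0] is_moduleD(1)[OF W(1)] by auto
    have "?W = ?U"
    proof (rule nakayama[OF free_noeth W U y])
      fix w assume w: "w \<in> ?W"
      then obtain p q where p: "cocyc {0} rk d 0 p"
        "\<forall>v\<in>freemod (rk 0). dot (rk 0) (w - fsmult y p) v - dot 0 q (shd d (Suc 0) v) \<in> {0}"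
        using main[of 0 w] N by auto
      have "w - fsmult y p \<in> freemod (rk 0)" using w p(1) by (auto simp: cocyc_def)
      then have "w - fsmult y p \<in> vecs {0} (rk 0)"
        by (rule vecsI_dot[OF zero_ideal]) (use p(2) in \<open>auto simp: dot_def\<close>)
      then show "\<exists>w'\<in>?W. w - fsmult y w' \<in> ?U" using p(1) by auto
    qed
    then show "c = 0" using c by blast
  qed
qed

end

section \<open>Regular sequences\<close>

text \<open>Indexed by sets of positions, because suffixes and complements of single elements occur
  later besides prefixes.\<close>

definition idl :: "(nat \<Rightarrow> 'a::comm_ring_1) \<Rightarrow> nat set \<Rightarrow> 'a set" where
  "idl x A = {(\<Sum>i\<in>A. x i * a i) | a. True}"

lemma idl_empty [simp]: "idl x {} = {0}" by (auto simp: idl_def)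

lemma idl_insert:
  assumes "finite A" "i \<notin> A" shows "idl x (insert i A) = adjoin (idl x A) (x i)"
proof (intro equalityI subsetI)
  fix z assume "z \<in> idl x (insert i A)"
  then obtain a where "z = (\<Sum>k\<in>insert i A. x k * a k)" by (auto simp: idl_def)
  then have "z = (\<Sum>k\<in>A. x k * a k) + x i * a i" using assms by (simp add: add.commute)
  then show "z \<in> adjoin (idl x A) (x i)" unfolding adjoin_def idl_def by blast
next
  fix z assume "z \<in> adjoin (idl x A) (x i)"
  then obtain a b where z: "z = (\<Sum>k\<in>A. x k * a k) + x i * b" unfolding adjoin_def idl_def by blast
  have "(\<Sum>k\<in>insert i A. x k * (a(i := b)) k) = x i * b + (\<Sum>k\<in>A. x k * (a(i := b)) k)"
    using assms by simp
  also have "(\<Sum>k\<in>A. x k * (a(i := b)) k) = (\<Sum>k\<in>A. x k * a k)"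
    by (rule sum.cong) (use assms in auto)
  finally have "z = (\<Sum>k\<in>insert i A. x k * (a(i := b)) k)" using z by (simp add: add.commute)
  then show "z \<in> idl x (insert i A)" unfolding idl_def by blast
qed

lemma idl_ideal: "finite A \<Longrightarrow> is_ideal (idl x A)"
  by (induction A rule: finite_induct) (simp_all add: idl_insert adjoin_ideal)

lemma idl_cong: "(\<And>i. i \<in> A \<Longrightarrow> x i = y i) \<Longrightarrow> idl x A = idl y A"
  unfolding idl_def by (metis (no_types, lifting) sum.cong)

lemma idl_mono: assumes "finite B" "A \<subseteq> B" shows "idl x A \<subseteq> idl x B"
proof -
  have "finite C \<Longrightarrow> idl x A \<subseteq> idl x (A \<union> C)" for C
  proof (induction C rule: finite_induct)
    case (insert i C)
    have "finite (A \<union> C)" using assms insert finite_subset by blast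
    then have "idl x (A \<union> C) \<subseteq> idl x (insert i (A \<union> C))"
      by (cases "i \<in> A \<union> C") (simp_all add: insert_absorb idl_insert adjoin_sub)
    then show ?case using insert by simp
  qed simp
  from this[of B] assms show ?thesis by (simp add: Un_absorb1)
qed

lemma idl_mem: assumes "finite A" "i \<in> A" shows "x i * a \<in> idl x A"
proof -
  have "idl x {i} \<subseteq> idl x A" using idl_mono assms by blast
  moreover have "x i * a \<in> idl x {i}" by (auto simp: idl_def)
  ultimately show ?thesis by blast
qed

lemma idl_least: "is_ideal K \<Longrightarrow> (\<And>i. i \<in> A \<Longrightarrow> x i \<in> K) \<Longrightarrow> idl x A \<subseteq> K"
  by (auto simp: idl_def intro!: ideal_sum idealD)

lemma idl_lessThan_Suc: "idl x {..<Suc i} = adjoin (idl x {..<i}) (x i)"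
  by (simp add: lessThan_Suc idl_insert)

definition regseq :: "(nat \<Rightarrow> 'a::comm_ring_1) \<Rightarrow> nat \<Rightarrow> bool" where
  "regseq x t \<longleftrightarrow> (\<forall>i<t. nzd (idl x {..<i}) (x i))"

section \<open>Prime avoidance and associated primes\<close>

lemma prime_ideal_prod:
  assumes "prime_ideal P" "finite F" "\<And>q. q \<in> F \<Longrightarrow> f q \<notin> P" shows "(\<Prod>q\<in>F. f q) \<notin> P"
  using assms(2,3) by (induction F rule: finite_induct) (use assms(1) in \<open>auto simp: prime_ideal_def\<close>)

text \<open>The element found for \<open>F\<close> is corrected by \<open>b * c\<close>, with
  \<open>c\<close> a product of elements of the primes in \<open>F\<close>; incomparability allows
  each factor, hence the product, to stay outside the new prime \<open>p\<close>.\<close>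

lemma prime_avoidance:
  assumes "finite F" "is_ideal I" "\<And>p. p \<in> F \<Longrightarrow> prime_ideal p" "\<And>p. p \<in> F \<Longrightarrow> \<not> I \<subseteq> p"
    "\<And>p q. p \<in> F \<Longrightarrow> q \<in> F \<Longrightarrow> p \<subseteq> q \<Longrightarrow> p = q"
  shows "\<exists>a\<in>I. \<forall>p\<in>F. a \<notin> p"
  using assms(1,3,4,5)
proof (induction F rule: finite_induct)
  case empty
  show ?case using idealD(1)[OF assms(2)] by blast
next
  case (insert p F)
  have "\<exists>a\<in>I. \<forall>q\<in>F. a \<notin> q" by (rule insert.IH) (use insert.prems in \<open>simp_all\<close>)
  then obtain a where a: "a \<in> I" "\<forall>q\<in>F. a \<notin> q" by blast
  have p: "prime_ideal p" using insert.prems(1) by simp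
  show ?case
  proof (cases "a \<in> p")
    case False then show ?thesis using a by blast
  next
    case True
    have "\<not> I \<subseteq> p" using insert.prems(2) by simp
    then obtain b where b: "b \<in> I" "b \<notin> p" by blast
    have "\<not> q \<subseteq> p" if "q \<in> F" for q using insert.prems(3)[of q p] insert.hyps(2) that by auto
    then have "\<forall>q\<in>F. \<exists>c. c \<in> q \<and> c \<notin> p" by blast
    then obtain f where f: "\<And>q. q \<in> F \<Longrightarrow> f q \<in> q \<and> f q \<notin> p" by metis
    define c where "c = (\<Prod>q\<in>F. f q)"
    have cp: "c \<notin> p" unfolding c_def by (rule prime_ideal_prod[OF p insert.hyps(1)]) (use f in blast)
    have cq: "c \<in> q" if "q \<in> F" for q
    proof -
      have "c = f q * (\<Prod>q\<in>F - {q}. f q)" unfolding c_def using that insert.hyps(1) by (simp add: prod.remove)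
      moreover have "is_ideal q" using insert.prems that by (auto simp: prime_ideal_def)
      ultimately show ?thesis using f[OF that] idealD(4) by metis
    qed
    have "b * c \<notin> p" using b cp p by (auto simp: prime_ideal_def)
    have pid: "is_ideal q" if "q \<in> insert p F" for q using insert.prems(1)[OF that] by (simp add: prime_ideal_def)
    have "a + b * c \<notin> p"
    proof
      assume "a + b * c \<in> p"
      from idealD(6)[OF pid[of p] this True] show False using \<open>b * c \<notin> p\<close> by simp
    qed
    moreover have "a + b * c \<notin> q" if q: "q \<in> F" for q
    proof
      assume "a + b * c \<in> q"
      moreover have "b * c \<in> q" using cq[OF q] idealD(3)[OF pid[of q]] q by blast
      ultimately have "a + b * c - b * c \<in> q" using idealD(6)[OF pid[of q]] q by blast
      then show False using a(2) q by simp
    qed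
    moreover have "a + b * c \<in> I" using a b idealD(2,4)[OF assms(2)] by blast
    ultimately show ?thesis by blast
  qed
qed

lemma ideals_maximal:
  assumes R: "noethmod (UNIV :: 'a::comm_ring_1 set) (*)" and "P I" "\<And>I. P I \<Longrightarrow> is_ideal (I :: 'a set)"
  obtains M where "P M" "\<forall>N. P N \<longrightarrow> M \<subseteq> N \<longrightarrow> N = M"
proof -
  have "\<exists>M\<in>Collect P. \<forall>N\<in>Collect P. M \<subseteq> N \<longrightarrow> N = M"
    by (rule noethmod_maximal[OF R]) (use assms(2,3) in \<open>auto simp: ideal_iff_module\<close>)
  then show ?thesis using that by auto
qed

lemma colon_ideal: assumes "is_ideal J" shows "is_ideal {a. a * u \<in> J}"
  using idealD(1-3)[OF assms] by (auto simp: is_ideal_def distrib_right mult.assoc)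

text \<open>The maximal annihilators of nonzero elements modulo \<open>J\<close> are finitely many primes, and
  their union is the set of zero divisors modulo \<open>J\<close>.\<close>
lemma zero_divisors_annihilator:
  fixes J I :: "'a::comm_ring_1 set"
  assumes R: "noethmod (UNIV :: 'a set) (*)" and J: "is_ideal J" and I: "is_ideal I"
    and zd: "\<And>a. a \<in> I \<Longrightarrow> \<not> nzd J a"
  obtains u where "u \<notin> J" "prime_ideal {a. a * u \<in> J}" "I \<subseteq> {a. a * u \<in> J}"
proof -
  \<comment> \<open>\<open>C\<close> consists of the annihilators modulo \<open>J\<close> of
    elements outside \<open>J\<close>, and \<open>mx\<close> of the maximal ones among them, which
    turn out to be prime.\<close>
  define C where "C = {{a. a * u \<in> J} | u. u \<notin> J}"
  define mx where "mx = {p \<in> C. \<forall>q\<in>C. p \<subseteq> q \<longrightarrow> q = p}"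
  have Cid: "is_ideal p" if "p \<in> C" for p using that colon_ideal[OF J] by (auto simp: C_def)
  have above: "\<exists>p\<in>mx. q \<subseteq> p" if qC: "q \<in> C" for q
  proof -
    obtain M where M: "M \<in> C \<and> q \<subseteq> M" "\<forall>N. N \<in> C \<and> q \<subseteq> N \<longrightarrow> M \<subseteq> N \<longrightarrow> N = M"
      by (rule ideals_maximal[OF R, of "\<lambda>p. p \<in> C \<and> q \<subseteq> p" q]) (use qC Cid in auto)
    then have "M \<in> mx" unfolding mx_def by auto
    then show ?thesis using M by blast
  qed
  have "\<forall>p\<in>mx. \<exists>u. u \<notin> J \<and> p = {a. a * u \<in> J}" by (auto simp: mx_def C_def)
  then obtain u where u: "\<And>p. p \<in> mx \<Longrightarrow> u p \<notin> J \<and> p = {a. a * u p \<in> J}" by metis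
  have mxC: "p \<in> C" if "p \<in> mx" for p using that by (simp add: mx_def)
  have prime: "prime_ideal p" if p: "p \<in> mx" for p
    unfolding prime_ideal_def
  proof (intro conjI allI impI)
    show "is_ideal p" using Cid mxC p by blast
    have pu: "a \<in> p \<longleftrightarrow> a * u p \<in> J" for a using u[OF p] by blast
    show "1 \<notin> p" using u[OF p] pu[of 1] by simp
    fix a b assume ab: "a * b \<in> p"
    show "a \<in> p \<or> b \<in> p"
    proof (rule disjCI)
      assume b: "b \<notin> p"
      then have n: "b * u p \<notin> J" using pu by simp
      have "{a. a * (b * u p) \<in> J} \<in> C" using n unfolding C_def by blast
      moreover have "p \<subseteq> {a. a * (b * u p) \<in> J}"
      proof
        fix c assume "c \<in> p"
        then have "b * (c * u p) \<in> J" using pu idealD(3)[OF J] by blast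
        then show "c \<in> {a. a * (b * u p) \<in> J}" by (simp add: mult.left_commute)
      qed
      ultimately have "{a. a * (b * u p) \<in> J} = p" using p unfolding mx_def by blast
      moreover have "a * (b * u p) \<in> J" using ab pu by (simp add: mult.assoc)
      ultimately show "a \<in> p" by blast
    qed
  qed
  \<comment> \<open>Finiteness of \<open>mx\<close>: take one element \<open>u p\<close> for each
    prime and the ideals spanned by \<open>J\<close> and finitely many of these. If
    \<open>G F\<close> is a largest one, every \<open>u p\<close> lies in \<open>G F\<close>; hence
    \<open>p\<close> contains the intersection of \<open>F\<close>, so it contains a member of
    \<open>F\<close>, and by maximality equals it.\<close>
  define G where "G F = {j + (\<Sum>p\<in>F. u p * c p) | j c. j \<in> J}" for F
  have GI: "y \<in> G F" if "j \<in> J" "y = j + (\<Sum>p\<in>F. u p * c p)" for y j F c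
    using that unfolding G_def by blast
  have Gid: "is_ideal (G F)" for F
    unfolding is_ideal_def
  proof (intro conjI ballI allI)
    show "0 \<in> G F" by (rule GI[where c = "\<lambda>_. 0", OF idealD(1)[OF J]]) simp
  next
    fix y z assume "y \<in> G F" "z \<in> G F"
    then obtain j c j' c' where "y = j + (\<Sum>p\<in>F. u p * c p)" "z = j' + (\<Sum>p\<in>F. u p * c' p)" "j \<in> J" "j' \<in> J"
      unfolding G_def by blast
    then show "y + z \<in> G F"
      by (intro GI[where j = "j + j'" and c = "\<lambda>p. c p + c' p"])
        (auto simp: algebra_simps sum.distrib idealD(2)[OF J])
  next
    fix b y assume "y \<in> G F"
    then obtain j c where "y = j + (\<Sum>p\<in>F. u p * c p)" "j \<in> J" unfolding G_def by blast
    then show "b * y \<in> G F" using idealD(3)[OF J, of j b]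
      by (intro GI[where j = "b * j" and c = "\<lambda>p. b * c p"]) (auto simp: algebra_simps sum_distrib_left)
  qed
  obtain M where M: "\<exists>F. finite F \<and> F \<subseteq> mx \<and> M = G F"
    "\<forall>N. (\<exists>F. finite F \<and> F \<subseteq> mx \<and> N = G F) \<longrightarrow> M \<subseteq> N \<longrightarrow> N = M"
    by (rule ideals_maximal[OF R, of "\<lambda>N. \<exists>F. finite F \<and> F \<subseteq> mx \<and> N = G F" "G {}"]) (use Gid in auto)
  obtain F where F: "finite F" "F \<subseteq> mx" "M = G F" using M(1) by blast
  have Fmax: "G F' = G F" if "finite F'" "F' \<subseteq> mx" "G F \<subseteq> G F'" for F'
    using M(2) F(3) that by blast
  have "mx \<subseteq> F"
  proof
    fix p assume p: "p \<in> mx"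
    have upd: "(\<Sum>q\<in>F. u q * (c(p := b)) q) = (\<Sum>q\<in>F. u q * c q)" if "p \<notin> F" for c b
      by (rule sum.cong) (use that in auto)
    show "p \<in> F"
    proof (rule ccontr)
      assume pF: "p \<notin> F"
      have "G F \<subseteq> G (insert p F)"
      proof
        fix y assume "y \<in> G F"
        then obtain j c where jc: "y = j + (\<Sum>p\<in>F. u p * c p)" "j \<in> J" unfolding G_def by blast
        then have "y = j + (\<Sum>q\<in>insert p F. u q * (c(p := 0)) q)" using F(1) pF upd[OF pF] by simp
        then show "y \<in> G (insert p F)" by (rule GI[OF jc(2)])
      qed
      then have eq: "G (insert p F) = G F" using Fmax[of "insert p F"] F p by blast
      have "u p = 0 + (\<Sum>q\<in>insert p F. u q * ((\<lambda>_. 0)(p := 1)) q)" using F(1) pF upd[OF pF] by simp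
      then have "u p \<in> G (insert p F)" by (rule GI[OF idealD(1)[OF J]])
      then have "u p \<in> G F" using eq by simp
      then obtain j c where jc: "u p = j + (\<Sum>q\<in>F. u q * c q)" "j \<in> J" unfolding G_def by blast
      have inter: "a \<in> p" if a: "\<And>q. q \<in> F \<Longrightarrow> a \<in> q" for a
      proof -
        have "a * u p = a * j + (\<Sum>q\<in>F. (a * u q) * c q)"
          unfolding jc(1) by (simp add: algebra_simps sum_distrib_left)
        moreover have "(\<Sum>q\<in>F. (a * u q) * c q) \<in> J"
        proof (rule ideal_sum[OF J])
          fix q assume q: "q \<in> F"
          then have "a * u q \<in> J" using a[OF q] u F(2) by blast
          then show "(a * u q) * c q \<in> J" by (rule idealD(4)[OF J])
        qed
        ultimately have "a * u p \<in> J" using idealD(2)[OF J idealD(3)[OF J jc(2)]] by metis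
        then show ?thesis using u[OF p] by blast
      qed
      have "\<exists>q\<in>F. q \<subseteq> p"
      proof (rule ccontr)
        assume "\<not> (\<exists>q\<in>F. q \<subseteq> p)"
        then have "\<forall>q\<in>F. \<exists>c. c \<in> q \<and> c \<notin> p" by blast
        then obtain f where f: "\<And>q. q \<in> F \<Longrightarrow> f q \<in> q \<and> f q \<notin> p" by metis
        have "(\<Prod>q\<in>F. f q) \<in> q" if q: "q \<in> F" for q
        proof -
          have "(\<Prod>q\<in>F. f q) = f q * (\<Prod>q\<in>F - {q}. f q)" using q F(1) by (simp add: prod.remove)
          moreover have "is_ideal q" using Cid mxC q F(2) by blast
          ultimately show ?thesis using f[OF q] idealD(4) by metis
        qed
        then have "(\<Prod>q\<in>F. f q) \<in> p" by (rule inter)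
        then show False using prime_ideal_prod[OF prime[OF p] F(1)] f by blast
      qed
      then obtain q where q: "q \<in> F" "q \<subseteq> p" by blast
      then have "p = q" using F(2) mxC[OF p] unfolding mx_def by blast
      then show False using q(1) pF by blast
    qed
  qed
  then have mxF: "mx = F" using F by blast
  have "\<exists>p\<in>mx. I \<subseteq> p"
  proof (rule ccontr)
    assume no: "\<not> (\<exists>p\<in>mx. I \<subseteq> p)"
    \<comment> \<open>An element of \<open>I\<close> avoiding all of \<open>mx\<close> contradicts
      \<open>zd\<close>: being a zero divisor, it lies in some member of \<open>C\<close>, and that
      is contained in a member of \<open>mx\<close>.\<close>
    have "\<exists>a\<in>I. \<forall>p\<in>mx. a \<notin> p"
      by (rule prime_avoidance) (use mxF F I prime no in \<open>auto simp: mx_def\<close>)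
    then obtain a where a: "a \<in> I" "\<And>p. p \<in> mx \<Longrightarrow> a \<notin> p" by blast
    obtain c where c: "a * c \<in> J" "c \<notin> J" using zd[OF a(1)] by (auto simp: nzd_def)
    then have "{a. a * c \<in> J} \<in> C" unfolding C_def by blast
    from above[OF this] a(2) c(1) show False by blast
  qed
  then obtain p where p: "p \<in> mx" "I \<subseteq> p" by blast
  then show ?thesis using that[of "u p"] u[OF p(1)] prime[OF p(1)] by metis
qed

section \<open>Prime chains from regular sequences, permutability, and sequences of maximal
  length\<close>

context local_noeth
begin

lemma m_prime: "prime_ideal \<mm>"
  unfolding prime_ideal_def
proof (intro conjI allI impI)
  fix a b assume ab: "a * b \<in> \<mm>"
  show "a \<in> \<mm> \<or> b \<in> \<mm>"
  proof (rule disjCI)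
    assume "b \<notin> \<mm>"
    then obtain c where "b * c = 1" using units by blast
    then have "a = (a * b) * c" by (simp add: mult.assoc)
    then show "a \<in> \<mm>" using idealD(4)[OF mideal ab] by metis
  qed
qed (use mideal one_notin in auto)

text \<open>The multiplicative set \<open>T\<close> generated by \<open>a\<close> and the complement
  of \<open>Q\<close> misses \<open>K\<close>, because powers of \<open>a\<close> can be cancelled
  modulo \<open>K\<close>. An ideal over \<open>K\<close> maximal among those missing
  \<open>T\<close> is prime, lies in \<open>Q\<close> and omits \<open>a\<close>.\<close>

lemma smaller_prime:
  fixes K :: "'a set"
  assumes K: "is_ideal K" and Q: "prime_ideal Q" and a: "a \<in> Q" "nzd K a" and KQ: "K \<subseteq> Q"
  shows "\<exists>P. prime_ideal P \<and> K \<subseteq> P \<and> P \<subset> Q"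
proof -
  define T where "T = {a ^ k * b | k b. b \<notin> Q}"
  have Tmult: "y * z \<in> T" if yz: "y \<in> T" "z \<in> T" for y z
  proof -
    obtain k b k' b' where "y = a ^ k * b" "z = a ^ k' * b'" "b \<notin> Q" "b' \<notin> Q" using yz unfolding T_def by blast
    then have "y * z = a ^ (k + k') * (b * b')" "b * b' \<notin> Q"
      using Q by (auto simp: power_add algebra_simps prime_ideal_def)
    then show ?thesis unfolding T_def by blast
  qed
  have inT: "b \<in> T" if "b \<notin> Q" for b
  proof -
    have "b = a ^ 0 * b" by simp
    then show ?thesis using that unfolding T_def by blast
  qed
  have pow: "a ^ k * b \<in> K \<Longrightarrow> b \<in> K" for k b
    by (induction k) (use a(2) in \<open>auto simp: nzd_def mult.assoc\<close>)
  have KT: "K \<inter> T = {}" using pow KQ unfolding T_def by blast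
  obtain P where P': "is_ideal P \<and> K \<subseteq> P \<and> P \<inter> T = {}"
    and mx': "\<forall>N. is_ideal N \<and> K \<subseteq> N \<and> N \<inter> T = {} \<longrightarrow> P \<subseteq> N \<longrightarrow> N = P"
    by (rule ideals_maximal[OF noeth, of "\<lambda>P. is_ideal P \<and> K \<subseteq> P \<and> P \<inter> T = {}" K]) (use K KT in auto)
  have P: "is_ideal P" "K \<subseteq> P" "P \<inter> T = {}" using P' by auto
  have mx: "N = P" if "is_ideal N" "K \<subseteq> N" "N \<inter> T = {}" "P \<subseteq> N" for N using mx' that by blast
  have "1 \<notin> Q" using Q by (simp add: prime_ideal_def)
  have big: "\<exists>p c. p \<in> P \<and> p + b * c \<in> T" if "b \<notin> P" for b
  proof (rule ccontr)
    assume no: "\<not> (\<exists>p c. p \<in> P \<and> p + b * c \<in> T)"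
    then have "adjoin P b \<inter> T = {}" unfolding adjoin_def by blast
    then have "adjoin P b = P" using mx[OF adjoin_ideal[OF P(1)]] adjoin_sub[of P b] P(2) by blast
    then show False using adjoin_mem[OF P(1), of b 1] that by simp
  qed
  have "prime_ideal P"
    unfolding prime_ideal_def
  proof (intro conjI allI impI)
    show "1 \<notin> P" using inT[OF \<open>1 \<notin> Q\<close>] P(3) by blast
    fix y z assume yz: "y * z \<in> P"
    show "y \<in> P \<or> z \<in> P"
    proof (rule ccontr)
      assume "\<not> (y \<in> P \<or> z \<in> P)"
      then obtain p c p' c' where pc: "p \<in> P" "p + y * c \<in> T" "p' \<in> P" "p' + z * c' \<in> T" using big by meson
      have "(p + y * c) * (p' + z * c') = p * (p' + z * c') + (y * c) * p' + (y * z) * (c * c')"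
        by (simp add: algebra_simps)
      also have "\<dots> \<in> P"
        by (intro idealD(2)[OF P(1)] idealD(4)[OF P(1) pc(1)] idealD(3)[OF P(1) pc(3)] idealD(4)[OF P(1) yz])
      finally show False using Tmult[OF pc(2,4)] P(3) by blast
    qed
  qed (rule P(1))
  moreover have "P \<subseteq> Q" using inT P(3) by blast
  moreover have "a \<in> T"
  proof -
    have "a = a ^ 1 * 1" by simp
    then show ?thesis unfolding T_def using \<open>1 \<notin> Q\<close> by blast
  qed
  then have "a \<notin> P" using P(3) by blast
  ultimately show ?thesis using P(2) a(1) by blast
qed

text \<open>Descent from the maximal ideal: a prime over the elements up to \<open>x i\<close>
  contains \<open>x i\<close>, which is regular modulo the earlier ones, so there is a strictly
  smaller prime over those. This bounds the length of regular sequences by the dimension.\<close>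

lemma regseq_prime_chain:
  assumes x: "regseq x t" "\<And>i. i < t \<Longrightarrow> x i \<in> \<mm>"
  shows "\<exists>P :: nat \<Rightarrow> 'a set. prime_chain t P"
proof -
  have "k \<le> t \<Longrightarrow> \<exists>P :: nat \<Rightarrow> 'a set. prime_chain k P \<and> idl x {..<t - k} \<subseteq> P 0" for k
  proof (induction k)
    case 0
    have "idl x {..<t} \<subseteq> \<mm>" by (rule idl_least[OF mideal]) (use x in auto)
    then show ?case using m_prime by (intro exI[of _ "\<lambda>_. \<mm>"]) (auto simp: prime_chain_def)
  next
    case (Suc k)
    then obtain P :: "nat \<Rightarrow> 'a set" where P: "prime_chain k P" "idl x {..<t - k} \<subseteq> P 0" by auto
    define i where "i = t - Suc k"
    have i: "t - k = Suc i" "i < t" using Suc by (auto simp: i_def)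
    have "x i * 1 \<in> idl x {..<Suc i}" by (rule idl_mem) auto
    then have xi: "x i \<in> P 0" using P(2) i by auto
    have sub: "idl x {..<i} \<subseteq> P 0" using P(2) idl_mono[of "{..<Suc i}" "{..<i}" x] i by auto
    have "prime_ideal (P 0)" using P(1) by (simp add: prime_chain_def)
    moreover have "nzd (idl x {..<i}) (x i)" using x(1) i by (simp add: regseq_def)
    ultimately obtain Q where Q: "prime_ideal Q" "idl x {..<i} \<subseteq> Q" "Q \<subset> P 0"
      using smaller_prime[OF idl_ideal _ xi _ sub] by auto
    have "prime_chain (Suc k) (case_nat Q P)"
      unfolding prime_chain_def
    proof (intro conjI allI impI)
      fix n assume "n \<le> Suc k" then show "prime_ideal (case_nat Q P n)"
        using Q P(1) by (cases n) (auto simp: prime_chain_def)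
    next
      fix n assume "n < Suc k" then show "case_nat Q P n \<subset> case_nat Q P (Suc n)"
        using Q P(1) by (cases n) (auto simp: prime_chain_def)
    qed
    then show ?case using Q(2) i_def by (intro exI[of _ "case_nat Q P"]) auto
  qed
  from this[of t] show ?thesis by auto
qed

text \<open>The annihilator W of \<open>b\<close> modulo \<open>J\<close> satisfies W = J + a W: if
  b c lies in \<open>J\<close>, then c = a e modulo \<open>J\<close> with e again in W. Nakayama's
  lemma gives W = J.\<close>

lemma nzd_swap1:
  assumes J: "is_ideal J" and a: "nzd J a" "a \<in> \<mm>" and b: "nzd (adjoin J a) b"
  shows "nzd J b"
proof -
  let ?W = "{c. c * b \<in> J}"
  have W: "is_module ?W (*)" using colon_ideal[OF J] by (simp add: ideal_iff_module)
  have U: "is_module J (*)" "J \<subseteq> ?W" using J idealD(4)[OF J] by (auto simp: ideal_iff_module)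
  have "?W = J"
  proof (rule nakayama[OF noeth W subset_UNIV U a(2)])
    fix c assume "c \<in> ?W"
    then have c: "b * c \<in> J" by (simp add: mult.commute)
    then have "b * c \<in> adjoin J a" using adjoin_sub by blast
    then have "c \<in> adjoin J a" using b by (simp add: nzd_def)
    then obtain j e where je: "c = j + a * e" "j \<in> J" unfolding adjoin_def by blast
    have "a * (b * e) = b * c - b * j" unfolding je(1) by (simp add: algebra_simps)
    also have "\<dots> \<in> J" using idealD(6)[OF J c idealD(3)[OF J je(2)]] .
    finally have "b * e \<in> J" using a(1) by (simp add: nzd_def)
    then have "e \<in> ?W" by (simp add: mult.commute)
    moreover have "c - a * e \<in> J" using je by simp
    ultimately show "\<exists>w'\<in>?W. c - a * w' \<in> J" by blast
  qed
  then show ?thesis unfolding nzd_def by (auto simp: mult.commute)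
qed

end

lemma nzd_swap2:
  assumes J: "is_ideal J" and a: "nzd J a" and b: "nzd (adjoin J a) b"
  shows "nzd (adjoin J b) a"
  unfolding nzd_def
proof (intro allI impI)
  fix c assume "a * c \<in> adjoin J b"
  then obtain j e where je: "a * c = j + b * e" "j \<in> J" unfolding adjoin_def by blast
  have "b * e = - j + a * c" using je by simp
  then have "b * e \<in> adjoin J a" using idealD(5)[OF J je(2)] unfolding adjoin_def by blast
  then have "e \<in> adjoin J a" using b by (simp add: nzd_def)
  then obtain j' f where f: "e = j' + a * f" "j' \<in> J" unfolding adjoin_def by blast
  have "a * (c - b * f) = j + b * j'" using je f by (simp add: algebra_simps)
  moreover have "j + b * j' \<in> J" using idealD(2)[OF J je(2) idealD(3)[OF J f(2)]] .
  ultimately have "c - b * f \<in> J" using a by (simp add: nzd_def)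
  then have "c = (c - b * f) + b * f \<and> c - b * f \<in> J" by simp
  then show "c \<in> adjoin J b" unfolding adjoin_def by blast
qed

context local_noeth
begin

text \<open>Induction on the length. If the last element is outside \<open>A\<close>, only the case
  where it is \<open>x i\<close> is new, and it follows by removing elements from the full prefix
  one at a time with \<open>nzd_swap1\<close>. If it is in \<open>A\<close>,
  \<open>nzd_swap2\<close> exchanges it with \<open>x i\<close>.\<close>

lemma regseq_permutable:
  assumes "regseq x t" "\<And>i. i < t \<Longrightarrow> x i \<in> \<mm>" "A \<subseteq> {..<t}" "i < t" "i \<notin> A"
  shows "nzd (idl x A) (x i)"
  using assms
proof (induction t arbitrary: A i)
  case 0 then show ?case by simp
next
  case (Suc t)
  have IH: "nzd (idl x A) (x i)" if "A \<subseteq> {..<t}" "i < t" "i \<notin> A" for A i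
    using Suc.IH[of A i] Suc.prems(1,2) that by (auto simp: regseq_def)
  have last: "nzd (idl x A) (x t)" if "A \<subseteq> {..<t}" for A
    using that
  proof (induction "card ({..<t} - A)" arbitrary: A)
    case 0
    then have "A = {..<t}" by auto
    then show ?case using Suc.prems(1) by (simp add: regseq_def)
  next
    case (Suc n)
    then obtain a where a: "a \<in> {..<t} - A" by (metis card.empty nat.distinct(1) ex_in_conv)
    have fin: "finite A" using Suc.prems finite_subset by blast
    have "{..<t} - insert a A = ({..<t} - A) - {a}" by blast
    then have "n = card ({..<t} - insert a A)" using Suc.hyps(2) a by simp
    then have "nzd (idl x (insert a A)) (x t)" using Suc.hyps(1) a Suc.prems by auto
    moreover have "idl x (insert a A) = adjoin (idl x A) (x a)" using idl_insert[OF fin] a by blast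
    moreover have "nzd (idl x A) (x a)" using IH a Suc.prems by auto
    moreover have "x a \<in> \<mm>" using a \<open>\<And>i. i < Suc t \<Longrightarrow> x i \<in> \<mm>\<close> by auto
    ultimately show ?case using nzd_swap1[OF idl_ideal[OF fin]] by metis
  qed
  show ?case
  proof (cases "t \<in> A")
    case False
    then have A: "A \<subseteq> {..<t}" using Suc.prems(3) by (auto simp: lessThan_Suc)
    show ?thesis
    proof (cases "i = t")
      case True then show ?thesis using last[OF A] by simp
    next
      case False then show ?thesis using IH[OF A] Suc.prems by simp
    qed
  next
    case True
    define B where "B = A - {t}"
    have B: "B \<subseteq> {..<t}" "A = insert t B" "t \<notin> B" "finite B"
      using True Suc.prems(3) finite_subset[OF Suc.prems(3)] by (auto simp: B_def lessThan_Suc)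
    have it: "i < t" "i \<notin> B" using True Suc.prems B by (auto simp: less_Suc_eq)
    have "nzd (idl x B) (x i)" by (rule IH[OF B(1) it])
    moreover have "nzd (adjoin (idl x B) (x i)) (x t)"
      using last[of "insert i B"] idl_insert[OF B(4) it(2), of x] it B(1) by auto
    ultimately have "nzd (adjoin (idl x B) (x t)) (x i)" by (rule nzd_swap2[OF idl_ideal[OF B(4)]])
    then show ?thesis using idl_insert[OF B(4,3), of x] B(2) by simp
  qed
qed

text \<open>When the sequence cannot be prolonged inside \<open>I\<close>, all of \<open>I\<close>
  consists of zero divisors modulo it, so some \<open>u\<close> has a prime annihilator containing
  \<open>I\<close>; this must be the maximal ideal, and \<open>u\<close> is a socle element. The
  bound on injective dimension passes to the quotient, drops there to \<open>van _ 1\<close> by the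
  socle, and grows by one per element on the way back, which gives \<open>Suc t\<close>.\<close>

lemma maximal_regular_sequence:
  assumes I: "is_ideal I" "I \<subseteq> \<mm>" and P: "\<And>p. prime_ideal p \<Longrightarrow> I \<subseteq> p \<Longrightarrow> p = \<mm>"
    and bd: "\<not> (\<exists>P :: nat \<Rightarrow> 'a set. prime_chain (Suc d) P)" and V: "van ({0} :: 'a set) N"
  obtains x t u where "t \<le> d" "regseq x t" "\<forall>i<t. x i \<in> I" "u \<notin> idl x {..<t}"
    "\<forall>a\<in>\<mm>. u * a \<in> idl x {..<t}" "van (idl x {..<t}) 1" "van ({0} :: 'a set) (Suc t)"
proof -
  define S where "S t \<longleftrightarrow> (\<exists>x. regseq x t \<and> (\<forall>i<t. x i \<in> I))" for t
  have "\<not> S (Suc d)" using regseq_prime_chain bd I(2) unfolding S_def by (meson subsetD)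
  moreover have "S 0" by (simp add: S_def regseq_def)
  ultimately obtain t where t: "t \<le> d" "S t" "\<not> S (Suc t)"
  proof -
    have "\<exists>t\<le>d. S t \<and> \<not> S (Suc t)"
    proof (rule ccontr)
      assume no: "\<not> (\<exists>t\<le>d. S t \<and> \<not> S (Suc t))"
      have "k \<le> Suc d \<Longrightarrow> S k" for k by (induction k) (use no \<open>S 0\<close> in auto)
      then show False using \<open>\<not> S (Suc d)\<close> by blast
    qed
    then show ?thesis using that by blast
  qed
  obtain x where x: "regseq x t" "\<forall>i<t. x i \<in> I" using t(2) S_def by blast
  let ?J = "idl x {..<t}"
  have J: "is_ideal ?J" by (rule idl_ideal) simp
  have zd: "\<not> nzd ?J a" if a: "a \<in> I" for a
  proof
    assume nz: "nzd ?J a"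
    have e: "idl (x(t := a)) {..<i} = idl x {..<i}" if "i \<le> t" for i
      by (rule idl_cong) (use that in auto)
    have "regseq (x(t := a)) (Suc t)"
      unfolding regseq_def
    proof (intro allI impI)
      fix i assume "i < Suc t"
      then show "nzd (idl (x(t := a)) {..<i}) ((x(t := a)) i)"
        using nz x(1) e[of i] by (cases "i = t") (auto simp: regseq_def)
    qed
    moreover have "\<forall>i<Suc t. (x(t := a)) i \<in> I" using a x(2) by (auto simp: less_Suc_eq)
    ultimately show False using t(3) S_def by blast
  qed
  obtain u where u: "u \<notin> ?J" "prime_ideal {a. a * u \<in> ?J}" "I \<subseteq> {a. a * u \<in> ?J}"
    by (rule zero_divisors_annihilator[OF noeth J I(1) zd])
  have "{a. a * u \<in> ?J} = \<mm>" by (rule P[OF u(2,3)])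
  then have um: "u * a \<in> ?J" if "a \<in> \<mm>" for a using that by (auto simp: mult.commute)
  have "i \<le> t \<Longrightarrow> van (idl x {..<i}) N" for i
  proof (induction i)
    case 0 then show ?case using V by simp
  next
    case (Suc i)
    then have "nzd (idl x {..<i}) (x i)" using x(1) by (simp add: regseq_def)
    then have "van (adjoin (idl x {..<i}) (x i)) N" using van_quotient[OF idl_ideal] Suc by auto
    then show ?case by (simp only: idl_lessThan_Suc)
  qed
  then have "van ?J N" by simp
  then have v1: "van ?J 1" using van_socle[OF J u(1) um] by blast
  have "k \<le> t \<Longrightarrow> van (idl x {..<t - k}) (Suc k)" for k
  proof (induction k)
    case 0 then show ?case using v1 by simp
  next
    case (Suc k)
    define i where "i = t - Suc k"
    have i: "t - k = Suc i" "i < t" using Suc by (auto simp: i_def)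
    have "nzd (idl x {..<i}) (x i)" "x i \<in> \<mm>" using x i I(2) by (auto simp: regseq_def)
    moreover have "van (adjoin (idl x {..<i}) (x i)) (Suc k)" using Suc i by (simp flip: idl_lessThan_Suc)
    ultimately have "van (idl x {..<i}) (Suc (Suc k))" using van_lift[OF idl_ideal, of "{..<i}" x "x i" "Suc k"] by simp
    then show ?case by (simp add: i_def)
  qed
  from this[of t] have "van ({0} :: 'a set) (Suc t)" by simp
  then show ?thesis using that t(1) x u(1) um v1 by blast
qed

end

section \<open>Modules with vanishing Ext into the ring are syzygies\<close>

context local_noeth
begin

text \<open>Vanishing in positive degrees makes the dual of the resolution exact except at its
  start, where the kernel consists of the functionals on the cokernel; resolving that kernel
  continues the turned complex.\<close>

lemma dual_resolution:
  assumes D: "acyc {0} rk d"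
    and van0: "\<And>j c. cocyc ({0} :: 'a set) rk d (Suc j) c \<Longrightarrow> cobd {0} rk d j c" and p: "p \<ge> 1"
  obtains r e where "acyc ({0} :: 'a set) r e" "\<forall>i\<le>p. r i = rk (p - i)"
    "\<forall>i<p. e (Suc i) = transp (rk (p - i)) (rk (p - Suc i)) (d (p - i))"
    "\<forall>v\<in>freemod (r (Suc p)). cocyc {0} rk d 0 (e (Suc p) v)"
proof -
  let ?W = "{c. cocyc ({0} :: 'a set) rk d 0 c}"
  have W: "is_module ?W fsmult" "?W \<subseteq> freemod (rk 0)" by (rule cocyc_module[OF zero_ideal]) (auto simp: cocyc_def)
  obtain q g where g: "is_hom (freemod q) fsmult ?W fsmult g" "g ` freemod q = ?W"
    by (rule noethmod_cover[OF free_noeth W(2,1)])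
  have gl: "lin q (rk 0) g" using g(1) W(2) unfolding is_hom_def by blast
  have g1: "cocyc {0} rk d 0 (g v)" if "v \<in> freemod q" for v using is_homD(1)[OF g(1) that] by simp
  have g2: "\<exists>v\<in>freemod q. c - g v \<in> vecs {0} (rk 0)" if "cocyc {0} rk d 0 c" for c
  proof -
    have "c \<in> g ` freemod q" unfolding g(2) using that by simp
    then show ?thesis by auto
  qed
  obtain r e where C: "acyc {0} r e" "\<forall>i\<le>p. r i = rk (0 + p - i)" "r (Suc p) = q"
    "\<forall>i<p. e (Suc i) = transp (rk (0 + p - i)) (rk (0 + p - Suc i)) (d (0 + p - i))" "e (Suc p) = g"
    by (rule dual_complex[where l = 0, OF noeth zero_ideal D p van0 gl g1 g2])
  show ?thesis by (rule that[OF C(1)]) (use C g1 in auto)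
qed

text \<open>Dualising twice. The turned dual complex has no cohomology into R from degree
  \<open>N\<close> on, so its own dual is exact at the positions from \<open>p \<ge> N\<close> on.
  Position \<open>p\<close> carries \<open>rk 0\<close>, and the map arriving there is the original
  \<open>d 1\<close>; the \<open>K\<close> modules beyond it, read backwards, extend the resolution
  to the right.\<close>

lemma high_syzygy:
  assumes V: "van ({0} :: 'a set) N" and D: "acyc {0} rk d"
    and van0: "\<And>j c. cocyc ({0} :: 'a set) rk d (Suc j) c \<Longrightarrow> cobd {0} rk d j c" and K: "K \<ge> 1"
  shows "\<exists>rk' d'. acyc ({0} :: 'a set) rk' d' \<and> (\<forall>i. rk' (K + i) = rk i) \<and> (\<forall>i. d' (Suc (K + i)) = d (Suc i))"
proof -
  define p where "p = max N 1"
  have p: "p \<ge> 1" "p \<ge> N" by (auto simp: p_def)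
  obtain r e where C: "acyc ({0} :: 'a set) r e" "\<forall>i\<le>p. r i = rk (p - i)"
    "\<forall>i<p. e (Suc i) = transp (rk (p - i)) (rk (p - Suc i)) (d (p - i))"
    and "\<forall>v\<in>freemod (r (Suc p)). cocyc {0} rk d 0 (e (Suc p) v)"
    by (rule dual_resolution[OF D van0 p(1)])
  obtain p' where p': "p = Suc p'" using p(1) by (cases p) auto
  have ep: "e p = transp (rk 1) (rk 0) (d 1)" "r p = rk 0" "r p' = rk 1" using C(3)[rule_format, of p'] C(2)[rule_format, of p] C(2)[rule_format, of p'] p' by auto
  define R where "R i = (if i \<le> K then r (p + K - i) else rk (i - K))" for i
  define E where "E i = (if i \<le> K then transp (r (Suc (p + K - i))) (r (p + K - i)) (e (Suc (p + K - i))) else d (i - K))" for i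
  have RK: "R (K + i) = rk i" for i using ep by (cases i) (auto simp: R_def)
  have EK: "E (Suc (K + i)) = d (Suc i)" for i by (auto simp: E_def)
  have Rle: "R i = r (p + K - i)" if "i \<le> K" for i using that by (simp add: R_def)
  have Ele: "E i = transp (r (Suc (p + K - i))) (r (p + K - i)) (e (Suc (p + K - i)))" if "i \<le> K" for i
    using that by (simp add: E_def)
  have L: "lin (R (Suc i)) (R i) (E (Suc i))" for i
  proof (cases "Suc i \<le> K")
    case True
    then have "p + K - i = Suc (p + K - Suc i)" by simp
    then show ?thesis using True Rle Ele lin_transp by simp
  next
    case False
    then obtain k where "i = K + k" using le_Suc_ex by (metis not_less_eq_eq)
    then show ?thesis using RK[of k] RK[of "Suc k"] EK[of k] acycD(1)[OF D, of k] by simp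
  qed
  have "acyc {0} R E"
    unfolding acyc_def
  proof (intro conjI allI ballI impI)
    fix i show "lin (R (Suc i)) (R i) (E (Suc i))" by (rule L)
    show "E (Suc i) (E (Suc (Suc i)) v) \<in> vecs {0} (R i)" if v: "v \<in> freemod (R (Suc (Suc i)))" for v
    proof (cases "Suc i \<le> K")
      case False
      then obtain k where "i = K + k" using le_Suc_ex by (metis not_less_eq_eq)
      then show ?thesis using RK[of k] RK[of "Suc (Suc k)"] EK[of k] EK[of "Suc k"] acycD(2)[OF D, of v k] v by simp
    next
      case True
      define k where "k = p + K - Suc (Suc i)"
      have k: "p + K - Suc i = Suc k" "p + K - i = Suc (Suc k)" using True p' by (auto simp: k_def)
      have "cobd {0} r e k (E (Suc (Suc i)) v)"
      proof (cases "Suc (Suc i) \<le> K")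
        case True2: True
        have "E (Suc (Suc i)) v = transp (r (Suc k)) (r k) (e (Suc k)) v" using Ele[OF True2] by (simp add: k_def)
        moreover have "v \<in> freemod (r k)" using v Rle[OF True2] by (simp add: k_def)
        ultimately show ?thesis unfolding cobd_def by auto
      next
        case False
        \<comment> \<open>At the seam the transpose of the transpose is \<open>d 1\<close>
          itself.\<close>
        then have iK: "Suc i = K" using True by simp
        then have kp: "k = p'" by (simp add: k_def p')
        have "E (Suc (Suc i)) v = d 1 v" using EK[of 0] iK by simp
        moreover have v1: "v \<in> freemod (rk 1)" using v RK[of 1] iK by simp
        moreover have "transp (rk 0) (rk 1) (e p) v = d 1 v"
          unfolding ep by (rule transp_transp[OF _ v1]) (use acycD(1)[OF D, of 0] in simp)
        moreover have "d 1 v \<in> freemod (rk 0)" using linD(1)[OF acycD(1)[OF D, of 0]] v1 by simp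
        ultimately show ?thesis unfolding cobd_def kp p'[symmetric] ep
          by (intro conjI bexI[of _ v]) auto
      qed
      from cobd_cocyc[OF zero_ideal C(1) this]
      have "transp (r (Suc (Suc k))) (r (Suc k)) (e (Suc (Suc k))) (E (Suc (Suc i)) v) \<in> vecs {0} (r (Suc (Suc k)))"
        by (simp add: cocyc_def)
      then show ?thesis using True Ele[of "Suc i"] Rle[of i] k by simp
    qed
    show "\<exists>w\<in>freemod (R (Suc (Suc i))). v - E (Suc (Suc i)) w \<in> vecs {0} (R (Suc i))"
      if v: "v \<in> freemod (R (Suc i))" "E (Suc i) v \<in> vecs {0} (R i)" for v
    proof (cases "Suc i \<le> K")
      case False
      then obtain k where "i = K + k" using le_Suc_ex by (metis not_less_eq_eq)
      then show ?thesis
        using RK[of k] RK[of "Suc k"] RK[of "Suc (Suc k)"] EK[of k] EK[of "Suc k"] acycD(3)[OF D, of v k] v by simp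
    next
      case True
      define k where "k = p + K - Suc (Suc i)"
      have k: "p + K - Suc i = Suc k" "p + K - i = Suc (Suc k)" using True p' by (auto simp: k_def)
      have "cocyc {0} r e (Suc k) v" using v True Ele[of "Suc i"] Rle[of "Suc i"] Rle[of i] k by (simp add: cocyc_def)
      moreover have "N \<le> Suc k" using k(1) True p(2) by simp
      ultimately have "cobd {0} r e k v" using vanD[OF V C(1)] by blast
      then obtain b where b: "b \<in> freemod (r k)" "v = transp (r (Suc k)) (r k) (e (Suc k)) b"
        unfolding cobd_def by auto
      show ?thesis
      proof (cases "Suc (Suc i) \<le> K")
        case True2: True
        have "E (Suc (Suc i)) b = v" "b \<in> freemod (R (Suc (Suc i)))"
          using Ele[OF True2] Rle[OF True2] b by (simp_all add: k_def)
        then show ?thesis by auto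
      next
        case False
        then have iK: "Suc i = K" using True by simp
        then have kp: "k = p'" by (simp add: k_def p')
        have b1: "b \<in> freemod (rk 1)" using b(1) kp ep by simp
        have "v = transp (rk 0) (rk 1) (e p) b" using b(2) kp ep p' by simp
        also have "\<dots> = d 1 b"
          unfolding ep by (rule transp_transp[OF _ b1]) (use acycD(1)[OF D, of 0] in simp)
        finally have "E (Suc (Suc i)) b = v" using EK[of 0] iK by simp
        moreover have "b \<in> freemod (R (Suc (Suc i)))" using b1 RK[of 1] iK by simp
        ultimately show ?thesis by auto
      qed
    qed
  qed
  then show ?thesis using RK EK by blast
qed

section \<open>Separating functionals over a self-injective quotient\<close>

text \<open>R/J is an injective cogenerator. In a resolution that starts with generators of
  \<open>N\<close> and \<open>y\<close>, reading off \<open>u\<close> times the coefficient of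
  \<open>y\<close> is a cocycle of degree 1; its primitive vanishes on \<open>N\<close> and sends
  \<open>y\<close> to \<open>u\<close>, both modulo \<open>J\<close>.\<close>

lemma separating_functional:
  assumes J: "is_ideal J" and V: "van J 1" and u: "u \<notin> J" "\<And>a. a \<in> \<mm> \<Longrightarrow> u * a \<in> J"
    and N: "is_module N fsmult" "N \<subseteq> freemod n" "vecs J n \<subseteq> N" and y: "y \<in> freemod n" "y \<notin> N"
  shows "\<exists>c\<in>freemod n. (\<forall>v\<in>N. dot n c v \<in> J) \<and> dot n c y \<notin> J"
proof -
  obtain q g1 where g1: "is_hom (freemod q) fsmult N fsmult g1" "g1 ` freemod q = N"
    by (rule noethmod_cover[OF free_noeth N(2,1)])
  have g1l: "lin q n g1" using g1(1) N(2) unfolding is_hom_def by blast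
  let ?g = "\<lambda>v. g1 (fstv q v) + fsmult (v q) y"
  have gl: "lin (q + 1) n ?g" by (rule lin_extend[OF g1l y(1)])
  obtain rk d where D: "acyc J rk d" "rk 0 = n" "rk (Suc 0) = q + 1" "d (Suc 0) = ?g"
    using resolution_exists[OF noeth J gl] by blast
  have ym: "c \<in> \<mm>" if "fsmult c y \<in> N" for c
    using units[of c] cancel_unit[OF N(1) freemod_module y(1) that] y(2) by blast
  have cob: "cobd J rk d 0 c" if "cocyc J rk d (Suc 0) c" for c by (rule vanD[OF V D(1) _ that]) simp
  obtain b where b: "b \<in> freemod n" "\<forall>v\<in>N. dot n b v \<in> J" "u - dot n b y \<in> J"
    using socle_functional[where p = 0 and V' = N, OF J u(2) D(1,3,4) N(1) _ _ g1 _ ym cob] N(2,3) y(1)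
    unfolding D(2) by blast
  have "dot n b y \<notin> J" using b(3) u(1) idealD(2)[OF J] by fastforce
  then show ?thesis using b(1,2) by blast
qed

end

section \<open>Traces and functionals on spaces of matrices\<close>

definition trace :: "nat \<Rightarrow> ((nat \<Rightarrow> 'a::comm_ring_1) \<Rightarrow> nat \<Rightarrow> 'a) \<Rightarrow> 'a" where
  "trace n f = (\<Sum>b<n. f (unitv b) b)"

lemma lin_coord:
  assumes "lin n m f" "v \<in> freemod n" shows "f v b = (\<Sum>a<n. v a * f (unitv a) b)"
  using hom_expand[OF assms] by (simp add: sum_fun_apply fsmult_apply)

lemma trace_comp_commute:
  assumes f: "lin n m f" and g: "lin m n g"
  shows "trace m (\<lambda>v. f (g v)) = trace n (\<lambda>v. g (f v))"
proof -
  have "trace m (\<lambda>v. f (g v)) = (\<Sum>b<m. \<Sum>a<n. g (unitv b) a * f (unitv a) b)"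
    unfolding trace_def by (rule sum.cong) (auto intro!: lin_coord[OF f] linD(1)[OF g])
  also have "\<dots> = (\<Sum>a<n. \<Sum>b<m. g (unitv b) a * f (unitv a) b)" by (rule sum.swap)
  also have "\<dots> = (\<Sum>a<n. \<Sum>b<m. f (unitv a) b * g (unitv b) a)" by (simp add: mult.commute)
  also have "\<dots> = trace n (\<lambda>v. g (f v))"
    unfolding trace_def by (rule sum.cong) (auto intro!: lin_coord[OF g, symmetric] linD(1)[OF f])
  finally show ?thesis .
qed

lemma trace_smult: "trace n (\<lambda>v. fsmult x (f v)) = x * trace n f"
  by (simp add: trace_def fsmult_apply sum_distrib_left)

lemma trace_diff_ideal:
  assumes "is_ideal J" "\<And>v. v \<in> freemod n \<Longrightarrow> f v - g v \<in> vecs J n"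
  shows "trace n f - trace n g \<in> J"
proof -
  have "trace n f - trace n g = (\<Sum>b<n. (f (unitv b) - g (unitv b)) b)"
    by (simp add: trace_def sum_subtractf)
  also have "\<dots> \<in> J"
  proof (rule ideal_sum[OF assms(1)])
    fix b assume "b \<in> {..<n}"
    then have "unitv b \<in> freemod n" by simp
    from vecsD[OF assms(2)[OF this]] show "(f (unitv b) - g (unitv b)) b \<in> J" .
  qed
  finally show ?thesis .
qed

lemma sum_lessThan_add: "(\<Sum>k<p + m. g k) = (\<Sum>k<p. g k) + (\<Sum>b<m. g (p + b))" for g :: "nat \<Rightarrow> 'b::comm_monoid_add"
  by (induction m) (auto simp: add.assoc)

lemma sum_lessThan_mult: "(\<Sum>k<n * m. g k) = (\<Sum>a<n. \<Sum>b<m. g (a * m + b))" for g :: "nat \<Rightarrow> 'b::comm_monoid_add"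
  by (induction n) (auto simp: sum_lessThan_add add.commute[of m])

text \<open>The images of the unit vectors written one after the other as a single vector, so that
  functionals on linear maps become dot products.\<close>

definition flat :: "nat \<Rightarrow> nat \<Rightarrow> ((nat \<Rightarrow> 'a::comm_ring_1) \<Rightarrow> nat \<Rightarrow> 'a) \<Rightarrow> nat \<Rightarrow> 'a" where
  "flat n m f k = (if k < n * m then f (unitv (k div m)) (k mod m) else 0)"

lemma flat_entry: "a < n \<Longrightarrow> b < m \<Longrightarrow> flat n m f (a * m + b) = f (unitv a) b"
proof -
  assume a: "a < n" "b < m"
  have "a * m + b < Suc a * m" using a by simp
  also have "\<dots> \<le> n * m" using a by (intro mult_right_mono) auto
  finally show ?thesis using a by (simp add: flat_def)
qed

context local_noeth
begin

text \<open>Functionals on the free module of matrices are of the form \<open>f \<mapsto> trace (f \<circ> \<Psi>)\<close>.\<close>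
lemma separating_trace:
  fixes S :: "((nat \<Rightarrow> 'a) \<Rightarrow> nat \<Rightarrow> 'a) set"
  assumes J: "is_ideal J" and V: "van J 1" and u: "u \<notin> J" "\<And>a. a \<in> \<mm> \<Longrightarrow> u * a \<in> J"
    and S: "\<And>f. f \<in> S \<Longrightarrow> lin n m f" "\<And>f g. f \<in> S \<Longrightarrow> g \<in> S \<Longrightarrow> (\<lambda>v. f v + g v) \<in> S"
      "\<And>a f. f \<in> S \<Longrightarrow> (\<lambda>v. fsmult a (f v)) \<in> S"
      "\<And>f. lin n m f \<Longrightarrow> (\<And>v. v \<in> freemod n \<Longrightarrow> f v \<in> vecs J m) \<Longrightarrow> f \<in> S"
    and f0: "lin n m f0" "\<And>f. f \<in> S \<Longrightarrow> \<exists>v\<in>freemod n. f v \<noteq> f0 v"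
  shows "\<exists>\<Psi>. lin m n \<Psi> \<and> (\<forall>f\<in>S. trace m (\<lambda>v. f (\<Psi> v)) \<in> J) \<and> trace m (\<lambda>v. f0 (\<Psi> v)) \<notin> J"
proof -
  let ?N = "flat n m ` S"
  have sub: "?N \<subseteq> freemod (n * m)" by (auto simp: flat_def freemod_def)
  have zS: "(\<lambda>v. 0) \<in> S" using is_moduleD(1)[OF vecs_module[OF J]] by (intro S(4)) auto
  have N: "is_module ?N fsmult"
  proof (rule is_module_subset[OF freemod_module sub])
    have "flat n m (\<lambda>v. 0) = (0 :: nat \<Rightarrow> 'a)" by (auto simp: flat_def fun_eq_iff)
    then show "0 \<in> ?N" using zS by force
    fix y z assume "y \<in> ?N" "z \<in> ?N"
    then obtain f g where fg: "f \<in> S" "g \<in> S" "y = flat n m f" "z = flat n m g" by blast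
    then have "y + z = flat n m (\<lambda>v. f v + g v)" by (auto simp: flat_def fun_eq_iff)
    then show "y + z \<in> ?N" using S(2)[OF fg(1,2)] by blast
  next
    fix a y assume "y \<in> ?N"
    then obtain f where f: "f \<in> S" "y = flat n m f" by blast
    then have "fsmult a y = flat n m (\<lambda>v. fsmult a (f v))" by (auto simp: flat_def fun_eq_iff fsmult_apply)
    then show "fsmult a y \<in> ?N" using S(3)[OF f(1)] by blast
  qed
  have "vecs J (n * m) \<subseteq> ?N"
  proof
    fix v assume v: "v \<in> vecs J (n * m)"
    define w where "w a = (\<lambda>b. if b < m then v (a * m + b) else 0)" for a
    have w: "w a \<in> vecs J m" for a using v idealD(1)[OF J] by (auto simp: w_def vecs_def freemod_def)
    have wf: "w a \<in> freemod m" for a using w vecs_sub by blast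
    have "comb n fsmult w \<in> S"
    proof (rule S(4)[OF lin_comb[OF wf]])
      fix z :: "nat \<Rightarrow> 'a" assume "z \<in> freemod n"
      have "is_hom (freemod n) fsmult (vecs J m) fsmult (comb n fsmult w)"
        by (rule comb_hom[OF vecs_module[OF J] w])
      from is_homD(1)[OF this \<open>z \<in> freemod n\<close>] show "comb n fsmult w z \<in> vecs J m" .
    qed
    moreover have "v = flat n m (comb n fsmult w)"
    proof
      fix k
      show "v k = flat n m (comb n fsmult w) k"
      proof (cases "k < n * m")
        case False then show ?thesis using vecs_sub[OF v] by (simp add: flat_def freemod_def)
      next
        case True
        then have m: "m > 0" by (cases m) auto
        have a: "k div m < n" using True by (simp add: less_mult_imp_div_less)
        have "comb n fsmult w (unitv (k div m)) = w (k div m)" by (rule comb_unitv_free[OF wf a])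
        then show ?thesis using True m by (simp add: flat_def w_def)
      qed
    qed
    ultimately show "v \<in> ?N" by blast
  qed
  moreover have "flat n m f0 \<in> freemod (n * m)" by (auto simp: flat_def freemod_def)
  moreover have "flat n m f0 \<notin> ?N"
  proof
    assume "flat n m f0 \<in> ?N"
    then obtain f where f: "f \<in> S" "flat n m f0 = flat n m f" by blast
    have "f (unitv a) = f0 (unitv a)" if a: "a < n" for a
    proof
      fix b
      show "f (unitv a) b = f0 (unitv a) b"
      proof (cases "b < m")
        case True then show ?thesis using flat_entry[OF a True, of f] flat_entry[OF a True, of f0] f(2) by simp
      next
        case False
        then show ?thesis using linD(1)[OF S(1)[OF f(1)] unitv_in[OF a]] linD(1)[OF f0(1) unitv_in[OF a]]
          by (simp add: freemod_def)
      qed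
    qed
    then have "f v = f0 v" if "v \<in> freemod n" for v using hom_eqI[OF S(1)[OF f(1)] f0(1) _ that] by blast
    then show False using f0(2)[OF f(1)] by blast
  qed
  ultimately obtain c where c: "\<forall>v\<in>?N. dot (n * m) c v \<in> J" "dot (n * m) c (flat n m f0) \<notin> J"
    using separating_functional[OF J V u N sub] by blast
  \<comment> \<open>The coefficients of the functional, rearranged as the transposed matrix.\<close>
  define \<psi> where "\<psi> b = (\<lambda>a. if a < n then c (a * m + b) else 0)" for b
  have \<psi>: "\<psi> b \<in> freemod n" for b by (simp add: \<psi>_def freemod_def)
  let ?\<Psi> = "comb m fsmult \<psi>"
  have \<Psi>: "lin m n ?\<Psi>" by (rule lin_comb[OF \<psi>])
  have tr: "trace m (\<lambda>v. f (?\<Psi> v)) = dot (n * m) c (flat n m f)" if f: "lin n m f" for f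
  proof -
    have "trace m (\<lambda>v. f (?\<Psi> v)) = (\<Sum>b<m. f (\<psi> b) b)"
      unfolding trace_def by (rule sum.cong) (auto simp: comb_unitv_free[OF \<psi>])
    also have "\<dots> = (\<Sum>b<m. \<Sum>a<n. c (a * m + b) * f (unitv a) b)"
    proof (rule sum.cong[OF refl])
      fix b show "f (\<psi> b) b = (\<Sum>a<n. c (a * m + b) * f (unitv a) b)"
        unfolding lin_coord[OF f \<psi>] by (rule sum.cong) (auto simp: \<psi>_def)
    qed
    also have "\<dots> = (\<Sum>a<n. \<Sum>b<m. c (a * m + b) * f (unitv a) b)" by (rule sum.swap)
    also have "\<dots> = (\<Sum>a<n. \<Sum>b<m. c (a * m + b) * flat n m f (a * m + b))"
      by (intro sum.cong) (auto simp: flat_entry)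
    also have "\<dots> = dot (n * m) c (flat n m f)" unfolding dot_def by (rule sum_lessThan_mult[symmetric])
    finally show ?thesis .
  qed
  show ?thesis
    by (rule exI[of _ ?\<Psi>]) (use \<Psi> c tr[OF S(1)] tr[OF f0(1)] in auto)
qed

end

section \<open>Duality for stable endomorphisms\<close>

text \<open>The module \<open>M\<close> is the cokernel of \<open>d (l + 3)\<close>, presented by the free module at position \<open>l + 2\<close>;
  equivalently it is the image of \<open>d (l + 2)\<close>, so that an element \<open>v\<close> of the presenting free module
  vanishes in \<open>M / (x\<^sub>i)\<^sub>i\<^sub>\<in>\<^sub>A M\<close> iff \<open>d (l + 2) v\<close> has entries in \<open>idl x A\<close>.
  The map \<open>H i\<close> induces a factorisation of multiplication by \<open>x i\<close> on \<open>M\<close> through a free module.\<close>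
locale stable_module = local_noeth \<mm> for \<mm> :: "'a::comm_ring_1 set" +
  fixes rk :: "nat \<Rightarrow> nat" and d :: "nat \<Rightarrow> (nat \<Rightarrow> 'a) \<Rightarrow> (nat \<Rightarrow> 'a)" and l t :: nat
    and x :: "nat \<Rightarrow> 'a" and u :: 'a and H :: "nat \<Rightarrow> (nat \<Rightarrow> 'a) \<Rightarrow> (nat \<Rightarrow> 'a)"
  assumes T: "acyc {0} rk d" and tl: "t \<le> l"
    and dual_exact: "\<And>j c. Suc (Suc l) \<le> j \<Longrightarrow> cocyc {0} rk d (Suc j) c \<Longrightarrow> cobd {0} rk d j c"
    and reg: "regseq x t" and xm: "\<And>i. i < t \<Longrightarrow> x i \<in> \<mm>"
    and socle: "u \<notin> idl x {..<t}" "\<And>a. a \<in> \<mm> \<Longrightarrow> u * a \<in> idl x {..<t}" and selfinj: "van (idl x {..<t}) 1"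
    and Hlin: "\<And>i. i < t \<Longrightarrow> lin (rk (Suc (Suc l))) (rk (Suc (Suc l))) (H i)"
    and Hkill: "\<And>i v. i < t \<Longrightarrow> v \<in> freemod (rk (Suc (Suc (Suc l)))) \<Longrightarrow> H i (d (Suc (Suc (Suc l))) v) = 0"
    and Hx: "\<And>i v. i < t \<Longrightarrow> v \<in> freemod (rk (Suc (Suc l))) \<Longrightarrow> d (Suc (Suc l)) (H i v - fsmult (x i) v) = 0"
begin

abbreviation "F i \<equiv> freemod (rk i) :: (nat \<Rightarrow> 'a) set"
abbreviation "dK \<equiv> d (Suc (Suc l))"
abbreviation "nK \<equiv> rk (Suc (Suc l))"
abbreviation "FK \<equiv> F (Suc (Suc l))"
abbreviation "FB \<equiv> F (Suc (Suc (Suc l)))"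
abbreviation "dB \<equiv> d (Suc (Suc (Suc l)))"

text \<open>These are the maps that factor through the cokernel \<open>M\<close> of
  \<open>dB\<close>.\<close>

definition kills :: "((nat \<Rightarrow> 'a) \<Rightarrow> nat \<Rightarrow> 'a) \<Rightarrow> bool" where
  "kills w \<longleftrightarrow> (\<forall>v\<in>FB. w (dB v) = 0)"

lemma dl: "lin (rk (Suc i)) (rk i) (d (Suc i))" by (rule acycD(1)[OF T])
lemma d_in: "v \<in> F (Suc i) \<Longrightarrow> d (Suc i) v \<in> F i" by (rule linD(1)[OF dl])
lemma dd0: "v \<in> F (Suc (Suc i)) \<Longrightarrow> d (Suc i) (d (Suc (Suc i)) v) = 0" using acycD(2)[OF T, of v i] by simp

lemma killsD:
  assumes "kills w" "v \<in> FK" "dK v = 0" shows "w v = 0"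
proof -
  obtain b where "b \<in> FB" "v - dB b = 0"
    using acycD(3)[OF T assms(2)] assms(3) by auto
  then show ?thesis using assms(1) unfolding kills_def by (metis eq_iff_diff_eq_0)
qed

lemma fin: "A \<subseteq> {..<t} \<Longrightarrow> finite A" by (rule finite_subset) auto
lemma Iid: "A \<subseteq> {..<t} \<Longrightarrow> is_ideal (idl x A)" by (rule idl_ideal[OF fin])
lemma Vm: "A \<subseteq> {..<t} \<Longrightarrow> is_module (vecs (idl x A) k) fsmult" by (rule vecs_module[OF Iid])
lemma nz: "A \<subseteq> {..<t} \<Longrightarrow> i < t \<Longrightarrow> i \<notin> A \<Longrightarrow> nzd (idl x A) (x i)"
  by (rule regseq_permutable[OF reg xm])

text \<open>Each element of \<open>A\<close> is divided out by \<open>acyc_shift_quotient\<close>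
  and costs one position, so exactness modulo \<open>idl x A\<close> begins just above
  \<open>card A\<close>. The assumption \<open>t \<le> l\<close> places \<open>M\<close> high enough
  for this.\<close>

lemma exact_mod:
  assumes A: "A \<subseteq> {..<t}" and i: "card A \<le> i" and v: "v \<in> F (Suc i)" "d (Suc i) v \<in> vecs (idl x A) (rk i)"
  shows "\<exists>w\<in>F (Suc (Suc i)). v - d (Suc (Suc i)) w \<in> vecs (idl x A) (rk (Suc i))"
proof -
  have "finite A \<Longrightarrow> A \<subseteq> {..<t} \<Longrightarrow> acyc (idl x A) (\<lambda>i. rk (i + card A)) (\<lambda>i. d (i + card A))" for A
  proof (induction A rule: finite_induct)
    case empty then show ?case using T by simp
  next
    case (insert a A)
    then have "acyc (idl x A) (\<lambda>i. rk (i + card A)) (\<lambda>i. d (i + card A))" by simp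
    from acyc_shift_quotient[OF idl_ideal[OF insert.hyps(1)] this nz[of A a]] insert
    show ?case by (simp add: idl_insert)
  qed
  from acycD(3)[OF this[OF fin[OF A] A], of v "i - card A"] i v show ?thesis by (simp add: Suc_diff_le)
qed

section \<open>Moving the regular sequence across the trace pairing\<close>

lemma ivl_insert: "i < t \<Longrightarrow> {i..<t} = insert i {Suc i..<t}" by auto

lemma adjoin_top: "i < t \<Longrightarrow> idl x {i..<t} = adjoin (idl x {Suc i..<t}) (x i)"
  using idl_insert[of "{Suc i..<t}" i x] by (metis Suc_n_not_le_n atLeastLessThan_iff finite_atLeastLessThan ivl_insert)

lemma mod_module: "A \<subseteq> {..<t} \<Longrightarrow> is_module {y \<in> FK. dK y \<in> vecs (idl x A) (rk (Suc l))} fsmult"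
  by (rule hom_vimage_module[OF freemod_module freemod_module dl Vm])

lemma card_le: "A \<subseteq> {..<t} \<Longrightarrow> card A \<le> l + i"
  using card_mono[of "{..<t}" A] tl by simp

text \<open>The connecting homomorphism of multiplication by \<open>x i\<close>. A cocycle
  \<open>\<phi>\<close> into M modulo \<open>x i\<close> and the later elements has, modulo the
  later ones, a coboundary of the form x_i \<phi>'; then \<open>\<phi>'\<close> is a cocycle modulo
  the later elements, one degree higher.\<close>

lemma phi_step:
  assumes i: "i < t" and \<phi>: "lin (rk (Suc (l + i))) nK \<phi>"
    and c: "\<And>v. v \<in> F (Suc (Suc (l + i))) \<Longrightarrow> dK (\<phi> (d (Suc (Suc (l + i))) v)) \<in> vecs (idl x {i..<t}) (rk (Suc l))"
  obtains \<phi>' where "lin (rk (Suc (Suc (l + i)))) nK \<phi>'"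
    "\<forall>v\<in>F (Suc (Suc (l + i))). dK (\<phi> (d (Suc (Suc (l + i))) v) - fsmult (x i) (\<phi>' v)) \<in> vecs (idl x {Suc i..<t}) (rk (Suc l))"
    "\<forall>v\<in>F (Suc (Suc (Suc (l + i)))). dK (\<phi>' (d (Suc (Suc (Suc (l + i)))) v)) \<in> vecs (idl x {Suc i..<t}) (rk (Suc l))"
proof -
  let ?A = "{Suc i..<t}" and ?d = "d (Suc (Suc (l + i)))"
  let ?Q = "{y \<in> FK. dK y \<in> vecs (idl x ?A) (rk (Suc l))}"
  have A: "?A \<subseteq> {..<t}" "{i..<t} \<subseteq> {..<t}" by auto
  have Q: "is_module ?Q fsmult" by (rule mod_module[OF A(1)])
  have "\<exists>w\<in>FK. \<phi> (?d e) - fsmult (x i) w \<in> ?Q" if e: "e \<in> F (Suc (Suc (l + i)))" for e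
  proof -
    have y: "\<phi> (?d e) \<in> FK" by (rule linD(1)[OF \<phi> d_in[OF e]])
    have cl: "card {i..<t} \<le> Suc l" using card_le[OF A(2), of 1] by simp
    obtain b where b: "b \<in> FB" "\<phi> (?d e) - dB b \<in> vecs (idl x {i..<t}) nK"
      using exact_mod[OF A(2) cl y c[OF e]] by blast
    obtain w where w: "w \<in> FK" "\<phi> (?d e) - dB b - fsmult (x i) w \<in> vecs (idl x ?A) nK"
      using adjoin_vecs[OF Iid[OF A(1)], of _ "x i"] b(2) adjoin_top[OF i] by metis
    have "dK (\<phi> (?d e) - dB b - fsmult (x i) w) \<in> vecs (idl x ?A) (rk (Suc l))"
      by (rule lin_vecs[OF Iid[OF A(1)] dl w(2)])
    moreover have "dK (\<phi> (?d e) - dB b - fsmult (x i) w) = dK (\<phi> (?d e) - fsmult (x i) w)"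
      using y w(1) d_in[OF b(1)] dd0[OF b(1)] by (simp add: lin_diff[OF dl])
    ultimately show ?thesis using y w(1) by (intro bexI[of _ w]) auto
  qed
  then have "\<exists>g. lin (rk (Suc (Suc (l + i)))) nK g \<and> (\<forall>v\<in>F (Suc (Suc (l + i))). \<phi> (?d v) - fsmult (x i) (g v) \<in> ?Q)"
    by (intro free_lift[OF freemod_module Q hom_comp[OF dl \<phi>] freemod_module lin_fsmult]) auto
  then obtain g where g: "lin (rk (Suc (Suc (l + i)))) nK g"
    "\<And>v. v \<in> F (Suc (Suc (l + i))) \<Longrightarrow> \<phi> (?d v) - fsmult (x i) (g v) \<in> ?Q" by blast
  have "dK (g (d (Suc (Suc (Suc (l + i)))) v)) \<in> vecs (idl x ?A) (rk (Suc l))" if v: "v \<in> F (Suc (Suc (Suc (l + i))))" for v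
  proof -
    let ?w = "d (Suc (Suc (Suc (l + i)))) v"
    have w: "?w \<in> F (Suc (Suc (l + i)))" by (rule d_in[OF v])
    have gw: "g ?w \<in> FK" by (rule linD(1)[OF g(1) w])
    have "\<phi> (?d ?w) = 0" using dd0[OF v] lin_zero[OF \<phi>] by simp
    then have "dK (- fsmult (x i) (g ?w)) \<in> vecs (idl x ?A) (rk (Suc l))" using g(2)[OF w] by simp
    then have "- fsmult (x i) (dK (g ?w)) \<in> vecs (idl x ?A) (rk (Suc l))"
      using gw by (simp add: lin_minus[OF dl] linD(3)[OF dl])
    from is_moduleD(3)[OF Vm[OF A(1)] this] have "fsmult (x i) (dK (g ?w)) \<in> vecs (idl x ?A) (rk (Suc l))" by simp
    then show ?thesis using nzd_vecs[OF nz[OF A(1) i]] d_in[OF gw] by simp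
  qed
  then show ?thesis using that g by blast
qed

text \<open>Modulo the earlier elements \<open>w\<close> lifts through the next differential to some
  \<open>\<mu>\<close>, which need not vanish on the relations of \<open>M\<close>. Composing with
  \<open>H i\<close> repairs this, and turns \<open>w\<close> into \<open>x i\<close> times
  \<open>w\<close> because \<open>w\<close> factors through \<open>M\<close>.\<close>

lemma w_step:
  assumes i: "i < t" and w: "lin nK (rk (Suc (l + i))) w" "kills w"
    and c: "\<And>v. v \<in> FK \<Longrightarrow> d (Suc (l + i)) (w v) \<in> vecs (idl x {..<i}) (rk (l + i))"
  obtains w' where "lin nK (rk (Suc (Suc (l + i)))) w'" "kills w'"
    "\<forall>v\<in>FK. fsmult (x i) (w v) - d (Suc (Suc (l + i))) (w' v) \<in> vecs (idl x {..<i}) (rk (Suc (l + i)))"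
    "\<forall>v\<in>FK. d (Suc (Suc (l + i))) (w' v) \<in> vecs (idl x {..<Suc i}) (rk (Suc (l + i)))"
proof -
  let ?A = "{..<i}" and ?d = "d (Suc (Suc (l + i)))"
  have A: "?A \<subseteq> {..<t}" using i by auto
  have "\<exists>\<mu>. lin nK (rk (Suc (Suc (l + i)))) \<mu> \<and> (\<forall>v\<in>FK. w v - ?d (\<mu> v) \<in> vecs (idl x ?A) (rk (Suc (l + i))))"
  proof (rule free_lift[OF freemod_module Vm[OF A] w(1) freemod_module dl])
    fix a assume "a < nK"
    then have e: "unitv a \<in> FK" by simp
    from exact_mod[OF A card_le[OF A] linD(1)[OF w(1) e] c[OF e]]
    show "\<exists>v\<in>F (Suc (Suc (l + i))). w (unitv a) - ?d v \<in> vecs (idl x ?A) (rk (Suc (l + i)))" .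
  qed
  then obtain \<mu> where \<mu>: "lin nK (rk (Suc (Suc (l + i)))) \<mu>"
    "\<And>v. v \<in> FK \<Longrightarrow> w v - ?d (\<mu> v) \<in> vecs (idl x ?A) (rk (Suc (l + i)))" by blast
  define w' where "w' v = \<mu> (H i v)" for v
  have 1: "lin nK (rk (Suc (Suc (l + i)))) w'" unfolding w'_def by (rule hom_comp[OF Hlin[OF i] \<mu>(1)])
  have 2: "kills w'" unfolding kills_def w'_def using Hkill[OF i] lin_zero[OF \<mu>(1)] by simp
  have wH: "w (H i v) = fsmult (x i) (w v)" if v: "v \<in> FK" for v
  proof -
    have Hv: "H i v \<in> FK" by (rule linD(1)[OF Hlin[OF i] v])
    have "w (H i v - fsmult (x i) v) = 0"
      by (rule killsD[OF w(2) fm_diff[OF Hv fm_smult[OF v]] Hx[OF i v]])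
    then show ?thesis using v Hv by (simp add: lin_diff[OF w(1)] linD(3)[OF w(1)])
  qed
  have 3: "fsmult (x i) (w v) - ?d (w' v) \<in> vecs (idl x ?A) (rk (Suc (l + i)))" if v: "v \<in> FK" for v
    using \<mu>(2)[OF linD(1)[OF Hlin[OF i] v]] wH[OF v] by (simp add: w'_def)
  have 4: "?d (w' v) \<in> vecs (idl x {..<Suc i}) (rk (Suc (l + i)))" if v: "v \<in> FK" for v
  proof -
    have "- (fsmult (x i) (w v) - ?d (w' v)) \<in> vecs (idl x ?A) (rk (Suc (l + i)))"
      by (rule is_moduleD(3)[OF Vm[OF A] 3[OF v]])
    then have "?d (w' v) - fsmult (x i) (w v) \<in> vecs (idl x ?A) (rk (Suc (l + i)))" by simp
    from adjoin_vecsI[OF Iid[OF A] linD(1)[OF w(1) v] this] show ?thesis by (simp only: idl_lessThan_Suc)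
  qed
  show ?thesis by (rule that[OF 1 2]) (use 3 4 in blast)+
qed

text \<open>Modulo all elements but \<open>x i\<close>, the product of \<open>x i\<close> with the
  first trace is tr(d w' \<phi>) = tr(w' \<phi> d), which is the product of \<open>x i\<close> with
  the second trace. As \<open>x i\<close> is regular modulo the others, it cancels.\<close>

lemma trace_step:
  assumes i: "i < t" and w: "lin nK (rk (Suc (l + i))) w" and w': "lin nK (rk (Suc (Suc (l + i)))) w'" "kills w'"
    and ww: "\<And>v. v \<in> FK \<Longrightarrow> fsmult (x i) (w v) - d (Suc (Suc (l + i))) (w' v) \<in> vecs (idl x {..<i}) (rk (Suc (l + i)))"
    and \<phi>: "lin (rk (Suc (l + i))) nK \<phi>" and \<phi>': "lin (rk (Suc (Suc (l + i)))) nK \<phi>'"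
    and pp: "\<And>v. v \<in> F (Suc (Suc (l + i))) \<Longrightarrow>
      dK (\<phi> (d (Suc (Suc (l + i))) v) - fsmult (x i) (\<phi>' v)) \<in> vecs (idl x {Suc i..<t}) (rk (Suc l))"
  shows "trace (rk (Suc (l + i))) (\<lambda>v. w (\<phi> v)) - trace (rk (Suc (Suc (l + i)))) (\<lambda>v. w' (\<phi>' v)) \<in> idl x {..<t}"
proof -
  let ?d = "d (Suc (Suc (l + i)))" and ?n = "rk (Suc (l + i))" and ?n' = "rk (Suc (Suc (l + i)))"
  let ?C = "{..<t} - {i}"
  have C: "?C \<subseteq> {..<t}" "{..<i} \<subseteq> ?C" "{Suc i..<t} \<subseteq> ?C" "{Suc i..<t} \<subseteq> {..<t}" using i by auto
  have m1: "vecs (idl x {..<i}) k \<subseteq> vecs (idl x ?C) k" for k by (rule vecs_mono[OF idl_mono[OF fin[OF C(1)] C(2)]])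
  have m2: "vecs (idl x {Suc i..<t}) k \<subseteq> vecs (idl x ?C) k" for k by (rule vecs_mono[OF idl_mono[OF fin[OF C(1)] C(3)]])
  have "trace ?n (\<lambda>v. fsmult (x i) (w (\<phi> v))) - trace ?n (\<lambda>v. ?d (w' (\<phi> v))) \<in> idl x ?C"
    by (rule trace_diff_ideal[OF Iid[OF C(1)]]) (use ww[OF linD(1)[OF \<phi>]] m1 in blast)
  then have a: "x i * trace ?n (\<lambda>v. w (\<phi> v)) - trace ?n (\<lambda>v. ?d (w' (\<phi> v))) \<in> idl x ?C"
    by (simp add: trace_smult)
  have eq: "trace ?n (\<lambda>v. ?d (w' (\<phi> v))) = trace ?n' (\<lambda>v. w' (\<phi> (?d v)))"
    by (rule trace_comp_commute[OF dl hom_comp[OF \<phi> w'(1)]])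
  have "w' (\<phi> (?d v)) - fsmult (x i) (w' (\<phi>' v)) \<in> vecs (idl x ?C) ?n'" if v: "v \<in> F (Suc (Suc (l + i)))" for v
  proof -
    have p1: "\<phi> (?d v) \<in> FK" by (rule linD(1)[OF \<phi> d_in[OF v]])
    have p2: "\<phi>' v \<in> FK" by (rule linD(1)[OF \<phi>' v])
    let ?y = "\<phi> (?d v) - fsmult (x i) (\<phi>' v)"
    have y: "?y \<in> FK" by (rule fm_diff[OF p1 fm_smult[OF p2]])
    have cl: "card {Suc i..<t} \<le> Suc l" using card_le[OF C(4), of 1] by simp
    obtain b where b: "b \<in> FB" "?y - dB b \<in> vecs (idl x {Suc i..<t}) nK"
      using exact_mod[OF C(4) cl y pp[OF v]] by blast
    have "w' (?y - dB b) \<in> vecs (idl x {Suc i..<t}) ?n'"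
      by (rule lin_vecs[OF Iid[OF C(4)] w'(1) b(2)])
    moreover have "w' (?y - dB b) = w' ?y"
      using w'(2) b(1) y d_in[OF b(1)] by (simp add: lin_diff[OF w'(1) y] kills_def)
    moreover have "w' ?y = w' (\<phi> (?d v)) - fsmult (x i) (w' (\<phi>' v))"
      using p1 p2 by (simp add: lin_diff[OF w'(1)] linD(3)[OF w'(1)])
    ultimately show ?thesis using m2 by auto
  qed
  from trace_diff_ideal[OF Iid[OF C(1)] this]
  have b: "trace ?n' (\<lambda>v. w' (\<phi> (?d v))) - x i * trace ?n' (\<lambda>v. w' (\<phi>' v)) \<in> idl x ?C" by (simp add: trace_smult)
  have "x i * (trace ?n (\<lambda>v. w (\<phi> v)) - trace ?n' (\<lambda>v. w' (\<phi>' v))) =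
    (x i * trace ?n (\<lambda>v. w (\<phi> v)) - trace ?n (\<lambda>v. ?d (w' (\<phi> v)))) +
    (trace ?n' (\<lambda>v. w' (\<phi> (?d v))) - x i * trace ?n' (\<lambda>v. w' (\<phi>' v)))"
    unfolding eq by (simp add: algebra_simps)
  also have "\<dots> \<in> idl x ?C" by (rule idealD(2)[OF Iid[OF C(1)] a b])
  finally have "trace ?n (\<lambda>v. w (\<phi> v)) - trace ?n' (\<lambda>v. w' (\<phi>' v)) \<in> idl x ?C"
    using nz[OF C(1) i] by (simp add: nzd_def)
  then show ?thesis using idl_mono[OF _ C(1)] by blast
qed

text \<open>At stage \<open>i\<close> the map \<open>w\<close> takes values in cycles modulo the
  first \<open>i\<close> elements, and \<open>\<phi>'\<close> is a cocycle modulo the remaining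
  ones, while the trace modulo all of them never changes. The start has a genuine \<open>z\<close>
  with values in cycles; at \<open>i = t\<close> it is \<open>\<phi>'\<close> that is a genuine
  cocycle into \<open>M\<close>, to which annihilation of Ext applies.\<close>

lemma zigzag:
  assumes z: "lin nK (rk (Suc l)) z" "kills z" "\<And>v. v \<in> FK \<Longrightarrow> d (Suc l) (z v) = 0"
    and \<phi>: "lin (rk (Suc l)) nK \<phi>" "\<And>v. v \<in> FK \<Longrightarrow> dK (\<phi> (dK v)) \<in> vecs (idl x {..<t}) (rk (Suc l))"
    and i: "i \<le> t"
  shows "\<exists>\<phi>' w. lin (rk (Suc (l + i))) nK \<phi>' \<and> lin nK (rk (Suc (l + i))) w \<and> kills w \<and>
    (\<forall>v\<in>F (Suc (Suc (l + i))). dK (\<phi>' (d (Suc (Suc (l + i))) v)) \<in> vecs (idl x {i..<t}) (rk (Suc l))) \<and>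
    (\<forall>v\<in>FK. d (Suc (l + i)) (w v) \<in> vecs (idl x {..<i}) (rk (l + i))) \<and>
    trace (rk (Suc l)) (\<lambda>v. z (\<phi> v)) - trace (rk (Suc (l + i))) (\<lambda>v. w (\<phi>' v)) \<in> idl x {..<t}"
  using i
proof (induction i)
  case 0
  have "{0..<t} = {..<t}" by auto
  then have "lin (rk (Suc (l + 0))) nK \<phi> \<and> lin nK (rk (Suc (l + 0))) z \<and> kills z \<and>
    (\<forall>v\<in>F (Suc (Suc (l + 0))). dK (\<phi> (d (Suc (Suc (l + 0))) v)) \<in> vecs (idl x {0..<t}) (rk (Suc l))) \<and>
    (\<forall>v\<in>FK. d (Suc (l + 0)) (z v) \<in> vecs (idl x {..<0}) (rk (l + 0))) \<and>
    trace (rk (Suc l)) (\<lambda>v. z (\<phi> v)) - trace (rk (Suc (l + 0))) (\<lambda>v. z (\<phi> v)) \<in> idl x {..<t}"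
    using z \<phi> idealD(1)[OF Iid[OF subset_refl]] by simp
  then show ?case by blast
next
  case (Suc i)
  then obtain \<phi>' w where I: "lin (rk (Suc (l + i))) nK \<phi>'" "lin nK (rk (Suc (l + i))) w" "kills w"
    "\<And>v. v \<in> F (Suc (Suc (l + i))) \<Longrightarrow> dK (\<phi>' (d (Suc (Suc (l + i))) v)) \<in> vecs (idl x {i..<t}) (rk (Suc l))"
    "\<And>v. v \<in> FK \<Longrightarrow> d (Suc (l + i)) (w v) \<in> vecs (idl x {..<i}) (rk (l + i))"
    and tr: "trace (rk (Suc l)) (\<lambda>v. z (\<phi> v)) - trace (rk (Suc (l + i))) (\<lambda>v. w (\<phi>' v)) \<in> idl x {..<t}"
    by auto
  have it: "i < t" using Suc by simp
  obtain \<phi>2 where p: "lin (rk (Suc (Suc (l + i)))) nK \<phi>2"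
    "\<forall>v\<in>F (Suc (Suc (l + i))). dK (\<phi>' (d (Suc (Suc (l + i))) v) - fsmult (x i) (\<phi>2 v)) \<in> vecs (idl x {Suc i..<t}) (rk (Suc l))"
    "\<forall>v\<in>F (Suc (Suc (Suc (l + i)))). dK (\<phi>2 (d (Suc (Suc (Suc (l + i)))) v)) \<in> vecs (idl x {Suc i..<t}) (rk (Suc l))"
    by (rule phi_step[OF it I(1,4)])
  obtain w2 where w: "lin nK (rk (Suc (Suc (l + i)))) w2" "kills w2"
    "\<forall>v\<in>FK. fsmult (x i) (w v) - d (Suc (Suc (l + i))) (w2 v) \<in> vecs (idl x {..<i}) (rk (Suc (l + i)))"
    "\<forall>v\<in>FK. d (Suc (Suc (l + i))) (w2 v) \<in> vecs (idl x {..<Suc i}) (rk (Suc (l + i)))"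
    by (rule w_step[OF it I(2,3,5)])
  have "trace (rk (Suc (l + i))) (\<lambda>v. w (\<phi>' v)) - trace (rk (Suc (Suc (l + i)))) (\<lambda>v. w2 (\<phi>2 v)) \<in> idl x {..<t}"
    by (rule trace_step[OF it I(2) w(1,2) _ I(1) p(1)]) (use w(3) p(2) in auto)
  from idealD(2)[OF Iid[OF subset_refl] tr this]
  have "trace (rk (Suc l)) (\<lambda>v. z (\<phi> v)) - trace (rk (Suc (Suc (l + i)))) (\<lambda>v. w2 (\<phi>2 v)) \<in> idl x {..<t}" by simp
  then show ?case using p(1,3) w(1,2,4) unfolding add_Suc_right by blast
qed

text \<open>Here \<open>r\<close> annihilates the \<open>(t - 1)\<close>-st Ext of \<open>M\<close> with itself.\<close>
lemma annihilated_trace: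
  assumes r: "\<And>\<phi>. lin (rk (Suc (l + t))) nK \<phi> \<Longrightarrow>
      (\<And>v. v \<in> F (Suc (Suc (l + t))) \<Longrightarrow> dK (\<phi> (d (Suc (Suc (l + t))) v)) = 0) \<Longrightarrow>
      \<exists>\<chi>. lin (rk (l + t)) nK \<chi> \<and> (\<forall>v\<in>F (Suc (l + t)). dK (fsmult r (\<phi> v) - \<chi> (d (Suc (l + t)) v)) = 0)"
    and z: "lin nK (rk (Suc l)) z" "kills z" "\<And>v. v \<in> FK \<Longrightarrow> d (Suc l) (z v) = 0"
    and \<phi>: "lin (rk (Suc l)) nK \<phi>" "\<And>v. v \<in> FK \<Longrightarrow> dK (\<phi> (dK v)) \<in> vecs (idl x {..<t}) (rk (Suc l))"
  shows "r * trace (rk (Suc l)) (\<lambda>v. z (\<phi> v)) \<in> idl x {..<t}"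
proof -
  let ?J = "idl x {..<t}" and ?n = "rk (Suc (l + t))"
  have J: "is_ideal ?J" by (rule Iid[OF subset_refl])
  obtain \<phi>' w where I: "lin ?n nK \<phi>'" "lin nK ?n w" "kills w"
    "\<And>v. v \<in> F (Suc (Suc (l + t))) \<Longrightarrow> dK (\<phi>' (d (Suc (Suc (l + t))) v)) \<in> vecs (idl x {t..<t}) (rk (Suc l))"
    "\<And>v. v \<in> FK \<Longrightarrow> d (Suc (l + t)) (w v) \<in> vecs ?J (rk (l + t))"
    and tr: "trace (rk (Suc l)) (\<lambda>v. z (\<phi> v)) - trace ?n (\<lambda>v. w (\<phi>' v)) \<in> ?J"
    using zigzag[OF z \<phi> order_refl] by auto
  have "dK (\<phi>' (d (Suc (Suc (l + t))) v)) = 0" if "v \<in> F (Suc (Suc (l + t)))" for v using I(4)[OF that] by simp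
  from r[OF I(1) this] obtain \<chi> where \<chi>: "lin (rk (l + t)) nK \<chi>"
    "\<And>v. v \<in> F (Suc (l + t)) \<Longrightarrow> dK (fsmult r (\<phi>' v) - \<chi> (d (Suc (l + t)) v)) = 0" by blast
  have eq: "fsmult r (w (\<phi>' v)) = w (\<chi> (d (Suc (l + t)) v))" if v: "v \<in> F (Suc (l + t))" for v
  proof -
    have a: "\<phi>' v \<in> FK" by (rule linD(1)[OF I(1) v])
    have b: "\<chi> (d (Suc (l + t)) v) \<in> FK" by (rule linD(1)[OF \<chi>(1) d_in[OF v]])
    have "w (fsmult r (\<phi>' v) - \<chi> (d (Suc (l + t)) v)) = 0"
      by (rule killsD[OF I(3) fm_diff[OF fm_smult[OF a] b] \<chi>(2)[OF v]])
    then show ?thesis using a b by (simp add: lin_diff[OF I(2)] linD(3)[OF I(2)])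
  qed
  \<comment> \<open>Up to the kernel of \<open>dK\<close>, on which \<open>w\<close> vanishes, r
    \<phi>' is \<chi> d; commuting under the trace puts d in front of w, where d w vanishes modulo
    x.\<close>
  have "r * trace ?n (\<lambda>v. w (\<phi>' v)) = trace ?n (\<lambda>v. fsmult r (w (\<phi>' v)))" by (simp add: trace_smult)
  also have "\<dots> = trace ?n (\<lambda>v. w (\<chi> (d (Suc (l + t)) v)))" unfolding trace_def by (rule sum.cong) (auto simp: eq)
  also have "\<dots> = trace (rk (l + t)) (\<lambda>v. d (Suc (l + t)) (w (\<chi> v)))"
    by (rule trace_comp_commute[OF hom_comp[OF \<chi>(1) I(2)] dl])
  also have "\<dots> = trace (rk (l + t)) (\<lambda>v. d (Suc (l + t)) (w (\<chi> v))) - trace (rk (l + t)) (\<lambda>v. 0)" by (simp add: trace_def)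
  also have "\<dots> \<in> ?J"
    by (rule trace_diff_ideal[OF J]) (use I(5)[OF linD(1)[OF \<chi>(1)]] in simp)
  finally have "r * trace ?n (\<lambda>v. w (\<phi>' v)) \<in> ?J" .
  from idealD(2)[OF J idealD(3)[OF J tr, of r] this] show ?thesis by (simp add: algebra_simps)
qed

text \<open>Functionals on \<open>M\<close> modulo x lift to R because the higher Ext of
  \<open>M\<close> into R vanishes. The coboundary of \<open>\<alpha>\<close> is \<open>x m\<close>
  times some \<open>\<beta>\<close>, a cocycle of the next degree modulo the earlier elements.
  Lifting \<open>\<beta>\<close> by induction and taking a primitive \<open>\<chi>\<close> corrects
  \<open>\<alpha>\<close> to a cocycle modulo fewer elements, and the induction applies once more;
  hence \<open>j\<close> is generalised.\<close>

lemma cocycle_lift: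
  "m \<le> t \<Longrightarrow> Suc (Suc l) \<le> j \<Longrightarrow> cocyc (idl x {..<m}) rk d j \<alpha> \<Longrightarrow>
    \<exists>\<alpha>'. cocyc {0} rk d j \<alpha>' \<and> \<alpha> - \<alpha>' \<in> vecs (idl x {..<m}) (rk j)"
proof (induction m arbitrary: j \<alpha>)
  case 0
  then show ?case by (intro exI[of _ \<alpha>]) (simp add: zero_fun_def)
next
  case (Suc m)
  let ?J = "idl x {..<m}" and ?t = "transp (rk (Suc j)) (rk j) (d (Suc j))"
  have A: "{..<m} \<subseteq> {..<t}" and m: "m < t" using Suc.prems by auto
  note J = Iid[OF A] and VJ = Vm[OF A]
  have \<alpha>: "\<alpha> \<in> F j" "?t \<alpha> \<in> vecs (adjoin ?J (x m)) (rk (Suc j))"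
    using Suc.prems(3) by (simp_all add: cocyc_def idl_lessThan_Suc)
  obtain \<beta> where \<beta>: "\<beta> \<in> F (Suc j)" "?t \<alpha> - fsmult (x m) \<beta> \<in> vecs ?J (rk (Suc j))"
    using adjoin_vecs[OF J \<alpha>(2)] by blast
  have "dot (rk (Suc j)) \<beta> (d (Suc (Suc j)) v) \<in> ?J" if v: "v \<in> F (Suc (Suc j))" for v
  proof -
    have "dot (rk (Suc j)) (?t \<alpha>) (d (Suc (Suc j)) v) = 0"
      using dot_transp[OF dl d_in[OF v], of \<alpha>] dd0[OF v] by simp
    then have "- (x m * dot (rk (Suc j)) \<beta> (d (Suc (Suc j)) v)) \<in> ?J"
      using dot_vecs_left[OF J \<beta>(2), of "rk (Suc j)" "d (Suc (Suc j)) v"] by (simp add: dot_simps)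
    from idealD(5)[OF J this] show ?thesis using nz[OF A m] by (simp add: nzd_def)
  qed
  then have "cocyc ?J rk d (Suc j) \<beta>"
    using \<beta>(1) cocyc_iff[where rk = rk and d = d and i = "Suc j", OF J dl] by blast
  from Suc.IH[OF less_imp_le[OF m] le_SucI[OF Suc.prems(2)] this]
  obtain \<beta>' where b': "cocyc {0} rk d (Suc j) \<beta>'" "\<beta> - \<beta>' \<in> vecs ?J (rk (Suc j))" by blast
  from dual_exact[OF Suc.prems(2) b'(1)] obtain \<chi> where \<chi>: "\<chi> \<in> F j" "\<beta>' = ?t \<chi>" unfolding cobd_def by auto
  have "?t (\<alpha> - fsmult (x m) \<chi>) = (?t \<alpha> - fsmult (x m) \<beta>) + fsmult (x m) (\<beta> - \<beta>')"
    using \<alpha>(1) \<chi> by (simp add: lin_diff[OF lin_transp] linD(3)[OF lin_transp] fun_eq_iff fsmult_apply algebra_simps)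
  then have "?t (\<alpha> - fsmult (x m) \<chi>) \<in> vecs ?J (rk (Suc j))"
    using is_moduleD(2)[OF VJ \<beta>(2) is_moduleD(4)[OF VJ b'(2)]] by simp
  then have "cocyc ?J rk d j (\<alpha> - fsmult (x m) \<chi>)" unfolding cocyc_def using fm_diff[OF \<alpha>(1) fm_smult[OF \<chi>(1)]] by blast
  from Suc.IH[OF less_imp_le[OF m] Suc.prems(2) this]
  obtain \<alpha>' where a': "cocyc {0} rk d j \<alpha>'" "\<alpha> - fsmult (x m) \<chi> - \<alpha>' \<in> vecs ?J (rk j)" by blast
  have "\<alpha> - \<alpha>' - fsmult (x m) \<chi> \<in> vecs ?J (rk j)" using a'(2) by (simp add: algebra_simps)
  from adjoin_vecsI[OF J \<chi>(1) this] have "\<alpha> - \<alpha>' \<in> vecs (idl x {..<Suc m}) (rk j)" by (simp only: idl_lessThan_Suc)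
  then show ?case using a'(1) by blast
qed

text \<open>Dividing the entries by \<open>x m\<close> gives a map that kills relations only modulo
  the earlier elements. Its rows are cocycles there, and \<open>cocycle_lift\<close> replaces them
  by genuine ones.\<close>

lemma divide_killing_map:
  assumes m: "m < t" and y: "lin nK k y" "kills y" "\<And>v. v \<in> FK \<Longrightarrow> y v \<in> vecs (idl x {..<Suc m}) k"
  shows "\<exists>g. lin nK k g \<and> kills g \<and> (\<forall>v\<in>FK. y v - fsmult (x m) (g v) \<in> vecs (idl x {..<m}) k)"
proof -
  let ?J = "idl x {..<m}" and ?d = "dB"
  have A: "{..<m} \<subseteq> {..<t}" using m by auto
  note J = Iid[OF A] and VJ = Vm[OF A]
  have "\<exists>a. cocyc {0} rk d (Suc (Suc l)) a \<and> transp nK k y (unitv b) - fsmult (x m) a \<in> vecs ?J nK" if b: "b < k" for b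
  proof -
    let ?g = "transp nK k y (unitv b)"
    have gv: "dot nK ?g v = y v b" if "v \<in> FK" for v
      using dot_transp[OF y(1) that, of "unitv b"] b by (simp add: dot_commute[of _ "unitv b"] dot_unitv)
    have "?g \<in> vecs (adjoin ?J (x m)) nK"
      unfolding idl_lessThan_Suc[symmetric]
    proof (rule vecsI_dot[OF idl_ideal])
      fix v :: "nat \<Rightarrow> 'a" assume v: "v \<in> FK"
      show "dot nK ?g v \<in> idl x {..<Suc m}" unfolding gv[OF v] by (rule vecsD[OF y(3)[OF v]])
    qed auto
    from adjoin_vecs[OF J this] obtain a where a: "a \<in> FK" "?g - fsmult (x m) a \<in> vecs ?J nK" by blast
    have "dot nK a (?d v) \<in> ?J" if v: "v \<in> FB" for v
    proof -
      have "dot nK ?g (?d v) = 0" using gv[OF d_in[OF v]] y(2) v by (simp add: kills_def)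
      then have "- (x m * dot nK a (?d v)) \<in> ?J" using dot_vecs_left[OF J a(2), of nK "?d v"] by (simp add: dot_simps)
      from idealD(5)[OF J this] show ?thesis using nz[OF A m] by (simp add: nzd_def)
    qed
    then have "cocyc ?J rk d (Suc (Suc l)) a"
      using a(1) cocyc_iff[where rk = rk and d = d and i = "Suc (Suc l)", OF J dl] by blast
    from cocycle_lift[OF _ order_refl this] m obtain a' where
      a': "cocyc {0} rk d (Suc (Suc l)) a'" "a - a' \<in> vecs ?J nK" by auto
    have eq: "(?g - fsmult (x m) a) + fsmult (x m) (a - a') = ?g - fsmult (x m) a'"
      by (simp add: fun_eq_iff fsmult_apply algebra_simps)
    have "?g - fsmult (x m) a' \<in> vecs ?J nK"
      using is_moduleD(2)[OF VJ a(2) is_moduleD(4)[OF VJ a'(2), of "x m"]] unfolding eq .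
    then show ?thesis using a'(1) by blast
  qed
  then obtain a where a: "\<And>b. b < k \<Longrightarrow> cocyc {0} rk d (Suc (Suc l)) (a b) \<and>
    transp nK k y (unitv b) - fsmult (x m) (a b) \<in> vecs ?J nK" by metis
  define g where "g v = (\<lambda>b. if b < k then dot nK (a b) v else 0)" for v
  have 1: "lin nK k g" by (auto simp: is_hom_def g_def freemod_def fun_eq_iff dot_simps fsmult_apply)
  have 2: "kills g"
    unfolding kills_def
  proof
    fix v assume v: "v \<in> FB"
    have "dot nK (a b) (?d v) = 0" if "b < k" for b
      using a[OF that] cocyc_iff[where rk = rk and d = d and i = "Suc (Suc l)", OF zero_ideal dl] v by blast
    then show "g (?d v) = 0" by (auto simp: g_def)
  qed
  have "y v - fsmult (x m) (g v) \<in> vecs ?J k" if v: "v \<in> FK" for v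
  proof -
    have yv: "y v \<in> freemod k" "g v \<in> freemod k" using linD(1)[OF y(1) v] linD(1)[OF 1 v] by auto
    have "(y v - fsmult (x m) (g v)) b \<in> ?J" for b
    proof (cases "b < k")
      case True
      have "dot nK (transp nK k y (unitv b) - fsmult (x m) (a b)) v \<in> ?J" using a[OF True] dot_vecs_left[OF J] by blast
      moreover have "dot nK (transp nK k y (unitv b)) v = y v b"
        using dot_transp[OF y(1) v, of "unitv b"] True by (simp add: dot_commute[of _ "unitv b"] dot_unitv)
      ultimately show ?thesis using True by (simp add: g_def dot_simps fsmult_apply)
    next
      case False
      then show ?thesis using yv idealD(1)[OF J] by (simp add: freemod_def fsmult_apply)
    qed
    moreover have "y v - fsmult (x m) (g v) \<in> freemod k" by (rule fm_diff[OF yv(1) fm_smult[OF yv(2)]])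
    ultimately show ?thesis unfolding vecs_def by blast
  qed
  then show ?thesis using 1 2 by blast
qed

text \<open>Modulo the earlier elements \<open>y\<close> is \<open>x m\<close> times some
  \<open>g\<close>, and \<open>g\<close> lifts along \<open>dK\<close> to some \<open>\<mu>\<close>.
  Since \<open>g\<close> factors through \<open>M\<close>, composing it with \<open>H m\<close>
  multiplies it by \<open>x m\<close>; so \<mu> composed with \<open>H m\<close> is a lift of
  \<open>y\<close> up to the earlier elements which also kills relations, and the induction treats
  the difference.\<close>

lemma lift_small_map:
  "m \<le> t \<Longrightarrow> lin nK (rk (Suc l)) y \<Longrightarrow> kills y \<Longrightarrow> (\<And>v. v \<in> FK \<Longrightarrow> d (Suc l) (y v) = 0) \<Longrightarrow>
    (\<And>v. v \<in> FK \<Longrightarrow> y v \<in> vecs (idl x {..<m}) (rk (Suc l))) \<Longrightarrow>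
    \<exists>h. lin nK nK h \<and> kills h \<and> (\<forall>v\<in>FK. y v = dK (h v))"
proof (induction m arbitrary: y)
  case 0
  have "y v = dK 0" if "v \<in> FK" for v
    using 0(5)[OF that] lin_zero[OF dl, of "Suc l"] by simp
  then show ?case unfolding kills_def using lin_zero_map by (intro exI[of _ "\<lambda>v. 0"]) blast
next
  case (Suc m)
  let ?J = "idl x {..<m}"
  have A: "{..<m} \<subseteq> {..<t}" and m: "m < t" using Suc.prems by auto
  note J = Iid[OF A] and VJ = Vm[OF A]
  obtain g where g: "lin nK (rk (Suc l)) g" "kills g"
    "\<And>v. v \<in> FK \<Longrightarrow> y v - fsmult (x m) (g v) \<in> vecs ?J (rk (Suc l))"
    using divide_killing_map[OF m Suc.prems(2,3,5)] by blast
  have dg: "d (Suc l) (g v) \<in> vecs ?J (rk l)" if v: "v \<in> FK" for v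
  proof -
    have gv: "g v \<in> F (Suc l)" "y v \<in> F (Suc l)" using linD(1)[OF g(1) v] linD(1)[OF Suc.prems(2) v] by auto
    have "d (Suc l) (y v - fsmult (x m) (g v)) \<in> vecs ?J (rk l)" by (rule lin_vecs[OF J dl g(3)[OF v]])
    moreover have "d (Suc l) (y v - fsmult (x m) (g v)) = d (Suc l) (y v) - fsmult (x m) (d (Suc l) (g v))"
      using gv by (simp add: lin_diff[OF dl] linD(3)[OF dl])
    ultimately have "- fsmult (x m) (d (Suc l) (g v)) \<in> vecs ?J (rk l)"
      unfolding Suc.prems(4)[OF v] diff_0 by simp
    from is_moduleD(3)[OF VJ this] have "fsmult (x m) (d (Suc l) (g v)) \<in> vecs ?J (rk l)" by simp
    then show ?thesis using nzd_vecs[OF nz[OF A m]] d_in[OF gv(1)] by simp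
  qed
  have "\<exists>\<mu>. lin nK nK \<mu> \<and> (\<forall>v\<in>FK. g v - dK (\<mu> v) \<in> vecs ?J (rk (Suc l)))"
  proof (rule free_lift[OF freemod_module VJ g(1) freemod_module dl])
    fix a assume "a < nK"
    then have e: "unitv a \<in> FK" by simp
    have "card {..<m} \<le> l" using card_le[OF A, of 0] by simp
    from exact_mod[OF A this linD(1)[OF g(1) e] dg[OF e]]
    show "\<exists>w\<in>FK. g (unitv a) - dK w \<in> vecs ?J (rk (Suc l))" .
  qed
  then obtain \<mu> where \<mu>: "lin nK nK \<mu>" "\<And>v. v \<in> FK \<Longrightarrow> g v - dK (\<mu> v) \<in> vecs ?J (rk (Suc l))" by blast
  define h where "h v = \<mu> (H m v)" for v
  have hl: "lin nK nK h" unfolding h_def by (rule hom_comp[OF Hlin[OF m] \<mu>(1)])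
  have hk: "kills h" unfolding kills_def h_def using Hkill[OF m] lin_zero[OF \<mu>(1)] by simp
  define y' where "y' v = y v - dK (h v)" for v
  have y'l: "lin nK (rk (Suc l)) y'" unfolding y'_def by (rule hom_sub[OF freemod_module Suc.prems(2) hom_comp[OF hl dl]])
  have y'k: "kills y'" using Suc.prems(3) hk lin_zero[OF dl] by (simp add: kills_def y'_def)
  have y'0: "d (Suc l) (y' v) = 0" if v: "v \<in> FK" for v
  proof -
    have "h v \<in> FK" "y v \<in> F (Suc l)" using linD(1)[OF hl v] linD(1)[OF Suc.prems(2) v] by auto
    then show ?thesis using Suc.prems(4)[OF v] dd0 d_in by (simp add: y'_def lin_diff[OF dl] zero_fun_def)
  qed
  have y'J: "y' v \<in> vecs ?J (rk (Suc l))" if v: "v \<in> FK" for v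
  proof -
    have Hv: "H m v \<in> FK" by (rule linD(1)[OF Hlin[OF m] v])
    have "g (H m v - fsmult (x m) v) = 0"
      by (rule killsD[OF g(2) fm_diff[OF Hv fm_smult[OF v]] Hx[OF m v]])
    then have gH: "g (H m v) = fsmult (x m) (g v)" using v Hv by (simp add: lin_diff[OF g(1)] linD(3)[OF g(1)])
    have "y' v = (y v - fsmult (x m) (g v)) + (g (H m v) - dK (\<mu> (H m v)))"
      by (simp add: y'_def h_def gH)
    then show ?thesis using is_moduleD(2)[OF VJ g(3)[OF v] \<mu>(2)[OF Hv]] by simp
  qed
  obtain h' where h': "lin nK nK h'" "kills h'" "\<And>v. v \<in> FK \<Longrightarrow> y' v = dK (h' v)"
    using Suc.IH[OF _ y'l y'k y'0 y'J] m by auto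
  show ?case
  proof (intro exI[of _ "\<lambda>v. h' v + h v"] conjI ballI)
    show "lin nK nK (\<lambda>v. h' v + h v)" by (rule hom_add[OF freemod_module h'(1) hl])
    show "kills (\<lambda>v. h' v + h v)" using h'(2) hk by (simp add: kills_def)
    fix v assume v: "v \<in> FK"
    have "h v \<in> FK" "h' v \<in> FK" using linD(1)[OF hl v] linD(1)[OF h'(1) v] by auto
    then show "y v = dK (h' v + h v)" using h'(3)[OF v] by (simp add: y'_def linD(2)[OF dl] algebra_simps)
  qed
qed

text \<open>Here \<open>f\<close> represents an endomorphism of \<open>M\<close>, and
  \<open>r\<close> kills Ext of \<open>M\<close> with itself in degree \<open>t - 1\<close>. Trace
  duality only shows that r f factors through a free module modulo x; the error is a map with
  entries in \<open>idl x {..<t}\<close>, and \<open>lift_small_map\<close> factors it as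
  well.\<close>

theorem stable_annihilation:
  assumes r: "\<And>\<phi>. lin (rk (Suc (l + t))) nK \<phi> \<Longrightarrow>
      (\<And>v. v \<in> F (Suc (Suc (l + t))) \<Longrightarrow> dK (\<phi> (d (Suc (Suc (l + t))) v)) = 0) \<Longrightarrow>
      \<exists>\<chi>. lin (rk (l + t)) nK \<chi> \<and> (\<forall>v\<in>F (Suc (l + t)). dK (fsmult r (\<phi> v) - \<chi> (d (Suc (l + t)) v)) = 0)"
    and f: "lin nK nK f" "\<And>v. v \<in> FB \<Longrightarrow> dK (f (dB v)) = 0"
  shows "\<exists>h. lin nK nK h \<and> kills h \<and> (\<forall>v\<in>FK. dK (fsmult r (f v) - h v) = 0)"
proof -
  let ?J = "idl x {..<t}"
  have J: "is_ideal ?J" by (rule Iid[OF subset_refl])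
  note VJ = vecs_module[OF J]
  define z where "z v = dK (f v)" for v
  have z: "lin nK (rk (Suc l)) z" unfolding z_def by (rule hom_comp[OF f(1) dl])
  have zk: "kills z" using f(2) by (simp add: kills_def z_def)
  have z0: "d (Suc l) (z v) = 0" if "v \<in> FK" for v
    unfolding z_def by (rule dd0[OF linD(1)[OF f(1) that]])
  \<comment> \<open>The maps that modulo x agree with one from \<open>M\<close> through its free
    cover; a multiple of \<open>z\<close> outside \<open>S\<close> is told apart from
    \<open>S\<close> by a trace functional.\<close>
  define S where "S = {g. lin nK (rk (Suc l)) g \<and> (\<exists>h. lin nK nK h \<and> kills h \<and>
     (\<forall>v\<in>FK. g v - dK (h v) \<in> vecs ?J (rk (Suc l))))}"
  have rz: "lin nK (rk (Suc l)) (\<lambda>v. fsmult r (z v))" by (rule hom_smult[OF freemod_module z])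
  have "(\<lambda>v. fsmult r (z v)) \<in> S"
  proof (rule ccontr)
    assume no: "(\<lambda>v. fsmult r (z v)) \<notin> S"
    have "\<exists>\<Psi>. lin (rk (Suc l)) nK \<Psi> \<and> (\<forall>g\<in>S. trace (rk (Suc l)) (\<lambda>v. g (\<Psi> v)) \<in> ?J) \<and>
      trace (rk (Suc l)) (\<lambda>v. fsmult r (z (\<Psi> v))) \<notin> ?J"
    proof (rule separating_trace[OF J selfinj socle, where ?f0.0 = "\<lambda>v. fsmult r (z v)" and S = S])
      show "lin nK (rk (Suc l)) g" if "g \<in> S" for g using that by (simp add: S_def)
      show "(\<lambda>v. g v + g' v) \<in> S" if g: "g \<in> S" "g' \<in> S" for g g'
      proof -
        obtain h h' where h: "lin nK nK h" "kills h" "\<And>v. v \<in> FK \<Longrightarrow> g v - dK (h v) \<in> vecs ?J (rk (Suc l))"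
          "lin nK nK h'" "kills h'" "\<And>v. v \<in> FK \<Longrightarrow> g' v - dK (h' v) \<in> vecs ?J (rk (Suc l))"
          using g unfolding S_def by blast
        have "g v + g' v - dK (h v + h' v) \<in> vecs ?J (rk (Suc l))" if v: "v \<in> FK" for v
        proof -
          have eq: "(g v - dK (h v)) + (g' v - dK (h' v)) = g v + g' v - dK (h v + h' v)"
            using linD(1)[OF h(1) v] linD(1)[OF h(4) v] by (simp add: linD(2)[OF dl])
          show ?thesis using is_moduleD(2)[OF VJ h(3)[OF v] h(6)[OF v]] unfolding eq .
        qed
        moreover have "kills (\<lambda>v. h v + h' v)" using h by (simp add: kills_def)
        moreover have "lin nK nK (\<lambda>v. h v + h' v)" by (rule hom_add[OF freemod_module h(1,4)])
        moreover have "lin nK (rk (Suc l)) (\<lambda>v. g v + g' v)" using g by (intro hom_add[OF freemod_module]) (auto simp: S_def)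
        ultimately show ?thesis unfolding S_def by blast
      qed
      show "(\<lambda>v. fsmult a (g v)) \<in> S" if g: "g \<in> S" for a g
      proof -
        obtain h where h: "lin nK nK h" "kills h" "\<And>v. v \<in> FK \<Longrightarrow> g v - dK (h v) \<in> vecs ?J (rk (Suc l))"
          using g unfolding S_def by blast
        have "fsmult a (g v) - dK (fsmult a (h v)) \<in> vecs ?J (rk (Suc l))" if v: "v \<in> FK" for v
        proof -
          have "fsmult a (g v) - dK (fsmult a (h v)) = fsmult a (g v - dK (h v))"
            using linD(1)[OF h(1) v] by (simp add: linD(3)[OF dl] fun_eq_iff fsmult_apply algebra_simps)
          then show ?thesis using is_moduleD(4)[OF VJ h(3)[OF v]] by simp
        qed
        moreover have "kills (\<lambda>v. fsmult a (h v))" using h by (simp add: kills_def)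
        moreover have "lin nK nK (\<lambda>v. fsmult a (h v))" by (rule hom_smult[OF freemod_module h(1)])
        moreover have "lin nK (rk (Suc l)) (\<lambda>v. fsmult a (g v))" using g by (intro hom_smult[OF freemod_module]) (auto simp: S_def)
        ultimately show ?thesis unfolding S_def by blast
      qed
      show "g \<in> S" if g: "lin nK (rk (Suc l)) g" "\<And>v. v \<in> FK \<Longrightarrow> g v \<in> vecs ?J (rk (Suc l))" for g
        unfolding S_def using g lin_zero[OF dl] by (intro CollectI conjI exI[of _ "\<lambda>v. 0"]) (auto simp: kills_def)
      show "lin nK (rk (Suc l)) (\<lambda>v. fsmult r (z v))" by (rule rz)
      show "\<exists>v\<in>FK. g v \<noteq> fsmult r (z v)" if g: "g \<in> S" for g
      proof (rule ccontr)
        assume "\<not> (\<exists>v\<in>FK. g v \<noteq> fsmult r (z v))"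
        then have "(\<lambda>v. fsmult r (z v)) \<in> S" using g rz unfolding S_def by auto
        then show False using no by blast
      qed
    qed
    then obtain \<Psi> where \<Psi>: "lin (rk (Suc l)) nK \<Psi>" "\<And>g. g \<in> S \<Longrightarrow> trace (rk (Suc l)) (\<lambda>v. g (\<Psi> v)) \<in> ?J"
      "trace (rk (Suc l)) (\<lambda>v. fsmult r (z (\<Psi> v))) \<notin> ?J" by blast
    \<comment> \<open>\<open>\<Psi>\<close> is a cocycle modulo x. This comes from testing the
      functional on the rank-one maps sending \<open>v\<close> to
      \<open>fsmult (dK v b) (unitv c)\<close>: they kill relations, so their composites with
      \<open>dK\<close> lie in \<open>S\<close>.\<close>
    have basis: "dK (\<Psi> (dK (unitv c))) \<in> vecs ?J (rk (Suc l))" if c: "c < nK" for c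
    proof -
      have e: "unitv c \<in> FK" using c by simp
      have Y: "dK (\<Psi> (dK (unitv c))) \<in> F (Suc l)" by (intro d_in linD(1)[OF \<Psi>(1)] e)
      have "dK (\<Psi> (dK (unitv c))) b \<in> ?J" for b
      proof (cases "b < rk (Suc l)")
        case False then show ?thesis using Y idealD(1)[OF J] by (simp add: freemod_def)
      next
        case True
        define h where "h v = fsmult (dK v b) (unitv c)" for v
        have hl: "lin nK nK h"
          using linD[OF dl] e by (auto simp: is_hom_def h_def fun_eq_iff fsmult_apply algebra_simps)
        have hk: "kills h" unfolding kills_def h_def using dd0 by simp
        have "(\<lambda>v. dK (h v)) \<in> S" unfolding S_def using hl hk hom_comp[OF hl dl] is_moduleD(1)[OF VJ]
          by (intro CollectI conjI exI[of _ h]) auto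
        then have "trace (rk (Suc l)) (\<lambda>v. dK (h (\<Psi> v))) \<in> ?J" by (rule \<Psi>(2))
        also have "trace (rk (Suc l)) (\<lambda>v. dK (h (\<Psi> v))) = trace nK (\<lambda>v. h (\<Psi> (dK v)))"
          by (rule trace_comp_commute[OF dl hom_comp[OF \<Psi>(1) hl]])
        also have "\<dots> = dK (\<Psi> (dK (unitv c))) b"
          using c by (simp add: trace_def h_def fsmult_apply unitv_apply if_distrib cong: if_cong)
        finally show ?thesis .
      qed
      then show ?thesis using Y unfolding vecs_def by blast
    qed
    have "dK (\<Psi> (dK v)) \<in> vecs ?J (rk (Suc l))" if v: "v \<in> FK" for v
      by (rule hom_into_submodule[OF hom_comp[OF hom_comp[OF dl \<Psi>(1)] dl] VJ basis v])
    from annihilated_trace[OF r z zk z0 \<Psi>(1) this] show False using \<Psi>(3) by (simp add: trace_smult)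
  qed
  then obtain h where h: "lin nK nK h" "kills h"
    "\<And>v. v \<in> FK \<Longrightarrow> fsmult r (z v) - dK (h v) \<in> vecs ?J (rk (Suc l))"
    unfolding S_def by blast
  define y where "y v = fsmult r (z v) - dK (h v)" for v
  have y: "lin nK (rk (Suc l)) y" unfolding y_def by (rule hom_sub[OF freemod_module rz hom_comp[OF h(1) dl]])
  have yk: "kills y" using zk h(2) lin_zero[OF dl] by (simp add: kills_def y_def)
  have y0: "d (Suc l) (y v) = 0" if v: "v \<in> FK" for v
    using z0[OF v] dd0[OF linD(1)[OF h(1) v]] linD(1)[OF z v] d_in[OF linD(1)[OF h(1) v]]
    by (simp add: y_def lin_diff[OF dl] linD(3)[OF dl])
  have yJ: "y v \<in> vecs ?J (rk (Suc l))" if "v \<in> FK" for v unfolding y_def by (rule h(3)[OF that])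
  obtain h' where h': "lin nK nK h'" "kills h'" "\<And>v. v \<in> FK \<Longrightarrow> y v = dK (h' v)"
    using lift_small_map[OF order_refl y yk y0 yJ] by blast
  show ?thesis
  proof (intro exI[of _ "\<lambda>v. h' v + h v"] conjI ballI)
    show "lin nK nK (\<lambda>v. h' v + h v)" by (rule hom_add[OF freemod_module h'(1) h(1)])
    show "kills (\<lambda>v. h' v + h v)" using h'(2) h(2) by (simp add: kills_def)
    fix v assume v: "v \<in> FK"
    have m: "h v \<in> FK" "h' v \<in> FK" "f v \<in> FK"
      using linD(1)[OF h(1) v] linD(1)[OF h'(1) v] linD(1)[OF f(1) v] by auto
    have "dK (fsmult r (f v) - (h' v + h v)) = fsmult r (z v) - (dK (h' v) + dK (h v))"
      using m by (simp add: lin_diff[OF dl] linD(2,3)[OF dl] z_def)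
    also have "\<dots> = 0" using h'(3)[OF v] by (simp add: y_def algebra_simps)
    finally show "dK (fsmult r (f v) - (h' v + h v)) = 0" .
  qed
qed

end

section \<open>The stable annihilator and free resolutions\<close>

lemma noetherian_local_noeth:
  assumes N: "noetherian_ring TYPE('a::comm_ring_1)" and L: "local_ring TYPE('a)"
  shows "local_noeth (max_ideal TYPE('a) :: 'a set)"
proof -
  have R: "noethmod (UNIV :: 'a set) (*)" by (rule noetherian_ring_noethmod[OF N])
  have ex: "\<exists>!m::'a set. maximal_ideal m" using L by (simp add: local_ring_def)
  let ?m = "max_ideal TYPE('a) :: 'a set"
  have m: "maximal_ideal ?m" unfolding max_ideal_def by (rule theI'[OF ex])
  have uniq: "M = ?m" if "maximal_ideal M" for M :: "'a set" using ex m that by blast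
  show ?thesis
  proof
    show "noethmod (UNIV :: 'a set) (*)" by (rule R)
    show "is_ideal ?m" "1 \<notin> ?m" using m by (auto simp: maximal_ideal_def)
    fix a :: 'a assume a: "a \<notin> ?m"
    let ?K = "adjoin {0} a"
    have K: "is_ideal ?K" by (rule adjoin_ideal[OF zero_ideal])
    have "1 \<in> ?K"
    proof (rule ccontr)
      assume n1: "1 \<notin> ?K"
      obtain M where M: "is_ideal M \<and> 1 \<notin> M \<and> ?K \<subseteq> M"
        "\<forall>N. is_ideal N \<and> 1 \<notin> N \<and> ?K \<subseteq> N \<longrightarrow> M \<subseteq> N \<longrightarrow> N = M"
        by (rule ideals_maximal[OF R, of "\<lambda>M. is_ideal M \<and> 1 \<notin> M \<and> ?K \<subseteq> M" ?K]) (use K n1 in auto)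
      have "maximal_ideal M"
        unfolding maximal_ideal_def using M by blast
      then have "M = ?m" by (rule uniq)
      moreover have "a \<in> ?K" using adjoin_mem[OF zero_ideal, of a 1] by simp
      ultimately show False using M(1) a by blast
    qed
    then show "\<exists>b. a * b = 1" unfolding adjoin_def by auto
  qed
qed

lemma free_res_exists:
  assumes R: "noethmod (UNIV :: 'a::comm_ring_1 set) (*)" and M: "is_module M (s :: 'a \<Rightarrow> 'm::ab_group_add \<Rightarrow> 'm)" "fin_gen M s"
  shows "\<exists>rk d eps. free_res M s rk d eps"
proof -
  obtain q eps where e: "is_hom (freemod q) fsmult M s eps" "eps ` freemod q = M"
    using fin_gen_coverable[OF M] unfolding coverable_def by blast
  have Z: "is_module {0} s"
    by (rule is_module_subset[OF M(1)]) (auto simp: is_moduleD(1)[OF M(1)] module_smult_zero_right[OF M(1)])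
  let ?K = "{v \<in> freemod q. eps v \<in> {0}}"
  have K: "is_module ?K fsmult" by (rule hom_vimage_module[OF freemod_module M(1) e(1) Z])
  have sub: "?K \<subseteq> freemod q" by blast
  obtain p g where g: "is_hom (freemod p) fsmult ?K fsmult g" "g ` freemod p = ?K"
    by (rule noethmod_cover[OF noethmod_freemod[OF R] sub K])
  have gl: "lin p q g" using g(1) unfolding is_hom_def by blast
  obtain rk d where D: "acyc {0} rk d" "rk 0 = q" "rk (Suc 0) = p" "d (Suc 0) = g"
    using resolution_exists[OF R zero_ideal gl] by blast
  have "free_res M s rk d eps"
    unfolding free_res_def acyclic_free_cx_iff using D e g(2) by simp
  then show ?thesis by blast
qed

locale resolved_module =
  fixes M :: "'m::ab_group_add set" and s :: "'a::comm_ring_1 \<Rightarrow> 'm \<Rightarrow> 'm"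
    and rk :: "nat \<Rightarrow> nat" and d :: "nat \<Rightarrow> (nat \<Rightarrow> 'a) \<Rightarrow> (nat \<Rightarrow> 'a)" and eps :: "(nat \<Rightarrow> 'a) \<Rightarrow> 'm"
  assumes M: "is_module M s" and res: "free_res M s rk d eps"
begin

lemma D: "acyc {0} rk d" using res by (simp add: free_res_def acyclic_free_cx_iff)
lemma eps_hom: "is_hom (freemod (rk 0)) fsmult M s eps" using res by (simp add: free_res_def)
lemma eps_surj: "eps ` freemod (rk 0) = M" using res by (simp add: free_res_def)
lemma ker_eps: "d (Suc 0) ` freemod (rk (Suc 0)) = {v \<in> freemod (rk 0). eps v = 0}"
  using res by (simp add: free_res_def)

lemma eps_d: "v \<in> freemod (rk (Suc 0)) \<Longrightarrow> eps (d (Suc 0) v) = 0" using ker_eps by blast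

lemma eps_lift:
  assumes "is_hom (freemod n) fsmult M s f"
  shows "\<exists>g. lin n (rk 0) g \<and> (\<forall>v\<in>freemod n. eps (g v) = f v)"
proof -
  have Z: "is_module {0} s"
    by (rule is_module_subset[OF M]) (auto simp: is_moduleD(1)[OF M] module_smult_zero_right[OF M])
  have "\<exists>g. lin n (rk 0) g \<and> (\<forall>v\<in>freemod n. f v - eps (g v) \<in> {0})"
  proof (rule free_lift[OF M Z assms freemod_module eps_hom])
    fix a assume "a < n"
    then have "f (unitv a) \<in> eps ` freemod (rk 0)" unfolding eps_surj by (intro is_homD(1)[OF assms]) simp
    then show "\<exists>w\<in>freemod (rk 0). f (unitv a) - eps w \<in> {0}" by auto
  qed
  then show ?thesis by auto
qed

text \<open>Scalars whose multiplication on \<open>M\<close> factors through a free module; the factorisation is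
  recorded on the presenting free module.\<close>
definition sann :: "'a set" where
  "sann = {r. \<exists>H. lin (rk 0) (rk 0) H \<and> (\<forall>v\<in>freemod (rk (Suc 0)). H (d (Suc 0) v) = 0) \<and>
     (\<forall>v\<in>freemod (rk 0). eps (H v) = s r (eps v))}"

text \<open>Only the identity endomorphism is tested; its factorisation is then lifted to the free
  module covering \<open>M\<close>.\<close>

lemma stable_ann_sann: assumes "r \<in> stable_ann M s" shows "r \<in> sann"
proof -
  have "is_hom M s M s (\<lambda>x. x)" by (simp add: is_hom_def)
  then have "factors_free M s M s (\<lambda>x. s r x)" using assms by (simp add: stable_ann_def)
  then obtain n h k where hk: "is_hom M s (freemod n) fsmult h" "is_hom (freemod n) fsmult M s k"
    "\<forall>x\<in>M. s r x = k (h x)" unfolding factors_free_def by blast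
  obtain \<kappa> where \<kappa>: "lin n (rk 0) \<kappa>" "\<forall>v\<in>freemod n. eps (\<kappa> v) = k v" using eps_lift[OF hk(2)] by blast
  let ?H = "\<lambda>v. \<kappa> (h (eps v))"
  have "lin (rk 0) (rk 0) ?H" by (rule hom_comp[OF hom_comp[OF eps_hom hk(1)] \<kappa>(1)])
  moreover have "?H (d (Suc 0) v) = 0" if "v \<in> freemod (rk (Suc 0))" for v
    using eps_d[OF that] hom_zero[OF M hk(1)] lin_zero[OF \<kappa>(1)] by simp
  moreover have "eps (?H v) = s r (eps v)" if "v \<in> freemod (rk 0)" for v
    using \<kappa>(2) hk(3) is_homD(1)[OF hk(1)] is_homD(1)[OF eps_hom that] by simp
  ultimately show ?thesis unfolding sann_def by blast
qed

text \<open>The homotopy identity \<open>r = d \<sigma>' + \<sigma> d\<close> in positive degrees, stated without naming \<open>\<sigma>'\<close>.\<close>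
lemma homotopy:
  assumes "r \<in> sann"
  shows "\<exists>\<sigma>. lin (rk j) (rk (Suc j)) \<sigma> \<and> (\<forall>v\<in>freemod (rk (Suc j)). d (Suc j) (fsmult r v - \<sigma> (d (Suc j) v)) = 0)"
proof (induction j)
  case 0
  obtain H where H: "lin (rk 0) (rk 0) H" "\<forall>v\<in>freemod (rk (Suc 0)). H (d (Suc 0) v) = 0"
    "\<forall>v\<in>freemod (rk 0). eps (H v) = s r (eps v)" using assms unfolding sann_def by blast
  have f: "lin (rk 0) (rk 0) (\<lambda>v. fsmult r v - H v)" by (rule hom_sub[OF freemod_module lin_fsmult H(1)])
  have "\<exists>\<sigma>. lin (rk 0) (rk (Suc 0)) \<sigma> \<and> (\<forall>v\<in>freemod (rk 0). (fsmult r v - H v) - d (Suc 0) (\<sigma> v) \<in> vecs {0} (rk 0))"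
  proof (rule free_lift[OF freemod_module vecs_module[OF zero_ideal] f freemod_module acycD(1)[OF D]])
    fix a assume "a < rk 0"
    then have e: "unitv a \<in> freemod (rk 0)" by simp
    let ?y = "fsmult r (unitv a) - H (unitv a)"
    have y: "?y \<in> freemod (rk 0)" using linD(1)[OF f e] .
    have "eps ?y = eps (fsmult r (unitv a)) - eps (H (unitv a))"
      by (rule hom_diff[OF freemod_module eps_hom fm_smult[OF e] linD(1)[OF H(1) e]])
    then have "eps ?y = 0" unfolding is_homD(3)[OF eps_hom e] bspec[OF H(3) e] by simp
    then have "?y \<in> d (Suc 0) ` freemod (rk (Suc 0))" unfolding ker_eps using y by blast
    then show "\<exists>w\<in>freemod (rk (Suc 0)). ?y - d (Suc 0) w \<in> vecs {0} (rk 0)" by auto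
  qed
  then obtain \<sigma> where \<sigma>: "lin (rk 0) (rk (Suc 0)) \<sigma>" "\<And>v. v \<in> freemod (rk 0) \<Longrightarrow> d (Suc 0) (\<sigma> v) = fsmult r v - H v" by auto
  have "d (Suc 0) (fsmult r v - \<sigma> (d (Suc 0) v)) = 0" if v: "v \<in> freemod (rk (Suc 0))" for v
  proof -
    have dv: "d (Suc 0) v \<in> freemod (rk 0)" by (rule linD(1)[OF acycD(1)[OF D] v])
    have "d (Suc 0) (fsmult r v - \<sigma> (d (Suc 0) v)) = fsmult r (d (Suc 0) v) - d (Suc 0) (\<sigma> (d (Suc 0) v))"
      using v linD(1)[OF \<sigma>(1) dv] by (simp add: lin_diff[OF acycD(1)[OF D]] linD(3)[OF acycD(1)[OF D]])
    then show ?thesis using \<sigma>(2)[OF dv] H(2) v by simp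
  qed
  then show ?case using \<sigma>(1) by blast
next
  case (Suc j)
  let ?d1 = "d (Suc j)" and ?d2 = "d (Suc (Suc j))"
  obtain \<sigma> where \<sigma>: "lin (rk j) (rk (Suc j)) \<sigma>"
    "\<And>v. v \<in> freemod (rk (Suc j)) \<Longrightarrow> ?d1 (fsmult r v - \<sigma> (?d1 v)) = 0" using Suc by blast
  note l1 = acycD(1)[OF D, of j] and l2 = acycD(1)[OF D, of "Suc j"]
  have f: "lin (rk (Suc j)) (rk (Suc j)) (\<lambda>v. fsmult r v - \<sigma> (?d1 v))"
    by (rule hom_sub[OF freemod_module lin_fsmult hom_comp[OF l1 \<sigma>(1)]])
  have "\<exists>\<tau>. lin (rk (Suc j)) (rk (Suc (Suc j))) \<tau> \<and>
    (\<forall>v\<in>freemod (rk (Suc j)). (fsmult r v - \<sigma> (?d1 v)) - ?d2 (\<tau> v) \<in> vecs {0} (rk (Suc j)))"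
  proof (rule free_lift[OF freemod_module vecs_module[OF zero_ideal] f freemod_module l2])
    fix a assume "a < rk (Suc j)"
    then have e: "unitv a \<in> freemod (rk (Suc j))" by simp
    have "?d1 (fsmult r (unitv a) - \<sigma> (?d1 (unitv a))) \<in> vecs {0} (rk j)" unfolding \<sigma>(2)[OF e] by simp
    from acycD(3)[OF D linD(1)[OF f e] this]
    show "\<exists>w\<in>freemod (rk (Suc (Suc j))). fsmult r (unitv a) - \<sigma> (?d1 (unitv a)) - ?d2 w \<in> vecs {0} (rk (Suc j))" .
  qed
  then obtain \<tau> where \<tau>: "lin (rk (Suc j)) (rk (Suc (Suc j))) \<tau>"
    "\<And>v. v \<in> freemod (rk (Suc j)) \<Longrightarrow> ?d2 (\<tau> v) = fsmult r v - \<sigma> (?d1 v)" by auto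
  have "?d2 (fsmult r v - \<tau> (?d2 v)) = 0" if v: "v \<in> freemod (rk (Suc (Suc j)))" for v
  proof -
    have dv: "?d2 v \<in> freemod (rk (Suc j))" by (rule linD(1)[OF l2 v])
    have "?d1 (?d2 v) = 0" using acycD(2)[OF D v] by simp
    then have 1: "?d2 (\<tau> (?d2 v)) = fsmult r (?d2 v)" using \<tau>(2)[OF dv] lin_zero[OF \<sigma>(1)] by simp
    have "?d2 (fsmult r v - \<tau> (?d2 v)) = fsmult r (?d2 v) - ?d2 (\<tau> (?d2 v))"
      using v linD(1)[OF \<tau>(1) dv] by (simp add: lin_diff[OF l2] linD(3)[OF l2])
    then show ?thesis using 1 by simp
  qed
  then show ?case using \<tau>(1) by blast
qed

text \<open>By the homotopy, r v - \<sigma> (d v) is a cycle, hence a boundary, and the cocycle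
  \<open>f\<close> vanishes on it; so r f is the coboundary of f \<sigma>.\<close>

lemma sann_ext_ann:
  assumes "r \<in> sann" shows "r \<in> cx_ext_ann rk d N t j"
  unfolding cx_ext_ann_def
proof (intro CollectI allI impI, elim conjE)
  fix f assume f: "is_hom (freemod (rk (Suc j))) fsmult N t f"
    "\<forall>x\<in>freemod (rk (Suc (Suc j))). f (d (Suc (Suc j)) x) = 0"
  obtain \<sigma> where \<sigma>: "lin (rk j) (rk (Suc j)) \<sigma>"
    "\<And>v. v \<in> freemod (rk (Suc j)) \<Longrightarrow> d (Suc j) (fsmult r v - \<sigma> (d (Suc j) v)) = 0" using homotopy[OF assms] by blast
  have "t r (f v) = f (\<sigma> (d (Suc j) v))" if v: "v \<in> freemod (rk (Suc j))" for v
  proof -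
    let ?p = "fsmult r v - \<sigma> (d (Suc j) v)"
    have q: "\<sigma> (d (Suc j) v) \<in> freemod (rk (Suc j))" by (rule linD(1)[OF \<sigma>(1) linD(1)[OF acycD(1)[OF D] v]])
    have p: "?p \<in> freemod (rk (Suc j))" by (rule fm_diff[OF fm_smult[OF v] q])
    have "d (Suc j) ?p \<in> vecs {0} (rk j)" unfolding \<sigma>(2)[OF v] by simp
    from acycD(3)[OF D p this] obtain w where w: "w \<in> freemod (rk (Suc (Suc j)))" "?p - d (Suc (Suc j)) w = 0"
      unfolding vecs_zero singleton_iff by blast
    have "?p = d (Suc (Suc j)) w" using w(2) unfolding right_minus_eq .
    then have "f ?p = 0" using f(2) w(1) by metis
    moreover have "f (?p + \<sigma> (d (Suc j) v)) = f ?p + f (\<sigma> (d (Suc j) v))" by (rule is_homD(2)[OF f(1) p q])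
    ultimately have "f (fsmult r v) = f (\<sigma> (d (Suc j) v))" by simp
    then show ?thesis using is_homD(3)[OF f(1) v] by simp
  qed
  then show "\<exists>g. is_hom (freemod (rk j)) fsmult N t g \<and> (\<forall>x\<in>freemod (rk (Suc j)). t r (f x) = g (d (Suc j) x))"
    using hom_comp[OF \<sigma>(1) f(1)] by blast
qed

text \<open>A cocycle with values in \<open>M\<close> is padded by 0 in the ring component and the
  primitive is projected back to \<open>M\<close>. The index \<open>j\<close> stands for Ext in
  degree \<open>j + 1\<close>.\<close>

lemma AR_ann_lift:
  assumes r: "r \<in> AR_ann M s" and \<phi>: "lin (rk (Suc j)) (rk 0) \<phi>"
    "\<And>v. v \<in> freemod (rk (Suc (Suc j))) \<Longrightarrow> eps (\<phi> (d (Suc (Suc j)) v)) = 0"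
  shows "\<exists>\<chi>. lin (rk j) (rk 0) \<chi> \<and> (\<forall>v\<in>freemod (rk (Suc j)). eps (fsmult r (\<phi> v) - \<chi> (d (Suc j) v)) = 0)"
proof -
  let ?N = "M \<times> (UNIV :: 'a set)"
  have rx: "r \<in> cx_ext_ann rk d ?N (sum_smult s) j"
    using r res unfolding AR_ann_def ext_ann_def by blast
  let ?f = "\<lambda>v. (eps (\<phi> v), 0 :: 'a)"
  have e\<phi>: "is_hom (freemod (rk (Suc j))) fsmult M s (\<lambda>v. eps (\<phi> v))" by (rule hom_comp[OF \<phi>(1) eps_hom])
  have "is_hom (freemod (rk (Suc j))) fsmult ?N (sum_smult s) ?f"
    using e\<phi> unfolding is_hom_def by (auto simp: sum_smult_def)
  moreover have "\<forall>v\<in>freemod (rk (Suc (Suc j))). ?f (d (Suc (Suc j)) v) = 0" using \<phi>(2) by (simp add: zero_prod_def)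
  ultimately obtain g where g: "is_hom (freemod (rk j)) fsmult ?N (sum_smult s) g"
    "\<forall>v\<in>freemod (rk (Suc j)). sum_smult s r (?f v) = g (d (Suc j) v)"
    using rx unfolding cx_ext_ann_def by blast
  have "is_hom (freemod (rk j)) fsmult M s (\<lambda>v. fst (g v))"
    using g(1) unfolding is_hom_def by (auto simp: sum_smult_def mem_Times_iff)
  from eps_lift[OF this] obtain \<chi> where \<chi>: "lin (rk j) (rk 0) \<chi>" "\<forall>v\<in>freemod (rk j). eps (\<chi> v) = fst (g v)" by blast
  have "eps (fsmult r (\<phi> v) - \<chi> (d (Suc j) v)) = 0" if v: "v \<in> freemod (rk (Suc j))" for v
  proof -
    have dv: "d (Suc j) v \<in> freemod (rk j)" by (rule linD(1)[OF acycD(1)[OF D] v])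
    have "eps (fsmult r (\<phi> v) - \<chi> (d (Suc j) v)) = s r (eps (\<phi> v)) - eps (\<chi> (d (Suc j) v))"
      using linD(1)[OF \<phi>(1) v] linD(1)[OF \<chi>(1) dv]
      by (simp add: hom_diff[OF freemod_module eps_hom] is_homD(3)[OF eps_hom])
    moreover have "fst (g (d (Suc j) v)) = s r (eps (\<phi> v))"
      using g(2) v by (metis (no_types, lifting) fst_conv sum_smult_def)
    ultimately show ?thesis using \<chi>(2) dv by simp
  qed
  then show ?thesis using \<chi>(1) by blast
qed

text \<open>\<open>h\<close> kills the relations, so its composite with a set-theoretic section of
  \<open>eps\<close> does not depend on the section and is linear on \<open>M\<close>.\<close>

lemma factors_freeI:
  assumes h: "lin (rk 0) (rk 0) h" "\<And>v. v \<in> freemod (rk (Suc 0)) \<Longrightarrow> h (d (Suc 0) v) = 0"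
    "\<And>v. v \<in> freemod (rk 0) \<Longrightarrow> eps (h v) = g (eps v)"
  shows "factors_free M s M s g"
proof -
  have wd: "h v = h w" if vw: "v \<in> freemod (rk 0)" "w \<in> freemod (rk 0)" "eps v = eps w" for v w
  proof -
    have "eps (v - w) = 0" using vw by (simp add: hom_diff[OF freemod_module eps_hom])
    then have "v - w \<in> d (Suc 0) ` freemod (rk (Suc 0))" unfolding ker_eps using fm_diff[OF vw(1,2)] by blast
    then obtain b where "b \<in> freemod (rk (Suc 0))" "v - w = d (Suc 0) b" by (rule imageE)
    then have "h (v - w) = 0" using h(2) by metis
    then show ?thesis using vw by (simp add: lin_diff[OF h(1)])
  qed
  define p where "p m = (SOME v. v \<in> freemod (rk 0) \<and> eps v = m)" for m
  have p: "p m \<in> freemod (rk 0) \<and> eps (p m) = m" if m: "m \<in> M" for m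
  proof -
    have "m \<in> eps ` freemod (rk 0)" using m eps_surj by simp
    then have "\<exists>v. v \<in> freemod (rk 0) \<and> eps v = m" by blast
    then show ?thesis unfolding p_def by (rule someI_ex)
  qed
  have 1: "is_hom M s (freemod (rk 0)) fsmult (\<lambda>m. h (p m))"
    unfolding is_hom_def
  proof (intro conjI ballI allI)
    fix m assume m: "m \<in> M"
    show "h (p m) \<in> freemod (rk 0)" using p[OF m] linD(1)[OF h(1)] by blast
    fix a
    have "h (p (s a m)) = h (fsmult a (p m))"
      by (rule wd) (use p[OF m] p[OF is_moduleD(4)[OF M m]] in \<open>auto simp: is_homD(3)[OF eps_hom]\<close>)
    then show "h (p (s a m)) = fsmult a (h (p m))" using linD(3)[OF h(1)] p[OF m] by simp
  next
    fix m m' assume m: "m \<in> M" "m' \<in> M"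
    have "h (p (m + m')) = h (p m + p m')"
      by (rule wd) (use p[OF m(1)] p[OF m(2)] p[OF is_moduleD(2)[OF M m]] in \<open>auto simp: is_homD(2)[OF eps_hom]\<close>)
    then show "h (p (m + m')) = h (p m) + h (p m')" using linD(2)[OF h(1)] p[OF m(1)] p[OF m(2)] by simp
  qed
  have "\<forall>m\<in>M. g m = eps (h (p m))" using h(3) p by simp
  then show ?thesis unfolding factors_free_def using 1 eps_hom by blast
qed

lemma sann_ideal: "is_ideal sann"
  unfolding is_ideal_def
proof (intro conjI ballI allI)
  have "eps 0 = s 0 (eps v)" if "v \<in> freemod (rk 0)" for v
    using hom_zero[OF freemod_module eps_hom] module_smult_zero_left[OF M is_homD(1)[OF eps_hom that]] by simp
  then show "0 \<in> sann" unfolding sann_def using lin_zero_map by (intro CollectI exI[of _ "\<lambda>v. 0"]) blast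
next
  fix a b assume "a \<in> sann" "b \<in> sann"
  then obtain G H where G: "lin (rk 0) (rk 0) G" "\<forall>v\<in>freemod (rk (Suc 0)). G (d (Suc 0) v) = 0" "\<forall>v\<in>freemod (rk 0). eps (G v) = s a (eps v)"
    and H: "lin (rk 0) (rk 0) H" "\<forall>v\<in>freemod (rk (Suc 0)). H (d (Suc 0) v) = 0" "\<forall>v\<in>freemod (rk 0). eps (H v) = s b (eps v)"
    unfolding sann_def by blast
  have "lin (rk 0) (rk 0) (\<lambda>v. G v + H v)" by (rule hom_add[OF freemod_module G(1) H(1)])
  moreover have "eps (G v + H v) = s (a + b) (eps v)" if v: "v \<in> freemod (rk 0)" for v
    using is_homD(2)[OF eps_hom linD(1)[OF G(1) v] linD(1)[OF H(1) v]] G(3) H(3) v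
      is_moduleD(5)[OF M is_homD(1)[OF eps_hom v], of a b] by simp
  ultimately show "a + b \<in> sann" unfolding sann_def using G(2) H(2) by (intro CollectI exI[of _ "\<lambda>v. G v + H v"]) simp
next
  fix c a assume "a \<in> sann"
  then obtain G where G: "lin (rk 0) (rk 0) G" "\<forall>v\<in>freemod (rk (Suc 0)). G (d (Suc 0) v) = 0" "\<forall>v\<in>freemod (rk 0). eps (G v) = s a (eps v)"
    unfolding sann_def by blast
  have "lin (rk 0) (rk 0) (\<lambda>v. fsmult c (G v))" by (rule hom_smult[OF freemod_module G(1)])
  moreover have "eps (fsmult c (G v)) = s (c * a) (eps v)" if v: "v \<in> freemod (rk 0)" for v
    using is_homD(3)[OF eps_hom linD(1)[OF G(1) v], of c] G(3) v
      is_moduleD(7)[OF M is_homD(1)[OF eps_hom v], of c a] by simp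
  ultimately show "c * a \<in> sann" unfolding sann_def using G(2) by (intro CollectI exI[of _ "\<lambda>v. fsmult c (G v)"]) simp
qed

text \<open>The hypothesis makes \<open>M\<close> a direct summand of a free module, through which
  every endomorphism then factors.\<close>

lemma sann_one_stable: assumes "1 \<in> sann" shows "r \<in> stable_ann M s"
  unfolding stable_ann_def
proof (intro CollectI allI impI)
  fix f assume f: "is_hom M s M s f"
  obtain H where H: "lin (rk 0) (rk 0) H" "\<forall>v\<in>freemod (rk (Suc 0)). H (d (Suc 0) v) = 0" "\<forall>v\<in>freemod (rk 0). eps (H v) = s 1 (eps v)"
    using assms unfolding sann_def by blast
  obtain g where g: "lin (rk 0) (rk 0) g" "\<forall>v\<in>freemod (rk 0). eps (g v) = f (eps v)"
    using eps_lift[OF hom_comp[OF eps_hom f]] by blast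
  show "factors_free M s M s (\<lambda>x. s r (f x))"
  proof (rule factors_freeI[of "\<lambda>v. fsmult r (g (H v))"])
    show "lin (rk 0) (rk 0) (\<lambda>v. fsmult r (g (H v)))" by (rule hom_smult[OF freemod_module hom_comp[OF H(1) g(1)]])
    show "fsmult r (g (H (d (Suc 0) v))) = 0" if "v \<in> freemod (rk (Suc 0))" for v
      using H(2) that lin_zero[OF g(1)] by simp
    show "eps (fsmult r (g (H v))) = s r (f (eps v))" if v: "v \<in> freemod (rk 0)" for v
      using is_homD(3)[OF eps_hom linD(1)[OF g(1) linD(1)[OF H(1) v]]] g(2) linD(1)[OF H(1) v] H(3) v
        is_moduleD(8)[OF M is_homD(1)[OF eps_hom v]] by simp
  qed
qed

text \<open>A common denominator turns a basis of the localisation at \<open>p\<close> into a factorisation of some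
  scalar outside \<open>p\<close> through a free module.\<close>
lemma free_at_sann:
  assumes p: "prime_ideal p" and fr: "free_at M s p"
  shows "\<exists>r\<in>sann. r \<notin> p"
proof -
  obtain xs where xs: "set xs \<subseteq> M"
    "\<forall>y\<in>M. \<exists>as u w. length as = length xs \<and> u \<notin> p \<and> w \<notin> p
            \<and> s w (s u y - (\<Sum>j<length xs. s (as ! j) (xs ! j))) = 0"
    "\<And>as. length as = length xs \<Longrightarrow> (\<exists>w. w \<notin> p \<and> s w (\<Sum>j<length xs. s (as ! j) (xs ! j)) = 0) \<Longrightarrow>
            (\<forall>j<length xs. \<exists>w. w \<notin> p \<and> w * as ! j = 0)"
    using fr unfolding free_at_def by blast
  let ?k = "length xs" and ?E = "comb (length xs) s (\<lambda>j. xs ! j)"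
  have xM: "xs ! j \<in> M" if "j < ?k" for j using xs(1) that by auto
  have E: "is_hom (freemod ?k) fsmult M s ?E" by (rule comb_hom[OF M xM])
  have pm: "a * b \<notin> p" if "a \<notin> p" "b \<notin> p" for a b using p that unfolding prime_ideal_def by blast
  have "\<exists>U c. U \<notin> p \<and> c \<in> freemod ?k \<and> s U y = ?E c" if y: "y \<in> M" for y
  proof -
    obtain as u w where au: "length as = ?k" "u \<notin> p" "w \<notin> p"
      "s w (s u y - (\<Sum>j<?k. s (as ! j) (xs ! j))) = 0" using xs(2) y by blast
    define c where "c = (\<lambda>j. if j < ?k then as ! j else 0)"
    have c: "c \<in> freemod ?k" by (simp add: c_def freemod_def)
    have Ec: "?E c = (\<Sum>j<?k. s (as ! j) (xs ! j))" by (simp add: comb_def c_def)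
    have uy: "s u y \<in> M" by (rule is_moduleD(4)[OF M y])
    have "s w (s u y) - s w (?E c) = 0"
      using au(4) module_smult_diff_right[OF M uy is_homD(1)[OF E c], of w] by (simp add: Ec)
    then have "s (w * u) y = ?E (fsmult w c)"
      using is_moduleD(7)[OF M y, of w u] is_homD(3)[OF E c, of w] by simp
    then show ?thesis using pm[OF au(3,2)] fm_smult[OF c] by blast
  qed
  then have "\<forall>a. \<exists>U c. a < rk 0 \<longrightarrow> U \<notin> p \<and> c \<in> freemod ?k \<and> s U (eps (unitv a)) = ?E c"
    using is_homD(1)[OF eps_hom unitv_in] by blast
  then obtain U c where Uc: "\<And>a. a < rk 0 \<Longrightarrow> U a \<notin> p \<and> c a \<in> freemod ?k \<and> s (U a) (eps (unitv a)) = ?E (c a)"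
    by metis
  \<comment> \<open>\<open>V\<close> is a common denominator: it carries all of \<open>M\<close>
    into the span of the chosen elements \<open>xs\<close>, and \<open>W a\<close> is its cofactor
    for the generator with index \<open>a\<close>.\<close>
  define V where "V = (\<Prod>a<rk 0. U a)"
  have Vp: "V \<notin> p" unfolding V_def by (rule prime_ideal_prod[OF p]) (use Uc in auto)
  define W where "W a = (\<Prod>b\<in>{..<rk 0} - {a}. U b)" for a
  have VW: "V = W a * U a" if "a < rk 0" for a
    unfolding V_def W_def using that by (simp add: prod.remove[of _ a] mult.commute)
  let ?C = "comb (rk 0) fsmult (\<lambda>a. fsmult (W a) (c a))"
  have cM: "fsmult (W a) (c a) \<in> freemod ?k" if "a < rk 0" for a using Uc[OF that] by simp
  have C: "lin (rk 0) ?k ?C" by (rule lin_comb[OF cM])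
  have EC: "?E (?C v) = s V (eps v)" if v: "v \<in> freemod (rk 0)" for v
  proof (rule hom_eqI[OF hom_comp[OF C E] hom_smult[OF M eps_hom] _ v])
    fix a assume a: "a < rk 0"
    have ea: "eps (unitv a) \<in> M" using is_homD(1)[OF eps_hom] a by simp
    have "?E (?C (unitv a)) = ?E (fsmult (W a) (c a))" using comb_unitv_free[OF cM a] by simp
    also have "\<dots> = s (W a) (s (U a) (eps (unitv a)))" using is_homD(3)[OF E, of "c a"] Uc[OF a] by simp
    also have "\<dots> = s V (eps (unitv a))" using is_moduleD(7)[OF M ea] VW[OF a] by simp
    finally show "?E (?C (unitv a)) = s V (eps (unitv a))" .
  qed
  have "\<exists>w. w \<notin> p \<and> w * ?C (d (Suc 0) (unitv i)) j = 0" if i: "i < rk (Suc 0)" and j: "j < ?k" for i j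
  proof -
    let ?b = "d (Suc 0) (unitv i)"
    have b: "?b \<in> freemod (rk 0)" using linD(1)[OF acycD(1)[OF D]] i by simp
    have "?E (?C ?b) = 0" using EC[OF b] eps_d i module_smult_zero_right[OF M] by simp
    define as where "as = map (?C ?b) [0..<?k]"
    have as: "length as = ?k" "\<And>j. j < ?k \<Longrightarrow> as ! j = ?C ?b j" by (simp_all add: as_def)
    have "(\<Sum>j<?k. s (as ! j) (xs ! j)) = ?E (?C ?b)" by (simp add: comb_def[of ?k] as)
    then have "s 1 (\<Sum>j<?k. s (as ! j) (xs ! j)) = 0"
      using \<open>?E (?C ?b) = 0\<close> module_smult_zero_right[OF M] by simp
    moreover have "1 \<notin> p" using p by (simp add: prime_ideal_def)
    ultimately have "\<exists>w. w \<notin> p \<and> w * as ! j = 0" using xs(3)[OF as(1)] j by blast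
    then show ?thesis using as(2)[OF j] by simp
  qed
  then obtain w where w: "\<And>i j. i < rk (Suc 0) \<Longrightarrow> j < ?k \<Longrightarrow> w i j \<notin> p \<and> w i j * ?C (d (Suc 0) (unitv i)) j = 0"
    by metis
  \<comment> \<open>Independence at \<open>p\<close> gives, for each coefficient of the image of
    each generating relation, a scalar outside \<open>p\<close> that kills it. The product
    \<open>Q\<close> kills them all, so the map descends to \<open>M\<close>.\<close>
  define Q where "Q = (\<Prod>i<rk (Suc 0). \<Prod>j<?k. w i j)"
  have Qp: "Q \<notin> p" unfolding Q_def
    by (intro prime_ideal_prod[OF p]) (use w in auto)
  have Q0: "Q * ?C (d (Suc 0) (unitv i)) j = 0" if i: "i < rk (Suc 0)" and j: "j < ?k" for i j
  proof -
    have "w i j dvd (\<Prod>j<?k. w i j)" using j by (intro dvd_prodI) auto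
    also have "\<dots> dvd Q" unfolding Q_def using i by (intro dvd_prodI) auto
    finally obtain e where e: "Q = w i j * e" by (auto simp: dvd_def)
    have "Q * ?C (d (Suc 0) (unitv i)) j = e * (w i j * ?C (d (Suc 0) (unitv i)) j)"
      unfolding e by (simp only: mult_ac)
    also have "\<dots> = 0" using conjunct2[OF w[OF i j]] by (simp only: mult_zero_right)
    finally show ?thesis .
  qed
  define h where "h v = fsmult Q (?C v)" for v
  have hl: "lin (rk 0) ?k h" unfolding h_def by (rule hom_smult[OF freemod_module C])
  have hk: "h (d (Suc 0) v) = 0" if v: "v \<in> freemod (rk (Suc 0))" for v
  proof (rule hom_eqI[OF hom_comp[OF acycD(1)[OF D] hl] lin_zero_map _ v])
    fix i assume i: "i < rk (Suc 0)"
    have m: "?C (d (Suc 0) (unitv i)) \<in> freemod ?k"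
      using linD(1)[OF C linD(1)[OF acycD(1)[OF D] unitv_in[OF i]]] .
    show "h (d (Suc 0) (unitv i)) = 0"
    proof
      fix j show "h (d (Suc 0) (unitv i)) j = 0 j"
        using Q0[OF i, of j] m by (cases "j < ?k") (auto simp: h_def fsmult_apply freemod_def)
    qed
  qed
  obtain \<kappa> where \<kappa>: "lin ?k (rk 0) \<kappa>" "\<forall>v\<in>freemod ?k. eps (\<kappa> v) = ?E v" using eps_lift[OF E] by blast
  have "lin (rk 0) (rk 0) (\<lambda>v. \<kappa> (h v))" by (rule hom_comp[OF hl \<kappa>(1)])
  moreover have "\<forall>v\<in>freemod (rk (Suc 0)). \<kappa> (h (d (Suc 0) v)) = 0" using hk lin_zero[OF \<kappa>(1)] by simp
  moreover have "eps (\<kappa> (h v)) = s (Q * V) (eps v)" if v: "v \<in> freemod (rk 0)" for v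
  proof -
    have "eps (\<kappa> (h v)) = ?E (fsmult Q (?C v))" using \<kappa>(2) linD(1)[OF hl v] by (simp add: h_def)
    also have "\<dots> = s Q (s V (eps v))" using is_homD(3)[OF E linD(1)[OF C v]] EC[OF v] by simp
    also have "\<dots> = s (Q * V) (eps v)" using is_moduleD(7)[OF M is_homD(1)[OF eps_hom v]] by simp
    finally show ?thesis .
  qed
  ultimately have "Q * V \<in> sann" unfolding sann_def by (intro CollectI exI[of _ "\<lambda>v. \<kappa> (h v)"]) blast
  then show ?thesis using pm[OF Qp Vp] by blast
qed

end

section \<open>Maximal Cohen--Macaulay modules over Gorenstein rings\<close>

locale local_resolved_module = resolved_module M s rk d eps + local_noeth "max_ideal TYPE('a)"
  for M :: "'m::ab_group_add set" and s :: "'a::comm_ring_1 \<Rightarrow> 'm \<Rightarrow> 'm" and rk d eps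
begin

lemma seq_submod_Suc:
  "seq_submod M s ys (Suc i) = {q + s (ys ! i) m | q m. q \<in> seq_submod M s ys i \<and> m \<in> M}"
proof (intro equalityI subsetI)
  fix z assume "z \<in> seq_submod M s ys (Suc i)"
  then obtain f where f: "z = (\<Sum>k<Suc i. s (ys ! k) (f k))" "\<forall>k<Suc i. f k \<in> M" unfolding seq_submod_def by blast
  have "z = (\<Sum>k<i. s (ys ! k) (f k)) + s (ys ! i) (f i)" using f(1) by simp
  moreover have "(\<Sum>k<i. s (ys ! k) (f k)) \<in> seq_submod M s ys i" unfolding seq_submod_def using f(2) by auto
  ultimately show "z \<in> {q + s (ys ! i) m | q m. q \<in> seq_submod M s ys i \<and> m \<in> M}" using f(2) by blast
next
  fix z assume "z \<in> {q + s (ys ! i) m | q m. q \<in> seq_submod M s ys i \<and> m \<in> M}"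
  then obtain f m where f: "z = (\<Sum>k<i. s (ys ! k) (f k)) + s (ys ! i) m" "\<forall>k<i. f k \<in> M" "m \<in> M"
    unfolding seq_submod_def by blast
  have "(\<Sum>k<i. s (ys ! k) (f k)) = (\<Sum>k<i. s (ys ! k) ((f(i := m)) k))" by (rule sum.cong) auto
  then have "z = (\<Sum>k<Suc i. s (ys ! k) ((f(i := m)) k))" using f(1) by simp
  moreover have "\<forall>k<Suc i. (f(i := m)) k \<in> M" using f by (auto simp: less_Suc_eq)
  ultimately show "z \<in> seq_submod M s ys (Suc i)" unfolding seq_submod_def by blast
qed

text \<open>Everything is pulled back along \<open>eps\<close> to the submodules \<open>?B i\<close>
  of the covering free module. As \<open>creg\<close> consumes the sequence from the front while
  enlarging the relations, the induction is on suffixes.\<close>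

lemma regular_seq_creg:
  assumes ys: "regular_seq M s ys"
  shows "creg (rk 0) (d (Suc 0) ` freemod (rk (Suc 0))) ys"
proof -
  let ?B = "\<lambda>i. {v \<in> freemod (rk 0). eps v \<in> seq_submod M s ys i}"
  have "i \<le> length ys \<Longrightarrow> creg (rk 0) (?B (length ys - i)) (drop (length ys - i) ys)" for i
  proof (induction i)
    case 0 then show ?case by simp
  next
    case (Suc i)
    define k where "k = length ys - Suc i"
    have k: "k < length ys" "length ys - i = Suc k" using Suc.prems by (auto simp: k_def)
    have "drop k ys = ys ! k # drop (Suc k) ys" using k(1) by (simp add: Cons_nth_drop_Suc)
    moreover have "ys ! k \<in> max_ideal TYPE('a)" using ys nth_mem[OF k(1)] unfolding regular_seq_def by blast
    moreover have "v \<in> ?B k" if v: "v \<in> freemod (rk 0)" "fsmult (ys ! k) v \<in> ?B k" for v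
    proof -
      have "s (ys ! k) (eps v) \<in> seq_submod M s ys k" using v(2) is_homD(3)[OF eps_hom v(1)] by simp
      then show ?thesis using ys k(1) v(1) is_homD(1)[OF eps_hom v(1)] unfolding regular_seq_def by blast
    qed
    moreover have "{b + fsmult (ys ! k) v | b v. b \<in> ?B k \<and> v \<in> freemod (rk 0)} = ?B (Suc k)"
    proof (intro equalityI subsetI)
      fix z assume "z \<in> {b + fsmult (ys ! k) v | b v. b \<in> ?B k \<and> v \<in> freemod (rk 0)}"
      then obtain b v where bv: "z = b + fsmult (ys ! k) v" "b \<in> freemod (rk 0)" "eps b \<in> seq_submod M s ys k" "v \<in> freemod (rk 0)"
        by blast
      have "eps z = eps b + s (ys ! k) (eps v)"
        unfolding bv(1) is_homD(2)[OF eps_hom bv(2) fm_smult[OF bv(4)]] is_homD(3)[OF eps_hom bv(4)] ..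
      then have "eps z \<in> seq_submod M s ys (Suc k)"
        unfolding seq_submod_Suc using bv(3) is_homD(1)[OF eps_hom bv(4)] by blast
      then show "z \<in> ?B (Suc k)" unfolding bv(1) using fm_add[OF bv(2) fm_smult[OF bv(4)]] by blast
    next
      fix z assume "z \<in> ?B (Suc k)"
      then obtain q m where z: "z \<in> freemod (rk 0)" "eps z = q + s (ys ! k) m" "q \<in> seq_submod M s ys k" "m \<in> M"
        unfolding seq_submod_Suc by blast
      have "m \<in> eps ` freemod (rk 0)" using z(4) eps_surj by simp
      then obtain w where w: "w \<in> freemod (rk 0)" "m = eps w" by (rule imageE)
      let ?b = "z - fsmult (ys ! k) w"
      have b: "?b \<in> freemod (rk 0)" by (rule fm_diff[OF z(1) fm_smult[OF w(1)]])
      have "eps ?b = q"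
        unfolding hom_diff[OF freemod_module eps_hom z(1) fm_smult[OF w(1)]] is_homD(3)[OF eps_hom w(1)] z(2) w(2) by simp
      then have "?b \<in> ?B k" using b z(3) by blast
      moreover have "z = ?b + fsmult (ys ! k) w" by simp
      ultimately show "z \<in> {b + fsmult (ys ! k) v | b v. b \<in> ?B k \<and> v \<in> freemod (rk 0)}" using w(1) by blast
    qed
    moreover have "creg (rk 0) (?B (Suc k)) (drop (Suc k) ys)" using Suc k by simp
    ultimately have "creg (rk 0) (?B k) (drop k ys)" by simp
    then show ?case unfolding k_def .
  qed
  from this[of "length ys"] have "creg (rk 0) (?B 0) ys" by simp
  moreover have "?B 0 = d (Suc 0) ` freemod (rk (Suc 0))" unfolding ker_eps by (auto simp: seq_submod_def)
  ultimately show ?thesis by simp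
qed

lemma regular_seq_nonzero: assumes "regular_seq M s ys" shows "M \<noteq> {0}"
proof
  assume "M = {0}"
  moreover have "0 \<in> seq_submod M s ys j" for j
    unfolding seq_submod_def using is_moduleD(1)[OF M] module_smult_zero_right[OF M]
    by (intro CollectI exI[of _ "\<lambda>_. 0"]) simp
  moreover have "seq_submod M s ys j \<subseteq> M" for j
    unfolding seq_submod_def using is_moduleD(4)[OF M] by (auto intro!: module_sum[OF M])
  ultimately have "seq_submod M s ys (length ys) = M" by blast
  then show False using assms by (simp add: regular_seq_def)
qed

text \<open>If \<open>Hom(M, R)\<close> vanished, the dual of the resolution would be a finite free resolution, and
  its Ext into \<open>R\<close> in degree \<open>N\<close> would be \<open>M\<close>.\<close>
lemma no_functionals_trivial:
  assumes V: "van ({0} :: 'a set) N" "N \<ge> 1"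
    and van0: "\<And>j c. cocyc {0} rk d (Suc j) c \<Longrightarrow> cobd {0} rk d j c"
    and no: "\<And>c. cocyc {0} rk d 0 c \<Longrightarrow> c = 0"
  shows "M = {0}"
proof -
  obtain r e where C: "acyc ({0} :: 'a set) r e" "\<forall>i\<le>N. r i = rk (N - i)"
    "\<forall>i<N. e (Suc i) = transp (rk (N - i)) (rk (N - Suc i)) (d (N - i))"
    "\<forall>v\<in>freemod (r (Suc N)). cocyc {0} rk d 0 (e (Suc N) v)"
    by (rule dual_resolution[OF D van0 V(2)])
  obtain k where k: "N = Suc k" using V(2) by (cases N) auto
  have ek: "e (Suc k) = transp (rk 1) (rk 0) (d 1)" "r (Suc k) = rk 0" "r k = rk 1"
    using C(3)[rule_format, of k] C(2)[rule_format, of N] C(2)[rule_format, of k] k by auto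
  have l: "lin (rk 1) (rk 0) (d 1)" using acycD(1)[OF D, of 0] by simp
  have "eps v = 0" if v: "v \<in> freemod (rk 0)" for v
  proof -
    \<comment> \<open>The values of this map are functionals on \<open>M\<close>; without nonzero
      ones it is zero, and every vector of the module covering \<open>M\<close> becomes a cocycle of
      degree \<open>N\<close>.\<close>
    have "e (Suc N) w = 0" if "w \<in> freemod (r (Suc N))" for w using C(4) that no by blast
    then have "cocyc {0} r e (Suc k) v"
      unfolding acyc_cocyc_iff[OF zero_ideal C(1)] using v ek k by simp
    then have "cobd {0} r e k v" using vanD[OF V(1) C(1)] k by simp
    then obtain b where b: "b \<in> freemod (rk 1)" "v = transp (rk 0) (rk 1) (transp (rk 1) (rk 0) (d 1)) b"
      unfolding cobd_def ek by auto
    have "v = d 1 b" using b(2) transp_transp[OF l b(1)] by simp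
    then show ?thesis using eps_d b(1) by simp
  qed
  then have "eps ` freemod (rk 0) \<subseteq> {0}" by blast
  then show ?thesis unfolding eps_surj using is_moduleD(1)[OF M] by blast
qed

lemma AR_ann_subset_stable_ann:
  assumes V: "van ({0} :: 'a set) N" and dim: "\<not> (\<exists>P :: nat \<Rightarrow> 'a set. prime_chain (Suc n) P)" and n: "n \<ge> 2"
    and ys: "regular_seq M s ys" "length ys = n" and lf: "locally_free_punctured M s"
  shows "AR_ann M s \<subseteq> stable_ann M s"
proof (cases "sann \<subseteq> max_ideal TYPE('a)")
  case False
  then obtain a where a: "a \<in> sann" "a \<notin> max_ideal TYPE('a)" by blast
  then obtain b where "a * b = 1" using units by blast
  then have "1 \<in> sann" using idealD(4)[OF sann_ideal a(1), of b] by simp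
  then show ?thesis using sann_one_stable by blast
next
  case True
  have pr: "p = max_ideal TYPE('a)" if p: "prime_ideal p" "sann \<subseteq> p" for p
    using free_at_sann[OF p(1)] p lf unfolding locally_free_punctured_def by blast
  obtain x t u where x: "t \<le> n" "regseq x t" "\<forall>i<t. x i \<in> sann" "u \<notin> idl x {..<t}"
    "\<forall>a\<in>max_ideal TYPE('a). u * a \<in> idl x {..<t}" "van (idl x {..<t}) 1" "van ({0} :: 'a set) (Suc t)"
    by (rule maximal_regular_sequence[OF sann_ideal True pr dim V])
  note cr = van_regular_cokernel[OF x(7) D regular_seq_creg[OF ys(1)]]
  have van0: "cobd {0} rk d j c" if "cocyc {0} rk d (Suc j) c" for j c
    using cr that x(1) ys(2) by auto
  \<comment> \<open>If \<open>ys\<close> were longer than \<open>t\<close>, which bounds the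
    injective dimension, \<open>M\<close> would have no nonzero functionals and would be
    zero.\<close>
  have "n \<le> t"
  proof (rule ccontr)
    assume "\<not> n \<le> t"
    then have "c = 0" if "cocyc {0} rk d 0 c" for c using cr that ys(2) by auto
    then have "M = {0}" using no_functionals_trivial[OF x(7) _ van0] by simp
    then show False using regular_seq_nonzero[OF ys(1)] by blast
  qed
  \<comment> \<open>This is where dimension at least 2 enters: \<open>t' + 1\<close> is
    \<open>t - 1\<close>, and it is a positive Ext degree.\<close>
  then obtain t' where t: "t = Suc (Suc t')" using n by (cases t; cases "t - 1") auto
  \<comment> \<open>With \<open>l = t\<close> in \<open>stable_module\<close>, the module is
    presented at position \<open>t + 2\<close>.\<close>
  define K where "K = Suc (Suc t)"
  obtain rk' d' where T: "acyc ({0} :: 'a set) rk' d'" "\<And>i. rk' (K + i) = rk i" "\<And>i. d' (Suc (K + i)) = d (Suc i)"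
    using high_syzygy[OF x(7) D van0, of K] by (auto simp: K_def)
  have T0: "rk' K = rk 0" "rk' (Suc K) = rk (Suc 0)" "d' (Suc K) = d (Suc 0)"
    using T(2)[of 0] T(2)[of 1] T(3)[of 0] by auto
  have kerK: "d' K v = 0 \<longleftrightarrow> eps v = 0" if v: "v \<in> freemod (rk 0)" for v
  proof
    assume "d' K v = 0"
    then have "d' (Suc (Suc t)) v \<in> vecs {0} (rk' (Suc t))" by (simp add: K_def)
    moreover have "v \<in> freemod (rk' (Suc (Suc t)))" using v T0(1) by (simp add: K_def)
    ultimately obtain w where "w \<in> freemod (rk' (Suc K))" "v - d' (Suc K) w \<in> vecs {0} (rk' K)"
      using acycD(3)[OF T(1), of v "Suc t"] unfolding K_def by blast
    then have "v = d (Suc 0) w" "w \<in> freemod (rk (Suc 0))" using T0 by simp_all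
    then show "eps v = 0" using eps_d by simp
  next
    assume "eps v = 0"
    then have "v \<in> d (Suc 0) ` freemod (rk (Suc 0))" unfolding ker_eps using v by blast
    then obtain w where w: "w \<in> freemod (rk (Suc 0))" "v = d (Suc 0) w" by (rule imageE)
    then have "w \<in> freemod (rk' (Suc (Suc (Suc t))))" using T0 by (simp add: K_def)
    from acycD(2)[OF T(1) this] show "d' K v = 0" using w T0(3) by (simp add: K_def)
  qed
  have "\<forall>i. \<exists>H. i < t \<longrightarrow> lin (rk 0) (rk 0) H \<and> (\<forall>v\<in>freemod (rk (Suc 0)). H (d (Suc 0) v) = 0) \<and>
     (\<forall>v\<in>freemod (rk 0). eps (H v) = s (x i) (eps v))" using x(3) unfolding sann_def by blast
  then obtain H where H: "\<And>i. i < t \<Longrightarrow> lin (rk 0) (rk 0) (H i) \<and> (\<forall>v\<in>freemod (rk (Suc 0)). H i (d (Suc 0) v) = 0) \<and>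
     (\<forall>v\<in>freemod (rk 0). eps (H i v) = s (x i) (eps v))" by metis
  interpret S: stable_module "max_ideal TYPE('a)" rk' d' t t x u H
  proof
    show "acyc {0} rk' d'" by (rule T(1))
    show "t \<le> t" by simp
    show "cobd {0} rk' d' j c" if j: "Suc (Suc t) \<le> j" "cocyc {0} rk' d' (Suc j) c" for j c
    proof -
      obtain i where i: "j = K + i" using j(1) le_Suc_ex unfolding K_def by blast
      have "rk' (K + i) = rk i" "rk' (Suc (K + i)) = rk (Suc i)" "rk' (Suc (Suc (K + i))) = rk (Suc (Suc i))"
        "d' (Suc (K + i)) = d (Suc i)" "d' (Suc (Suc (K + i))) = d (Suc (Suc i))"
        using T(2)[of i] T(2)[of "Suc i"] T(2)[of "Suc (Suc i)"] T(3)[of i] T(3)[of "Suc i"] by simp_all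
      then show ?thesis using van0[of i c] j(2) unfolding i cocyc_def cobd_def by simp
    qed
    show "regseq x t" by (rule x(2))
    show "x i \<in> max_ideal TYPE('a)" if "i < t" for i using x(3) True that by blast
    show "u \<notin> idl x {..<t}" "van (idl x {..<t}) 1" by (rule x(4), rule x(6))
    show "u * a \<in> idl x {..<t}" if "a \<in> max_ideal TYPE('a)" for a using x(5) that by blast
    fix i assume i: "i < t"
    show "lin (rk' (Suc (Suc t))) (rk' (Suc (Suc t))) (H i)" using H[OF i] T0(1) by (simp add: K_def)
    show "H i (d' (Suc (Suc (Suc t))) v) = 0" if "v \<in> freemod (rk' (Suc (Suc (Suc t))))" for v
      using H[OF i] T0 that by (simp add: K_def)
    show "d' (Suc (Suc t)) (H i v - fsmult (x i) v) = 0" if "v \<in> freemod (rk' (Suc (Suc t)))" for v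
    proof -
      have v: "v \<in> freemod (rk 0)" using that T0(1) by (simp add: K_def)
      have Hv: "H i v \<in> freemod (rk 0)" using H[OF i] linD(1) v by blast
      have "eps (H i v - fsmult (x i) v) = eps (H i v) - s (x i) (eps v)"
        unfolding hom_diff[OF freemod_module eps_hom Hv fm_smult[OF v]] is_homD(3)[OF eps_hom v] ..
      then have "eps (H i v - fsmult (x i) v) = 0" using H[OF i] v by simp
      then show ?thesis using kerK[OF fm_diff[OF Hv fm_smult[OF v]]] by (simp only: K_def)
    qed
  qed
  show ?thesis
  proof
    fix r assume r: "r \<in> AR_ann M s"
    show "r \<in> stable_ann M s"
      unfolding stable_ann_def
    proof (intro CollectI allI impI)
      fix f assume f: "is_hom M s M s f"
      obtain g where g: "lin (rk 0) (rk 0) g" "\<forall>v\<in>freemod (rk 0). eps (g v) = f (eps v)"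
        using eps_lift[OF hom_comp[OF eps_hom f]] by blast
      have rkK: "rk' (Suc (Suc t)) = rk 0" "rk' (Suc (Suc (Suc t))) = rk (Suc 0)" "d' (Suc (Suc (Suc t))) = d (Suc 0)"
        using T0 by (simp_all add: K_def)
      \<comment> \<open>Since \<open>t + t\<close> is \<open>K + t'\<close>, the Ext group required
        by \<open>stable_annihilation\<close> is the one of degree \<open>t' + 1\<close>, which has
        index \<open>t'\<close> in \<open>ext_ann\<close>.\<close>
      have rkt: "rk' (t + t) = rk t'" "rk' (Suc (t + t)) = rk (Suc t')" "rk' (Suc (Suc (t + t))) = rk (Suc (Suc t'))"
        "d' (Suc (t + t)) = d (Suc t')" "d' (Suc (Suc (t + t))) = d (Suc (Suc t'))"
        using T(2)[of t'] T(2)[of "Suc t'"] T(2)[of "Suc (Suc t')"] T(3)[of t'] T(3)[of "Suc t'"] by (simp_all add: K_def t)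
      have ker: "d' (Suc (Suc t)) v = 0 \<longleftrightarrow> eps v = 0" if "v \<in> freemod (rk 0)" for v using kerK[OF that] by (simp add: K_def)
      have "\<exists>h. lin (rk' (Suc (Suc t))) (rk' (Suc (Suc t))) h \<and> S.kills h \<and>
        (\<forall>v\<in>freemod (rk' (Suc (Suc t))). d' (Suc (Suc t)) (fsmult r (g v) - h v) = 0)"
      proof (rule S.stable_annihilation)
        show "lin (rk' (Suc (Suc t))) (rk' (Suc (Suc t))) g" using g(1) by (simp add: rkK)
        show "d' (Suc (Suc t)) (g (d' (Suc (Suc (Suc t))) v)) = 0" if v: "v \<in> freemod (rk' (Suc (Suc (Suc t))))" for v
        proof -
          have v': "v \<in> freemod (rk (Suc 0))" using v by (simp add: rkK)
          have dv: "d (Suc 0) v \<in> freemod (rk 0)" by (rule linD(1)[OF acycD(1)[OF D] v'])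
          have "eps (g (d (Suc 0) v)) = 0" using g(2) dv eps_d[OF v'] hom_zero[OF M f] by simp
          then show ?thesis using ker[OF linD(1)[OF g(1) dv]] by (simp add: rkK)
        qed
      next
        fix \<phi> assume \<phi>: "lin (rk' (Suc (t + t))) (rk' (Suc (Suc t))) \<phi>"
          "\<And>v. v \<in> freemod (rk' (Suc (Suc (t + t)))) \<Longrightarrow> d' (Suc (Suc t)) (\<phi> (d' (Suc (Suc (t + t))) v)) = 0"
        have \<phi>l: "lin (rk (Suc t')) (rk 0) \<phi>" using \<phi>(1) by (simp add: rkt rkK)
        have "eps (\<phi> (d (Suc (Suc t')) v)) = 0" if v: "v \<in> freemod (rk (Suc (Suc t')))" for v
        proof -
          have "\<phi> (d (Suc (Suc t')) v) \<in> freemod (rk 0)" by (rule linD(1)[OF \<phi>l linD(1)[OF acycD(1)[OF D] v]])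
          then show ?thesis using \<phi>(2)[of v] v ker by (simp add: rkt)
        qed
        from AR_ann_lift[OF r \<phi>l this] obtain \<chi> where \<chi>: "lin (rk t') (rk 0) \<chi>"
          "\<And>v. v \<in> freemod (rk (Suc t')) \<Longrightarrow> eps (fsmult r (\<phi> v) - \<chi> (d (Suc t') v)) = 0" by blast
        have "d' (Suc (Suc t)) (fsmult r (\<phi> v) - \<chi> (d (Suc t') v)) = 0" if v: "v \<in> freemod (rk (Suc t'))" for v
        proof -
          have "fsmult r (\<phi> v) - \<chi> (d (Suc t') v) \<in> freemod (rk 0)"
            by (rule fm_diff[OF fm_smult[OF linD(1)[OF \<phi>l v]] linD(1)[OF \<chi>(1) linD(1)[OF acycD(1)[OF D] v]]])
          then show ?thesis using ker \<chi>(2)[OF v] by blast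
        qed
        then show "\<exists>\<chi>. lin (rk' (t + t)) (rk' (Suc (Suc t))) \<chi> \<and>
          (\<forall>v\<in>freemod (rk' (Suc (t + t))). d' (Suc (Suc t)) (fsmult r (\<phi> v) - \<chi> (d' (Suc (t + t)) v)) = 0)"
          unfolding rkt rkK using \<chi>(1) by blast
      qed
      then obtain h where h: "lin (rk 0) (rk 0) h" "S.kills h"
        "\<And>v. v \<in> freemod (rk 0) \<Longrightarrow> d' (Suc (Suc t)) (fsmult r (g v) - h v) = 0" unfolding rkK by blast
      show "factors_free M s M s (\<lambda>y. s r (f y))"
      proof (rule factors_freeI[OF h(1)])
        show "h (d (Suc 0) v) = 0" if "v \<in> freemod (rk (Suc 0))" for v
          using h(2) that unfolding S.kills_def rkK by blast
        show "eps (h v) = s r (f (eps v))" if v: "v \<in> freemod (rk 0)" for v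
        proof -
          have gv: "g v \<in> freemod (rk 0)" and hv: "h v \<in> freemod (rk 0)" using linD(1)[OF g(1) v] linD(1)[OF h(1) v] by auto
          have "eps (fsmult r (g v) - h v) = 0" using h(3)[OF v] ker[OF fm_diff[OF fm_smult[OF gv] hv]] by blast
          then have "s r (eps (g v)) - eps (h v) = 0"
            unfolding hom_diff[OF freemod_module eps_hom fm_smult[OF gv] hv] is_homD(3)[OF eps_hom gv] .
          then show ?thesis using g(2) v by simp
        qed
      qed
    qed
  qed
qed

end

lemma krull_dim_unique:
  assumes "krull_dim_eq TYPE('a::comm_ring_1) n" "krull_dim_eq TYPE('a) m" shows "n = m"
proof -
  have chain: "\<exists>P :: nat \<Rightarrow> 'a set. prime_chain k P" if "\<exists>P :: nat \<Rightarrow> 'a set. prime_chain j P" "k \<le> j" for j k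
    using that unfolding prime_chain_def by (meson order.trans order.strict_trans2)
  have "\<not> n < m" if "krull_dim_eq TYPE('a) n" "krull_dim_eq TYPE('a) m" for n m
    using that chain[of m "Suc n"] unfolding krull_dim_eq_def by (meson Suc_leI)
  then show ?thesis using assms by (meson linorder_neqE_nat)
qed

theorem mainTheorem1:
  fixes M :: "'m::ab_group_add set" and s :: "'a::comm_ring_1 \<Rightarrow> 'm \<Rightarrow> 'm" and d :: nat
  assumes "gorenstein TYPE('a)"
    and "krull_dim_eq TYPE('a) d" and "d \<ge> 2"
    and "is_module M s" and "fin_gen M s"
    and "max_CM M s"
    and "locally_free_punctured M s"
  shows "stable_ann M s = AR_ann M s"
proof
  show "stable_ann M s \<subseteq> AR_ann M s"
  proof
    fix r assume r: "r \<in> stable_ann M s"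
    have "r \<in> cx_ext_ann rk e (M \<times> (UNIV :: 'a set)) (sum_smult s) j" if "free_res M s rk e eps" for rk e eps j
    proof -
      interpret resolved_module M s rk e eps by standard (rule assms(4), rule that)
      show ?thesis by (rule sann_ext_ann[OF stable_ann_sann[OF r]])
    qed
    then show "r \<in> AR_ann M s" unfolding AR_ann_def ext_ann_def by blast
  qed
  have N: "noetherian_ring TYPE('a)" "local_ring TYPE('a)" using assms(1) by (auto simp: gorenstein_def)
  interpret L: local_noeth "max_ideal TYPE('a)" by (rule noetherian_local_noeth[OF N])
  obtain rk e eps where res: "free_res M s rk e eps" using free_res_exists[OF L.noeth assms(4,5)] by blast
  interpret local_resolved_module M s rk e eps
    by (intro local_resolved_module.intro resolved_module.intro L.local_noeth_axioms assms(4) res)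
  obtain n where n: "krull_dim_eq TYPE('a) n" "depth_eq M s n" using assms(6) unfolding max_CM_def by blast
  have "n = d" by (rule krull_dim_unique[OF n(1) assms(2)])
  then obtain ys where ys: "length ys = d" "regular_seq M s ys" using n(2) unfolding depth_eq_def by blast
  obtain N where V: "van ({0} :: 'a set) N" using gorenstein_van[OF assms(1)] by blast
  have "\<not> (\<exists>P :: nat \<Rightarrow> 'a set. prime_chain (Suc d) P)" using assms(2) by (simp add: krull_dim_eq_def)
  then show "AR_ann M s \<subseteq> stable_ann M s"
    by (rule AR_ann_subset_stable_ann[OF V _ assms(3) ys(2,1) assms(7)])
qed

end
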